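(* Let $C\subset\mathbb{R}^d$ be a closed convex cone with $\emptyset\subsetneq C\subsetneq\mathbb{R}^d$. Let $\mathbf{g}\sim\mathcal{N}(0,I_d)$, $G_C=\|\Pi_C(\mathbf{g})\|^2$, $\delta_C=E[G_C]$, $\sigma_C^2=\mathrm{Var}(G_C)$ and $\tau_C^2=\mathrm{Var}(V_C)$. Then $$\tau_C^2\le2\delta_C\quad\text{and}\quad2\delta_C\le\sigma_C^2\le4\delta_C.$$ In addition, if $\delta_C>0$ and $N\sim\mathcal{N}(0,\sigma_C^2)$, one has $$d_{TV}(G_C-\delta_C,N)\le\frac{16\sqrt{\delta_C}}{\sigma_C^2}\le\frac{8}{\sqrt{\delta_C}},$$ and, if $C$ is self dual (i.e. $C^0=-C$), then $$d_{TV}(G_C-\delta_C,N)\le\frac{8\sqrt{2}}{\sqrt{d}}.$$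
   Context: For a non-empty closed convex cone $C\subset\mathbb{R}^d$, $\Pi_C(\mathbf{x})$ denotes the metric projection of $\mathbf{x}$ onto $C$ and $C^0=\{\mathbf{y}:\langle\mathbf{y},\mathbf{x}\rangle\le0\ \forall\mathbf{x}\in C\}$ is the polar cone. The conic intrinsic volumes $v_0,\dots,v_d$ of $C$ are the uniquely determined nonnegative numbers summing to one such that, for $\mathbf{g}\sim\mathcal{N}(0,I_d)$ and every bounded measurable $f:\mathbb{R}_+^2\to\mathbb{R}$, $$E f(\|\Pi_C(\mathbf{g})\|^2,\|\Pi_{C^0}(\mathbf{g})\|^2)=\sum_{j=0}^d v_j\,E f(Y_j,Y'_{d-j}),$$ where the $Y_j,Y_j'$ are independent with chi-squared distributions with $j$ degrees of freedom ($\chi^2_0$ is the point mass at $0$). $V_C$ denotes a random variable with $P(V_C=j)=v_j$, $j=0,\dots,d$. The total variation distance is $d_{TV}(F,G)=\sup_A|P(F\in A)-P(G\in A)|$ over all Borel sets $A\subset\mathbb{R}$. *)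

theory Defs
  imports "HOL-Probability.Probability"
begin

definition std_gaussian_density :: "'a::euclidean_space \<Rightarrow> real" where
  "std_gaussian_density x = (\<Prod>b\<in>Basis. std_normal_density (x \<bullet> b))"

definition polar_cone :: "'a::real_inner set \<Rightarrow> 'a set" where
  "polar_cone C = {y. \<forall>x\<in>C. y \<bullet> x \<le> 0}"

(* For k = 0 the product measure is a point mass and the sum is empty, so this is the
   point mass at 0. *)
definition chi_squared :: "nat \<Rightarrow> real measure" where
  "chi_squared k =
     distr (Pi\<^sub>M {..<k} (\<lambda>_. density lborel std_normal_density)) borel (\<lambda>x. \<Sum>i<k. (x i)\<^sup>2)"

(* "v 0, ..., v d are the conic intrinsic volumes of C", where d is the dimension of the
   ambient space; the values of v beyond d are irrelevant.  The test functions are defined on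
   the whole plane, but only their values on the nonnegative quadrant matter. *)
definition conic_intrinsic_volumes :: "'a::euclidean_space set \<Rightarrow> (nat \<Rightarrow> real) \<Rightarrow> bool" where
  "conic_intrinsic_volumes C v \<longleftrightarrow>
     (\<forall>j\<le>DIM('a). 0 \<le> v j) \<and> (\<Sum>j\<le>DIM('a). v j) = 1 \<and>
     (\<forall>f :: real \<times> real \<Rightarrow> real. f \<in> borel_measurable borel \<longrightarrow> bounded (range f) \<longrightarrow>
        (\<integral>x. f ((norm (closest_point C x))\<^sup>2, (norm (closest_point (polar_cone C) x))\<^sup>2)
            \<partial>density lborel std_gaussian_density)
        = (\<Sum>j\<le>DIM('a). v j * (\<integral>p. f p \<partial>(chi_squared j \<Otimes>\<^sub>M chi_squared (DIM('a) - j)))))"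

(* V is a random variable on Q whose law on 0, ..., d is given by the conic intrinsic volumes
   of C; since these sum to one, V \<le> d almost surely. *)
definition intrinsic_volume_variable ::
    "'a::euclidean_space set \<Rightarrow> 'b measure \<Rightarrow> ('b \<Rightarrow> nat) \<Rightarrow> bool" where
  "intrinsic_volume_variable C Q V \<longleftrightarrow>
     prob_space Q \<and> V \<in> measurable Q (count_space UNIV) \<and>
     (\<exists>v. conic_intrinsic_volumes C v \<and>
        (\<forall>j\<le>DIM('a). measure Q {\<omega> \<in> space Q. V \<omega> = j} = v j))"

definition tv_dist :: "'a measure \<Rightarrow> ('a \<Rightarrow> real) \<Rightarrow> 'b measure \<Rightarrow> ('b \<Rightarrow> real) \<Rightarrow> real" where
  "tv_dist P F Q G =
     (SUP A\<in>sets (borel :: real measure).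
        \<bar>measure P {\<omega> \<in> space P. F \<omega> \<in> A} - measure Q {\<omega> \<in> space Q. G \<omega> \<in> A}\<bar>)"

end

theory Submission
  imports Defs
begin

text \<open>Let \<open>a x = |\<Pi> x|\<^sup>2\<close>, where \<open>\<Pi>\<close> is the projection onto the cone, and let \<open>x\<close>, \<open>y\<close> be
independent standard Gaussian vectors. The proof rests on the covariance formula
\<open>Cov (F x) (H x) = \<integral> E (DF x \<bullet> DH (s x + sqrt (1 - s\<^sup>2) y)) ds\<close> over \<open>0 \<le> s \<le> 1\<close>.
Lemma \<open>gauss_covariance\<close> has it with Riemann sums in place of the integral: the correlation of
the two arguments is raised from 0 to 1 in \<open>n\<close> steps, and since the Ornstein-Uhlenbeck operators are
reversible, each step is half the mean of a product of two increments, which a first order expansion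
evaluates. Only gradients with a Lipschitz bound enter, and \<open>a\<close> has such a gradient, \<open>2 \<Pi>\<close>.

The bounds on the variance. For \<open>F = H = a\<close> the formula and Cauchy-Schwarz give
\<open>\<sigma>\<^sup>2 \<le> E |2 \<Pi> x|\<^sup>2 = 4 \<delta>\<close>. For the lower bound write \<open>|x|\<^sup>2 = a x + b x\<close> with
\<open>b x = |x - \<Pi> x|\<^sup>2\<close>. The gradient of \<open>b\<close> takes its values in the polar cone, so the formula shows
\<open>Cov a b \<le> 0\<close>; it also shows \<open>Cov a |x|\<^sup>2 = 2 \<delta>\<close>, and the difference is \<open>\<sigma>\<^sup>2 \<ge> 2 \<delta>\<close>.
Testing the defining property of the intrinsic volumes with (truncations of) the first two powers of
the first coordinate, and using the chi-squared moments \<open>j\<close> and \<open>j\<^sup>2 + 2 j\<close>, gives \<open>E V = \<delta>\<close> and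
\<open>\<tau>\<^sup>2 = \<sigma>\<^sup>2 - 2 \<delta>\<close>, hence \<open>\<tau>\<^sup>2 \<le> 2 \<delta>\<close>.

The normal approximation. Put \<open>S = (a - \<delta>) / \<sigma>\<close>. Stein's equation
\<open>g' v - v g v = h v - E h\<close> (the mean taken under the standard normal law) has a solution with
\<open>|g'| \<le> 2\<close> when \<open>0 \<le> h \<le> 1\<close>. The covariance formula for \<open>g S\<close> and \<open>S\<close> expresses
\<open>E (S g S) - E (g' S)\<close> as the average over \<open>s\<close> of \<open>(4 / \<sigma>\<^sup>2) E (g' S (t - E t))\<close>, where
\<open>t = \<Pi> x \<bullet> \<Pi> (s x + sqrt (1 - s\<^sup>2) y)\<close>. As a function on the doubled space \<open>t\<close> is locally Lipschitz
with local constant \<open>|\<Pi> x| + |\<Pi> (s x + sqrt (1 - s\<^sup>2) y)|\<close>, so the Poincare inequality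
\<open>gauss_poincare\<close> bounds its variance by \<open>4 \<delta>\<close>. This yields \<open>(4 / \<sigma>\<^sup>2) 2 (2 sqrt \<delta>)\<close>, the bound
claimed, for Lipschitz \<open>h\<close>; closed sets and inner regularity carry it over to Borel sets. Finally
\<open>\<sigma>\<^sup>2 \<ge> 2 \<delta>\<close> gives the bound in terms of \<open>\<delta>\<close> alone, and a self-dual cone has \<open>\<delta> = d / 2\<close> because
\<open>a (-x) = b x\<close>.\<close>

text \<open>These names single out the facts on the Lebesgue integral among their namesakes for the
Henstock-Kurzweil integral.\<close>
lemmas expectation_cong = Bochner_Integration.integral_cong
  and expectation_mono = Bochner_Integration.integral_mono
  and expectation_norm_bound = Bochner_Integration.integral_norm_bound_integral
  and expectation_add = Bochner_Integration.integral_add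
  and expectation_sum = Bochner_Integration.integral_sum
  and expectation_nonneg = Bochner_Integration.integral_nonneg

section \<open>The standard Gaussian measure\<close>

definition gauss :: "'a::euclidean_space measure" where
  "gauss = density lborel (\<lambda>x. ennreal (std_gaussian_density x))"

lemma std_gaussian_density_eq:
  "std_gaussian_density (x::'a::euclidean_space)
     = (1 / sqrt (2 * pi)) ^ DIM('a) * exp (- (norm x)\<^sup>2 / 2)"
proof -
  have "(\<Sum>b\<in>Basis. - (x \<bullet> b)\<^sup>2 / 2) = - (norm x)\<^sup>2 / 2"
    by (subst power2_norm_eq_inner, subst euclidean_inner)
       (simp add: sum_negf power2_eq_square flip: sum_divide_distrib)
  then show ?thesis
    unfolding std_gaussian_density_def std_normal_density_def prod.distrib
    by (simp flip: exp_sum)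
qed

lemma std_gaussian_density_nonneg [simp]: "0 \<le> std_gaussian_density x"
  by (simp add: std_gaussian_density_eq)

lemma borel_measurable_std_gaussian_density [measurable]:
  "std_gaussian_density \<in> borel_measurable borel"
  unfolding std_gaussian_density_eq[abs_def] by measurable

lemma space_gauss [simp]: "space gauss = UNIV"
  and sets_gauss [simp, measurable_cong]: "sets gauss = sets borel"
  by (auto simp: gauss_def)

lemma prob_space_gauss: "prob_space (gauss :: 'a::euclidean_space measure)"
proof
  have "emeasure (gauss :: 'a measure) (space gauss)
      = (\<integral>\<^sup>+x. (\<Prod>b\<in>Basis. ennreal (std_normal_density ((x::'a) \<bullet> b))) \<partial>lborel)"
    unfolding gauss_def std_gaussian_density_def
    by (simp add: emeasure_density prod_ennreal)
  also have "\<dots> = (\<Prod>b\<in>(Basis::'a set). (\<integral>\<^sup>+x. ennreal (std_normal_density x) \<partial>lborel))"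
    by (subst nn_integral_lborel_prod) auto
  also have "\<dots> = 1"
    by (simp add: nn_integral_eq_integral)
  finally show "emeasure (gauss :: 'a measure) (space gauss) = 1" .
qed

interpretation gauss: prob_space gauss
  by (rule prob_space_gauss)

interpretation gauss_pair: pair_prob_space gauss gauss ..

lemma gauss_prod: "(gauss :: ('a::euclidean_space \<times> 'b::euclidean_space) measure) = gauss \<Otimes>\<^sub>M gauss"
proof -
  have "gauss \<Otimes>\<^sub>M gauss = density (lborel \<Otimes>\<^sub>M lborel)
    (\<lambda>(x::'a, y::'b). ennreal (std_gaussian_density x) * ennreal (std_gaussian_density y))"
    unfolding gauss_def
    by (rule pair_measure_density)
       (auto simp: gauss_def[symmetric] intro: prob_space_imp_sigma_finite prob_space_gauss
          sigma_finite_lborel)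
  also have "\<dots> = gauss"
    unfolding gauss_def lborel_prod
    by (intro density_cong)
       (auto simp: std_gaussian_density_eq norm_prod_def power_add add_divide_distrib exp_add
         case_prod_beta borel_prod[symmetric] simp flip: ennreal_mult' exp_add
       intro!: AE_I2 arg_cong[where f=ennreal])
  finally show ?thesis ..
qed

lemma nn_integral_lborel_affine:
  fixes f :: "'a::euclidean_space \<Rightarrow> ennreal"
  assumes "c \<noteq> 0" and [measurable]: "f \<in> borel_measurable borel"
  shows "(\<integral>\<^sup>+x. f x \<partial>lborel) = ennreal (\<bar>c\<bar> ^ DIM('a)) * (\<integral>\<^sup>+x. f (t + c *\<^sub>R x) \<partial>lborel)"
  by (subst lborel_affine[OF assms(1), of t])
     (simp add: nn_integral_density nn_integral_distr nn_integral_cmult)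

lemma integral_lborel_translate:
  fixes f :: "'a::euclidean_space \<Rightarrow> real"
  assumes [measurable]: "f \<in> borel_measurable borel"
  shows "(\<integral>x. f (x + u) \<partial>lborel) = (\<integral>x. f x \<partial>lborel)"
  by (subst (2) lborel_distr_plus[of u, symmetric], subst integral_distr) (simp_all add: add.commute)

text \<open>Two one-variable substitutions, one in each factor of the product, realise the linear map; their
Jacobians \<open>|c|\<^sup>d\<close> and \<open>|c|\<^sup>-\<^sup>d\<close> cancel. The reflection is used rather than the rotation because it
is an involution, so that it will exchange the two arguments of a correlated pair.\<close>
lemma nn_integral_lborel_reflection:
  fixes f :: "'a::euclidean_space \<times> 'a \<Rightarrow> ennreal"
  assumes cs: "c\<^sup>2 + s\<^sup>2 = 1" and c: "c \<noteq> 0" and [measurable]: "f \<in> borel_measurable borel"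
  shows "(\<integral>\<^sup>+p. f (c *\<^sub>R fst p + s *\<^sub>R snd p, s *\<^sub>R fst p - c *\<^sub>R snd p) \<partial>lborel) = (\<integral>\<^sup>+p. f p \<partial>lborel)"
proof -
  define d where "d = ennreal (\<bar>c\<bar> ^ DIM('a))"
  have d: "d \<noteq> 0" "d < \<top>" using c by (auto simp: d_def)
  have sc: "s * s = 1 - c * c" using cs by (simp add: power2_eq_square)
  have [measurable]: "f \<in> borel_measurable (borel \<Otimes>\<^sub>M borel)"
    by (simp add: borel_prod)
  have [measurable]: "(\<lambda>(x, y). f (x, y)) \<in> borel_measurable (lborel \<Otimes>\<^sub>M lborel)"
      "(\<lambda>p. f p) \<in> borel_measurable (lborel \<Otimes>\<^sub>M lborel)"
    by (simp_all add: lborel_prod)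
  have m1 [measurable]: "(\<lambda>(x, y). f (c *\<^sub>R x + s *\<^sub>R y, s *\<^sub>R x - c *\<^sub>R y)) \<in> borel_measurable (lborel \<Otimes>\<^sub>M lborel)"
    by measurable
  have m2 [measurable]: "(\<lambda>(u, y). f (u, (1 / c) *\<^sub>R (s *\<^sub>R u - y))) \<in> borel_measurable (lborel \<Otimes>\<^sub>M lborel)"
    by measurable
  \<comment> \<open>First \<open>u = c x + s y\<close> replaces \<open>x\<close>; then \<open>(s u - y) / c\<close>, which is the second component, replaces \<open>y\<close>.\<close>
  have "(\<integral>\<^sup>+p. f (c *\<^sub>R fst p + s *\<^sub>R snd p, s *\<^sub>R fst p - c *\<^sub>R snd p) \<partial>lborel)
      = (\<integral>\<^sup>+y. \<integral>\<^sup>+x. f (c *\<^sub>R x + s *\<^sub>R y, s *\<^sub>R x - c *\<^sub>R y) \<partial>lborel \<partial>lborel)"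
    using lborel_pair.nn_integral_snd[OF m1] by (simp add: lborel_prod case_prod_unfold)
  then have "d * (\<integral>\<^sup>+p. f (c *\<^sub>R fst p + s *\<^sub>R snd p, s *\<^sub>R fst p - c *\<^sub>R snd p) \<partial>lborel)
      = (\<integral>\<^sup>+y. d * (\<integral>\<^sup>+x. f (c *\<^sub>R x + s *\<^sub>R y, s *\<^sub>R x - c *\<^sub>R y) \<partial>lborel) \<partial>lborel)"
    by (simp add: nn_integral_cmult)
  also have "\<dots> = (\<integral>\<^sup>+y. (\<integral>\<^sup>+u. f (u, (1 / c) *\<^sub>R (s *\<^sub>R u - y)) \<partial>lborel) \<partial>lborel)"
  proof (rule nn_integral_cong)
    fix y :: 'a
    have eq: "(1 / c) *\<^sub>R (s *\<^sub>R (s *\<^sub>R y + c *\<^sub>R x) - y) = s *\<^sub>R x - c *\<^sub>R y" for x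
    proof -
      have "s *\<^sub>R (s *\<^sub>R y + c *\<^sub>R x) - y = c *\<^sub>R (s *\<^sub>R x - c *\<^sub>R y)"
        by (simp add: scaleR_add_right scaleR_diff_right scaleR_diff_left sc mult.commute)
      then show ?thesis using c by simp
    qed
    show "d * (\<integral>\<^sup>+x. f (c *\<^sub>R x + s *\<^sub>R y, s *\<^sub>R x - c *\<^sub>R y) \<partial>lborel)
      = (\<integral>\<^sup>+u. f (u, (1 / c) *\<^sub>R (s *\<^sub>R u - y)) \<partial>lborel)"
      using nn_integral_lborel_affine[OF c, where t="s *\<^sub>R y" and
          f="\<lambda>u. f (u, (1 / c) *\<^sub>R (s *\<^sub>R u - y))"]
      unfolding d_def eq by (simp add: add.commute)
  qed
  also have "\<dots> = (\<integral>\<^sup>+u. (\<integral>\<^sup>+y. f (u, (1 / c) *\<^sub>R (s *\<^sub>R u - y)) \<partial>lborel) \<partial>lborel)"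
    by (rule lborel_pair.Fubini') simp
  also have "\<dots> = (\<integral>\<^sup>+u. d * (\<integral>\<^sup>+w. f (u, w) \<partial>lborel) \<partial>lborel)"
  proof (rule nn_integral_cong)
    fix u :: 'a
    have e: "ennreal (\<bar>- 1 / c\<bar> ^ DIM('a)) = inverse d"
      using c by (simp add: d_def power_one_over inverse_ennreal inverse_eq_divide)
    have "(\<integral>\<^sup>+w. f (u, w) \<partial>lborel) = inverse d * (\<integral>\<^sup>+y. f (u, (1 / c) *\<^sub>R (s *\<^sub>R u - y)) \<partial>lborel)"
      using c e by (subst nn_integral_lborel_affine[where c="- 1 / c" and t="(s / c) *\<^sub>R u"])
         (simp_all add: scaleR_diff_right)
    then show "(\<integral>\<^sup>+y. f (u, (1 / c) *\<^sub>R (s *\<^sub>R u - y)) \<partial>lborel) = d * (\<integral>\<^sup>+w. f (u, w) \<partial>lborel)"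
      using ennreal_divide_self[OF d] by (simp add: divide_ennreal_def mult.assoc[symmetric])
  qed
  also have "\<dots> = d * (\<integral>\<^sup>+p. f p \<partial>lborel)"
    using lborel.nn_integral_fst[of f lborel]
    by (simp add: nn_integral_cmult lborel_prod)
  finally show ?thesis
    using d by (auto simp: ennreal_mult_cancel_left)
qed

text \<open>The Gaussian density depends on the norm alone, and the reflection is an isometry preserving
Lebesgue measure. If \<open>c = 0\<close>, the map just swaps the two components.\<close>
lemma distr_gauss_reflection:
  assumes "c\<^sup>2 + s\<^sup>2 = 1" "0 \<le> s"
  shows "distr gauss borel (\<lambda>p. (c *\<^sub>R fst p + s *\<^sub>R snd p, s *\<^sub>R fst p - c *\<^sub>R snd p))
    = (gauss :: ('a::euclidean_space \<times> 'a) measure)"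
proof (cases "c = 0")
  case True
  then have "s = 1" using assms by (simp add: power2_eq_1_iff)
  with True show ?thesis
    unfolding gauss_prod
    by (subst (2) gauss_pair.distr_pair_swap)
       (auto intro!: distr_cong simp: sets_pair_measure_cong[OF sets_gauss sets_gauss] borel_prod[symmetric])
next
  case False
  let ?R = "\<lambda>p::'a \<times> 'a. (c *\<^sub>R fst p + s *\<^sub>R snd p, s *\<^sub>R fst p - c *\<^sub>R snd p)"
  have [measurable]: "?R \<in> borel_measurable borel"
    by (intro borel_measurable_continuous_onI continuous_intros)
  have n: "std_gaussian_density (?R p) = std_gaussian_density p" for p
  proof -
    have "(norm (?R p))\<^sup>2 = (c\<^sup>2 + s\<^sup>2) * (norm p)\<^sup>2"
      unfolding power2_norm_eq_inner
      by (cases p) (simp add: inner_prod_def inner_simps algebra_simps inner_commute power2_eq_square)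
    then show ?thesis using assms by (simp add: std_gaussian_density_eq)
  qed
  show ?thesis
  proof (rule measure_eqI)
    fix A assume "A \<in> sets (distr gauss borel ?R)"
    then have [measurable]: "A \<in> sets borel" by simp
    have "emeasure (distr gauss borel ?R) A = (\<integral>\<^sup>+p. indicator A (?R p) \<partial>gauss)"
      by (simp add: nn_integral_distr flip: nn_integral_indicator)
    also have "\<dots> = (\<integral>\<^sup>+p. (\<lambda>p. ennreal (std_gaussian_density p) * indicator A p) (?R p) \<partial>lborel)"
      by (simp add: gauss_def nn_integral_density n)
    also have "\<dots> = (\<integral>\<^sup>+p. ennreal (std_gaussian_density p) * indicator A p \<partial>lborel)"
      by (rule nn_integral_lborel_reflection[OF assms(1) False]) simp
    also have "\<dots> = emeasure gauss A"
      by (simp add: gauss_def emeasure_density)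
    finally show "emeasure (distr gauss borel ?R) A = emeasure gauss A" .
  qed simp
qed

text \<open>Completing the square, \<open>l r - r\<^sup>2 / 2 \<le> l\<^sup>2 - r\<^sup>2 / 4\<close>: the integrand times the density is dominated by
a multiple of a Gaussian density of twice the variance.\<close>
lemma integrable_exp_norm:
  "integrable gauss (\<lambda>x::'a::euclidean_space. exp (l * norm x))"
proof -
  let ?d = "1 / sqrt (2 * pi) :: real"
  have "(\<integral>\<^sup>+x. ennreal (exp (l * norm x)) \<partial>(gauss::'a measure))
     \<le> (\<integral>\<^sup>+x. ennreal (exp (l\<^sup>2)) * ennreal (std_gaussian_density ((1 / sqrt 2) *\<^sub>R x)) \<partial>(lborel::'a measure))"
    unfolding gauss_def
  proof (subst nn_integral_density, simp, simp, intro nn_integral_mono)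
    fix x :: 'a
    have "l * norm x \<le> l\<^sup>2 + (norm x)\<^sup>2 / 4"
      using zero_le_power2[of "l - norm x / 2"] by (simp add: power2_eq_square algebra_simps)
    then have "- (norm x)\<^sup>2 / 2 + l * norm x \<le> l\<^sup>2 - (norm x)\<^sup>2 / 4" by simp
    then have "exp (- (norm x)\<^sup>2 / 2) * exp (l * norm x) \<le> exp (l\<^sup>2) * exp (- (norm x)\<^sup>2 / 4)"
      by (simp flip: exp_add)
    then have "std_gaussian_density x * exp (l * norm x)
         \<le> exp (l\<^sup>2) * std_gaussian_density ((1 / sqrt 2) *\<^sub>R x)"
      unfolding std_gaussian_density_eq
      by (simp add: power_divide power_mult_distrib mult.assoc mult.left_commute[of "exp (l\<^sup>2)"] divide_simps)
    then show "ennreal (std_gaussian_density x) * ennreal (exp (l * norm x))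
        \<le> ennreal (exp (l\<^sup>2)) * ennreal (std_gaussian_density ((1 / sqrt 2) *\<^sub>R x))"
      by (simp flip: ennreal_mult')
  qed
  also have "\<dots> = ennreal (exp (l\<^sup>2)) * (ennreal (sqrt 2 ^ DIM('a)) * emeasure (gauss::'a measure) UNIV)"
    by (subst nn_integral_cmult, simp, subst nn_integral_lborel_affine[where c="sqrt 2" and t=0])
       (auto simp: gauss_def emeasure_density)
  also have "\<dots> < \<infinity>"
    using gauss.emeasure_space_1[where 'a='a] by (simp add: ennreal_mult_less_top)
  finally show ?thesis
    by (intro integrableI_nonneg) auto
qed

lemma integral_lborel_prod:
  fixes f :: "'a::euclidean_space \<Rightarrow> real \<Rightarrow> real"
  assumes int: "\<And>b. b \<in> Basis \<Longrightarrow> integrable lborel (f b)"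
  shows "(\<integral>x. (\<Prod>b\<in>Basis. f b (x \<bullet> b)) \<partial>lborel) = (\<Prod>b\<in>Basis. \<integral>t. f b t \<partial>lborel)"
proof -
  interpret product_sigma_finite "\<lambda>_::'a. lborel :: real measure" ..
  have [measurable]: "f b \<in> borel_measurable borel" if "b \<in> Basis" for b
    using int[OF that] by simp
  have "(\<integral>x. (\<Prod>b\<in>Basis. f b (x \<bullet> b)) \<partial>lborel)
    = (\<integral>x. (\<Prod>b\<in>Basis. f b (x b)) \<partial>(\<Pi>\<^sub>M b\<in>(Basis::'a set). lborel))"
    by (subst lborel_eq, subst integral_distr) (auto intro!: expectation_cong prod.cong)
  also have "\<dots> = (\<Prod>b\<in>Basis. \<integral>t. f b t \<partial>lborel)"
    by (rule product_integral_prod) (auto intro: int)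
  finally show ?thesis .
qed

lemma integral_gauss:
  fixes f :: "'a::euclidean_space \<Rightarrow> real"
  assumes [measurable]: "f \<in> borel_measurable borel"
  shows "(\<integral>x. f x \<partial>gauss) = (\<integral>x. std_gaussian_density x * f x \<partial>lborel)"
  unfolding gauss_def by (subst integral_density) auto

section \<open>Functions of at most exponential growth\<close>

text \<open>This class is closed under sums, products and linear substitutions, and its measurable members are
Gaussian integrable. All integrability conditions below reduce to membership in it.\<close>
definition exp_bounded :: "('a::real_normed_vector \<Rightarrow> 'b::real_normed_vector) \<Rightarrow> bool" where
  "exp_bounded f \<longleftrightarrow> (\<exists>K l. 0 \<le> K \<and> 0 \<le> l \<and> (\<forall>x. norm (f x) \<le> K * exp (l * norm x)))"

lemma exp_boundedI:
  assumes "0 \<le> K" "0 \<le> l" "\<And>x. norm (f x) \<le> K * exp (l * norm x)"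
  shows "exp_bounded f"
  using assms unfolding exp_bounded_def by blast

lemma exp_boundedE:
  assumes "exp_bounded f"
  obtains K l where "0 \<le> K" "0 \<le> l" "\<And>x. norm (f x) \<le> K * exp (l * norm x)"
  using assms unfolding exp_bounded_def by blast

lemma exp_bounded_mono:
  assumes "exp_bounded g" "\<And>x. norm (f x) \<le> norm (g x)"
  shows "exp_bounded f"
  using assms unfolding exp_bounded_def by (meson order_trans)

lemma exp_bounded_const: "exp_bounded (\<lambda>_. c)"
  by (rule exp_boundedI[of "norm c" 0]) auto

lemma exp_bounded_add:
  assumes "exp_bounded f" "exp_bounded g"
  shows "exp_bounded (\<lambda>x. f x + g x)"
proof -
  obtain K l where f: "0 \<le> K" "0 \<le> l" "\<And>x. norm (f x) \<le> K * exp (l * norm x)"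
    using assms(1) by (rule exp_boundedE) blast
  obtain K' l' where g: "0 \<le> K'" "0 \<le> l'" "\<And>x. norm (g x) \<le> K' * exp (l' * norm x)"
    using assms(2) by (rule exp_boundedE) blast
  show ?thesis
  proof (rule exp_boundedI[of "K + K'" "l + l'"])
    fix x :: 'a
    have "norm (f x + g x) \<le> K * exp (l * norm x) + K' * exp (l' * norm x)"
      using norm_triangle_ineq[of "f x" "g x"] f(3)[of x] g(3)[of x] by linarith
    also have "\<dots> \<le> K * exp ((l + l') * norm x) + K' * exp ((l + l') * norm x)"
      using f g by (intro add_mono mult_left_mono) (auto simp: mult_right_mono)
    finally show "norm (f x + g x) \<le> (K + K') * exp ((l + l') * norm x)"
      by (simp add: algebra_simps)
  qed (use f g in auto)
qed

lemma exp_bounded_product: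
  assumes "exp_bounded f" "exp_bounded g" "\<And>x. norm (h x) \<le> C * (norm (f x) * norm (g x))" "0 \<le> C"
  shows "exp_bounded h"
proof -
  obtain K l where f: "0 \<le> K" "0 \<le> l" "\<And>x. norm (f x) \<le> K * exp (l * norm x)"
    using assms(1) by (rule exp_boundedE) blast
  obtain K' l' where g: "0 \<le> K'" "0 \<le> l'" "\<And>x. norm (g x) \<le> K' * exp (l' * norm x)"
    using assms(2) by (rule exp_boundedE) blast
  show ?thesis
  proof (rule exp_boundedI[of "C * (K * K')" "l + l'"])
    fix x
    have "norm (h x) \<le> C * (norm (f x) * norm (g x))" by fact
    also have "\<dots> \<le> C * ((K * exp (l * norm x)) * (K' * exp (l' * norm x)))"
      using f g assms(4) by (intro mult_mono mult_left_mono) auto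
    finally show "norm (h x) \<le> C * (K * K') * exp ((l + l') * norm x)"
      by (simp add: algebra_simps exp_add)
  qed (use f g assms(4) in auto)
qed

lemma exp_bounded_mult:
  fixes f g :: "'a::real_normed_vector \<Rightarrow> real"
  shows "exp_bounded f \<Longrightarrow> exp_bounded g \<Longrightarrow> exp_bounded (\<lambda>x. f x * g x)"
  by (erule (1) exp_bounded_product[where C=1]) (auto simp: abs_mult)

lemma exp_bounded_scaleR:
  fixes f :: "'a::real_normed_vector \<Rightarrow> real"
  shows "exp_bounded f \<Longrightarrow> exp_bounded g \<Longrightarrow> exp_bounded (\<lambda>x. f x *\<^sub>R g x)"
  by (erule (1) exp_bounded_product[where C=1]) auto

lemma exp_bounded_inner:
  "exp_bounded f \<Longrightarrow> exp_bounded g \<Longrightarrow> exp_bounded (\<lambda>x. f x \<bullet> g x)"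
  by (erule (1) exp_bounded_product[where C=1]) (auto simp: Cauchy_Schwarz_ineq2)

lemma exp_bounded_minus: "exp_bounded f \<Longrightarrow> exp_bounded (\<lambda>x. - f x)"
  by (erule exp_bounded_mono) simp

lemma exp_bounded_diff:
  "exp_bounded f \<Longrightarrow> exp_bounded g \<Longrightarrow> exp_bounded (\<lambda>x. f x - g x)"
  using exp_bounded_add[of f "\<lambda>x. - g x"] exp_bounded_minus[of g] by simp

lemma exp_bounded_norm: "exp_bounded f \<Longrightarrow> exp_bounded (\<lambda>x. norm (f x))"
  by (erule exp_bounded_mono) simp

lemma exp_bounded_abs: "exp_bounded f \<Longrightarrow> exp_bounded (\<lambda>x. \<bar>f x\<bar> :: real)"
  by (erule exp_bounded_mono) simp

lemma exp_bounded_power: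
  fixes f :: "'a::real_normed_vector \<Rightarrow> real"
  shows "exp_bounded f \<Longrightarrow> exp_bounded (\<lambda>x. f x ^ n)"
  by (induction n) (auto intro: exp_bounded_const exp_bounded_mult)

lemma exp_bounded_exp_norm: "0 \<le> l \<Longrightarrow> exp_bounded (\<lambda>x. exp (l * norm x))"
  by (rule exp_boundedI[of 1 l]) auto

lemma exp_bounded_id: "exp_bounded (\<lambda>x. x)"
proof (rule exp_boundedI[of 1 1])
  show "norm x \<le> 1 * exp (1 * norm x)" for x :: 'a
    using exp_ge_add_one_self[of "norm x"] unfolding mult_1 by linarith
qed auto

lemma exp_bounded_compose:
  assumes "exp_bounded f" "bounded_linear L"
  shows "exp_bounded (\<lambda>x. f (L x))"
proof -
  obtain K l where f: "0 \<le> K" "0 \<le> l" "\<And>x. norm (f x) \<le> K * exp (l * norm x)"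
    using assms(1) by (rule exp_boundedE) blast
  obtain B where B: "0 < B" "\<And>x. norm (L x) \<le> norm x * B"
    using bounded_linear.pos_bounded[OF assms(2)] by blast
  show ?thesis
  proof (rule exp_boundedI[of K "l * B"])
    fix x
    have "norm (f (L x)) \<le> K * exp (l * norm (L x))" by (rule f)
    also have "\<dots> \<le> K * exp (l * (norm x * B))"
      using f B by (intro mult_left_mono) (auto intro!: mult_left_mono)
    finally show "norm (f (L x)) \<le> K * exp (l * B * norm x)" by (simp add: ac_simps)
  qed (use f B in auto)
qed

lemmas exp_bounded_intros =
  exp_bounded_const exp_bounded_add exp_bounded_mult exp_bounded_scaleR exp_bounded_inner
  exp_bounded_minus exp_bounded_diff exp_bounded_norm exp_bounded_abs exp_bounded_power
  exp_bounded_exp_norm exp_bounded_id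

lemma integrable_exp_bounded:
  fixes f :: "'a::euclidean_space \<Rightarrow> 'b::euclidean_space"
  assumes "exp_bounded f" "f \<in> borel_measurable borel"
  shows "integrable gauss f"
proof -
  obtain K l where f: "0 \<le> K" "0 \<le> l" "\<And>x. norm (f x) \<le> K * exp (l * norm x)"
    using assms(1) by (rule exp_boundedE) blast
  show ?thesis
    by (rule Bochner_Integration.integrable_bound[OF integrable_mult_right[OF integrable_exp_norm[of l], of K]])
       (use assms(2) f in auto)
qed

section \<open>Gaussian moments\<close>

text \<open>The density is a product over the coordinates, so the integral splits into one-dimensional normal
moments.\<close>
lemma gauss_inner_Basis:
  assumes i: "i \<in> Basis" and j: "j \<in> (Basis::'a::euclidean_space set)"
  shows "(\<integral>x. (x \<bullet> i) * (x \<bullet> j) \<partial>gauss) = i \<bullet> j"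
proof -
  define f where "f b t = std_normal_density t * ((if b = i then t else 1) * (if b = j then t else 1))"
    for b :: 'a and t
  have int: "integrable lborel (f b)" for b
    using integrable_std_normal_moment[of 0] integrable_std_normal_moment[of 1] integrable_std_normal_moment[of 2]
    by (cases "b = i"; cases "b = j") (simp_all add: f_def[abs_def] power2_eq_square)
  have 2: "(\<integral>t. std_normal_density t * (t * t) \<partial>lborel) = 1"
    using integral_std_normal_moment_even[of 1] by (simp add: power2_eq_square fact_numeral)
  have 1: "(\<integral>t. std_normal_density t * t \<partial>lborel) = 0"
    using integral_std_normal_moment_odd[of 0] by simp
  have "(\<integral>x. (x \<bullet> i) * (x \<bullet> j) \<partial>gauss) = (\<integral>x. (\<Prod>b\<in>Basis. f b (x \<bullet> b)) \<partial>lborel)"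
    using i j by (subst integral_gauss)
      (auto simp: f_def prod.distrib std_gaussian_density_def intro!: expectation_cong)
  also have "\<dots> = (\<Prod>b\<in>Basis. \<integral>t. f b t \<partial>lborel)"
    by (rule integral_lborel_prod) (rule int)
  also have "\<dots> = i \<bullet> j"
  proof (cases "i = j")
    case True
    have "(\<integral>t. f b t \<partial>lborel) = 1" for b
      using 2 True by (cases "b = i") (simp_all add: f_def)
    then show ?thesis using True i by (simp add: inner_Basis)
  next
    case False
    have "(\<integral>t. f i t \<partial>lborel) = 0"
      using 1 False by (simp add: f_def)
    then have "(\<Prod>b\<in>Basis. \<integral>t. f b t \<partial>lborel) = 0"
      using i by (intro prod_zero) auto
    then show ?thesis using False i j by (simp add: inner_Basis)
  qed
  finally show ?thesis .
qed

lemma integrable_inner_inner: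
  "integrable gauss (\<lambda>x. (x \<bullet> u) * (x \<bullet> v))" for u v :: "'a::euclidean_space"
  by (intro integrable_exp_bounded exp_bounded_intros) auto

lemma gauss_inner_inner:
  fixes u v :: "'a::euclidean_space"
  shows "(\<integral>x. (x \<bullet> u) * (x \<bullet> v) \<partial>gauss) = u \<bullet> v"
proof -
  have "(\<integral>x. (x \<bullet> u) * (x \<bullet> v) \<partial>gauss)
     = (\<integral>x. (\<Sum>i\<in>Basis. \<Sum>j\<in>Basis. ((u \<bullet> i) * (v \<bullet> j)) * ((x \<bullet> i) * (x \<bullet> j))) \<partial>gauss)"
    by (intro expectation_cong refl, subst (1) euclidean_inner, subst (2) euclidean_inner)
       (simp add: sum_product ac_simps)
  also have "\<dots> = (\<Sum>i\<in>Basis. \<Sum>j\<in>Basis. ((u \<bullet> i) * (v \<bullet> j)) * (i \<bullet> j))"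
    by (subst expectation_sum, intro Bochner_Integration.integrable_sum
        integrable_mult_right integrable_inner_inner,
        intro sum.cong refl, subst expectation_sum)
       (auto intro!: integrable_mult_right integrable_inner_inner sum.cong simp: gauss_inner_Basis)
  also have "\<dots> = u \<bullet> v"
    by (subst (4) euclidean_inner) (simp add: inner_Basis if_distrib sum.delta cong: if_cong)
  finally show ?thesis .
qed

lemma integral_sqnorm: "(\<integral>x. (norm x)\<^sup>2 \<partial>(gauss :: 'a::euclidean_space measure)) = real (DIM('a))"
proof -
  have "(\<integral>x. (norm x)\<^sup>2 \<partial>(gauss :: 'a measure)) = (\<integral>x. (\<Sum>b\<in>Basis. (x \<bullet> b) * (x \<bullet> b)) \<partial>(gauss :: 'a measure))"
    by (intro expectation_cong refl, subst power2_norm_eq_inner, subst euclidean_inner) simp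
  also have "\<dots> = (\<Sum>b\<in>(Basis :: 'a set). b \<bullet> b)"
    by (subst expectation_sum) (auto simp: gauss_inner_inner intro: integrable_inner_inner)
  also have "\<dots> = real (DIM('a))" by (simp add: inner_Basis)
  finally show ?thesis .
qed

section \<open>Pairs of independent Gaussian vectors\<close>

lemma borel_measurable_fst_borel [measurable]:
    "fst \<in> borel_measurable (borel :: ('a::euclidean_space \<times> 'b::euclidean_space) measure)"
  and borel_measurable_snd_borel [measurable]:
    "snd \<in> borel_measurable (borel :: ('a \<times> 'b) measure)"
  by (auto intro!: borel_measurable_continuous_onI continuous_intros)

lemma exp_bounded_fst: "exp_bounded f \<Longrightarrow> exp_bounded (\<lambda>p. f (fst p))"
  and exp_bounded_snd: "exp_bounded f' \<Longrightarrow> exp_bounded (\<lambda>p. f' (snd p))"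
  and exp_bounded_comb: "exp_bounded g \<Longrightarrow> exp_bounded (\<lambda>p. g (a *\<^sub>R fst p + b *\<^sub>R snd p))"
  and exp_bounded_affine: "exp_bounded h \<Longrightarrow> exp_bounded (\<lambda>y. h (u + b *\<^sub>R y))"
proof -
  show "exp_bounded f \<Longrightarrow> exp_bounded (\<lambda>p. f (fst p))"
    by (rule exp_bounded_compose[OF _ bounded_linear_fst])
  show "exp_bounded f' \<Longrightarrow> exp_bounded (\<lambda>p. f' (snd p))"
    by (rule exp_bounded_compose[OF _ bounded_linear_snd])
  show "exp_bounded g \<Longrightarrow> exp_bounded (\<lambda>p. g (a *\<^sub>R fst p + b *\<^sub>R snd p))"
    by (erule exp_bounded_compose)
       (intro bounded_linear_add bounded_linear_const_scaleR bounded_linear_fst bounded_linear_snd)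
  assume "exp_bounded h"
  then obtain K l where f: "0 \<le> K" "0 \<le> l" "\<And>x. norm (h x) \<le> K * exp (l * norm x)"
    by (rule exp_boundedE) blast
  show "exp_bounded (\<lambda>y. h (u + b *\<^sub>R y))"
  proof (rule exp_boundedI[of "K * exp (l * norm u)" "l * \<bar>b\<bar>"])
    fix y
    have "norm (h (u + b *\<^sub>R y)) \<le> K * exp (l * norm (u + b *\<^sub>R y))" by (rule f)
    also have "\<dots> \<le> K * exp (l * (norm u + \<bar>b\<bar> * norm y))"
      using f(1,2) norm_triangle_ineq[of u "b *\<^sub>R y"]
      by (intro mult_left_mono) (auto intro!: mult_left_mono)
    finally show "norm (h (u + b *\<^sub>R y)) \<le> K * exp (l * norm u) * exp (l * \<bar>b\<bar> * norm y)"
      by (simp add: exp_add algebra_simps)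
  qed (use f in auto)
qed

lemma integral_gauss_prod:
  fixes f :: "'a::euclidean_space \<times> 'b::euclidean_space \<Rightarrow> 'c::euclidean_space"
  assumes "exp_bounded f" "f \<in> borel_measurable borel"
  shows "(\<integral>p. f p \<partial>gauss) = (\<integral>x. \<integral>y. f (x, y) \<partial>gauss \<partial>gauss)"
proof -
  have "integrable (gauss \<Otimes>\<^sub>M gauss) f"
    unfolding gauss_prod[symmetric] by (rule integrable_exp_bounded[OF assms])
  from gauss_pair.integral_fst'[OF this] show ?thesis by (simp add: gauss_prod)
qed

lemma measure_gauss_UNIV [simp]: "measure gauss UNIV = 1"
  using gauss.prob_space by simp

lemma integral_gauss_fst:
  fixes f :: "'a::euclidean_space \<Rightarrow> 'c::euclidean_space"
  assumes "exp_bounded f" "f \<in> borel_measurable borel"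
  shows "(\<integral>p. f (fst p) \<partial>(gauss :: ('a \<times> 'b::euclidean_space) measure)) = (\<integral>x. f x \<partial>gauss)"
proof -
  have [measurable]: "f \<in> borel_measurable borel" by fact
  show ?thesis
    by (subst integral_gauss_prod) (auto intro: exp_bounded_fst assms simp: gauss.prob_space)
qed

lemma integral_gauss_reflection:
  fixes f :: "'a::euclidean_space \<times> 'a \<Rightarrow> 'c::euclidean_space"
  assumes "c\<^sup>2 + s\<^sup>2 = 1" "0 \<le> s" and [measurable]: "f \<in> borel_measurable borel"
  shows "(\<integral>p. f (c *\<^sub>R fst p + s *\<^sub>R snd p, s *\<^sub>R fst p - c *\<^sub>R snd p) \<partial>gauss) = (\<integral>p. f p \<partial>gauss)"
  by (subst (2) distr_gauss_reflection[OF assms(1,2), symmetric], subst integral_distr)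
     (auto intro!: borel_measurable_continuous_onI continuous_intros)

text \<open>A linear combination of two independent standard Gaussian vectors is again Gaussian: up to the
factor \<open>sqrt (a\<^sup>2 + b\<^sup>2)\<close> it is the first component of a reflected pair.\<close>
lemma integral_gauss_comb:
  fixes f :: "'a::euclidean_space \<Rightarrow> 'c::euclidean_space"
  assumes f: "exp_bounded f" and [measurable]: "f \<in> borel_measurable borel" and b: "0 \<le> b"
  shows "(\<integral>p. f (a *\<^sub>R fst p + b *\<^sub>R snd p) \<partial>gauss) = (\<integral>x. f (sqrt (a\<^sup>2 + b\<^sup>2) *\<^sub>R x) \<partial>gauss)"
proof (cases "a = 0 \<and> b = 0")
  case True
  then show ?thesis
    using gauss.prob_space[where 'a='a] gauss.prob_space[where 'a="'a \<times> 'a"] by simp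
next
  case False
  define r where "r = sqrt (a\<^sup>2 + b\<^sup>2)"
  have r: "r > 0" "r\<^sup>2 = a\<^sup>2 + b\<^sup>2"
    using False by (auto simp: r_def sum_power2_gt_zero_iff intro!: real_sqrt_gt_zero)
  let ?f = "\<lambda>p :: 'a \<times> 'a. f (r *\<^sub>R fst p)"
  have "(\<integral>p. ?f ((a / r) *\<^sub>R fst p + (b / r) *\<^sub>R snd p, (b / r) *\<^sub>R fst p - (a / r) *\<^sub>R snd p) \<partial>gauss)
      = (\<integral>p. ?f p \<partial>gauss)"
    using r b by (intro integral_gauss_reflection) (auto simp: power_divide divide_simps)
  moreover have "(\<integral>p. ?f p \<partial>gauss) = (\<integral>x. f (r *\<^sub>R x) \<partial>gauss)"
    using exp_bounded_affine[OF f, of 0 r] by (intro integral_gauss_fst) auto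
  ultimately show ?thesis using r by (simp add: scaleR_add_right r_def[symmetric])
qed

lemma gauss_uminus:
  fixes f :: "'a::euclidean_space \<Rightarrow> 'c::euclidean_space"
  assumes f: "exp_bounded f" and [measurable]: "f \<in> borel_measurable borel"
  shows "(\<integral>x. f (- x) \<partial>gauss) = (\<integral>x. f x \<partial>gauss)"
proof -
  have "(\<integral>x. f (- x) \<partial>gauss) = (\<integral>p. f (- fst p) \<partial>(gauss :: ('a \<times> 'a) measure))"
    using exp_bounded_affine[OF f, of 0 "-1"] by (intro integral_gauss_fst[symmetric]) auto
  also have "\<dots> = (\<integral>p. f (fst p) \<partial>(gauss :: ('a \<times> 'a) measure))"
    using integral_gauss_reflection[of "-1" 0 "\<lambda>p :: 'a \<times> 'a. f (fst p)"] by simp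
  also have "\<dots> = (\<integral>x. f x \<partial>gauss)"
    by (intro integral_gauss_fst f) auto
  finally show ?thesis .
qed

lemma gauss_inner: "(\<integral>x. x \<bullet> u \<partial>gauss) = 0" for u :: "'a::euclidean_space"
proof -
  have "exp_bounded (\<lambda>x. x \<bullet> u)" by (intro exp_bounded_intros)
  from gauss_uminus[OF this] show ?thesis by simp
qed

section \<open>The Ornstein-Uhlenbeck operators\<close>

text \<open>For independent standard Gaussian \<open>x\<close>, \<open>y\<close> this is a standard Gaussian vector with correlation \<open>s\<close>
to \<open>x\<close>.\<close>
abbreviation mix :: "real \<Rightarrow> 'a::real_vector \<Rightarrow> 'a \<Rightarrow> 'a" where
  "mix s x y \<equiv> s *\<^sub>R x + sqrt (1 - s\<^sup>2) *\<^sub>R y"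

text \<open>The Ornstein-Uhlenbeck (Mehler) operator, parametrised by the correlation \<open>s = exp (- t)\<close> instead
of the time \<open>t\<close>: the mean of \<open>H\<close> at a vector of correlation \<open>s\<close> with one whose value \<open>x\<close> is given.\<close>
definition OU :: "real \<Rightarrow> ('a::euclidean_space \<Rightarrow> 'b::euclidean_space) \<Rightarrow> 'a \<Rightarrow> 'b" where
  "OU s H x = (\<integral>y. H (mix s x y) \<partial>gauss)"

lemma borel_measurable_OU [measurable]:
  assumes [measurable]: "H \<in> borel_measurable borel"
  shows "OU s H \<in> borel_measurable borel"
  unfolding OU_def[abs_def] by measurable

lemma sqrt_one_minus_le: "0 \<le> s \<Longrightarrow> s \<le> 1 \<Longrightarrow> 0 \<le> sqrt (1 - s\<^sup>2) \<and> sqrt (1 - s\<^sup>2) \<le> 1" for s :: real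
  by (auto simp: power_le_one)

lemma norm_comb_le:
  fixes x y :: "'a::real_normed_vector"
  assumes "0 \<le> s" "s \<le> 1"
  shows "norm (mix s x y) \<le> norm x + norm y"
proof -
  have "norm (mix s x y) \<le> s * norm x + sqrt (1 - s\<^sup>2) * norm y"
    using norm_triangle_ineq[of "s *\<^sub>R x" "sqrt (1 - s\<^sup>2) *\<^sub>R y"] assms sqrt_one_minus_le[OF assms] by simp
  also have "\<dots> \<le> 1 * norm x + 1 * norm y"
    using assms sqrt_one_minus_le[OF assms] by (intro add_mono mult_right_mono) auto
  finally show ?thesis by simp
qed

lemma norm_OU_le:
  fixes H :: "'a::euclidean_space \<Rightarrow> 'b::euclidean_space"
  assumes s: "0 \<le> s" "s \<le> 1" and K: "0 \<le> K" "0 \<le> l" "\<And>x. norm (H x) \<le> K * exp (l * norm x)"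
    and [measurable]: "H \<in> borel_measurable borel"
  shows "norm (OU s H x) \<le> K * (\<integral>y. exp (l * norm y) \<partial>(gauss::'a measure)) * exp (l * norm x)"
proof -
  have "norm (OU s H x) \<le> (\<integral>y. (K * exp (l * norm x)) * exp (l * norm y) \<partial>(gauss::'a measure))"
    unfolding OU_def
  proof (rule expectation_norm_bound)
    show "integrable gauss (\<lambda>y. H (mix s x y))"
      by (intro integrable_exp_bounded exp_bounded_affine exp_boundedI[OF K]) auto
    show "integrable (gauss::'a measure) (\<lambda>y. (K * exp (l * norm x)) * exp (l * norm y))"
      by (intro integrable_mult_right integrable_exp_norm)
    fix y
    have "norm (H (mix s x y)) \<le> K * exp (l * norm (mix s x y))"
      by (rule K)
    also have "\<dots> \<le> K * exp (l * (norm x + norm y))"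
      using K(1,2) norm_comb_le[OF s, of x y] by (intro mult_left_mono) (auto intro!: mult_left_mono)
    finally show "norm (H (mix s x y)) \<le> (K * exp (l * norm x)) * exp (l * norm y)"
      by (simp add: algebra_simps exp_add)
  qed
  then show ?thesis by (simp add: ac_simps)
qed

lemma exp_bounded_OU:
  fixes H :: "'a::euclidean_space \<Rightarrow> 'b::euclidean_space"
  assumes s: "0 \<le> s" "s \<le> 1" and H: "exp_bounded H" "H \<in> borel_measurable borel"
  shows "exp_bounded (OU s H)"
proof -
  obtain K l where K: "0 \<le> K" "0 \<le> l" "\<And>x. norm (H x) \<le> K * exp (l * norm x)"
    using H(1) by (rule exp_boundedE) blast
  show ?thesis
    by (rule exp_boundedI[OF _ _ norm_OU_le[OF s K H(2)]]) (use K in auto)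
qed

lemma OU_1: "OU 1 H = H"
  by (simp add: OU_def[abs_def])

lemma OU_0: "OU 0 H x = (\<integral>y. H y \<partial>gauss)"
  by (simp add: OU_def)

lemma integral_OU_pair:
  fixes F :: "'a::euclidean_space \<Rightarrow> real"
  assumes "exp_bounded F" "exp_bounded H" and [measurable]: "F \<in> borel_measurable borel" "H \<in> borel_measurable borel"
  shows "(\<integral>x. F x * OU s H x \<partial>gauss)
    = (\<integral>p. F (fst p) * H (mix s (fst p) (snd p)) \<partial>gauss)"
  by (subst integral_gauss_prod)
     (auto simp: OU_def intro!: exp_bounded_intros exp_bounded_comb exp_bounded_fst assms)

lemma integral_OU_pair_inner:
  fixes F H :: "'a::euclidean_space \<Rightarrow> 'b::euclidean_space"
  assumes "exp_bounded F" and H: "exp_bounded H" and [measurable]: "F \<in> borel_measurable borel" "H \<in> borel_measurable borel"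
  shows "(\<integral>x. F x \<bullet> OU s H x \<partial>gauss)
    = (\<integral>p. F (fst p) \<bullet> H (mix s (fst p) (snd p)) \<partial>gauss)"
proof (subst integral_gauss_prod)
  have "F x \<bullet> OU s H x = (\<integral>y. F x \<bullet> H (mix s x y) \<partial>gauss)" for x
    unfolding OU_def
    by (rule integral_inner_right[symmetric]) (auto intro!: integrable_exp_bounded exp_bounded_affine H)
  then show "(\<integral>x. F x \<bullet> OU s H x \<partial>gauss) = (\<integral>x. \<integral>y. F (fst (x, y)) \<bullet>
      H (mix s (fst (x, y)) (snd (x, y))) \<partial>gauss \<partial>gauss)"
    by simp
qed (auto simp: OU_def intro!: exp_bounded_intros exp_bounded_comb exp_bounded_fst assms)

lemma integral_OU:
  fixes H :: "'a::euclidean_space \<Rightarrow> real"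
  assumes s: "0 \<le> s" "s \<le> 1" and H: "exp_bounded H" and [measurable]: "H \<in> borel_measurable borel"
  shows "(\<integral>x. OU s H x \<partial>gauss) = (\<integral>x. H x \<partial>gauss)"
  using integral_OU_pair[OF exp_bounded_const[of 1] H, of s]
     integral_gauss_comb[OF H, of "sqrt (1 - s\<^sup>2)" s] sqrt_one_minus_le[OF s] s
  by (simp add: power_le_one)

text \<open>The two independent Gaussian contributions, of variances \<open>s\<^sup>2 (1 - q\<^sup>2)\<close> and \<open>1 - s\<^sup>2\<close>, add up to one of
variance \<open>1 - (q s)\<^sup>2\<close>.\<close>
lemma OU_semigroup:
  fixes H :: "'a::euclidean_space \<Rightarrow> real"
  assumes q: "0 \<le> q" "q \<le> 1" and s: "0 \<le> s" "s \<le> 1"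
    and H: "exp_bounded H" and [measurable]: "H \<in> borel_measurable borel"
  shows "OU q (OU s H) x = OU (q * s) H x"
proof -
  let ?p = "sqrt (1 - q\<^sup>2)" and ?c = "sqrt (1 - s\<^sup>2)"
  let ?f = "\<lambda>w. H ((q * s) *\<^sub>R x + w)"
  have f: "exp_bounded ?f" using exp_bounded_affine[OF H, of "(q * s) *\<^sub>R x" 1] by simp
  have "OU q (OU s H) x = (\<integral>z. \<integral>y. ?f ((s * ?p) *\<^sub>R z + ?c *\<^sub>R y) \<partial>gauss \<partial>gauss)"
    by (simp add: OU_def algebra_simps)
  also have "\<dots> = (\<integral>p. ?f ((s * ?p) *\<^sub>R fst p + ?c *\<^sub>R snd p) \<partial>gauss)"
    by (subst integral_gauss_prod) (auto intro!: exp_bounded_comb[OF f])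
  also have "\<dots> = (\<integral>w. ?f (sqrt ((s * ?p)\<^sup>2 + ?c\<^sup>2) *\<^sub>R w) \<partial>gauss)"
    using sqrt_one_minus_le[OF s] by (intro integral_gauss_comb f) auto
  also have "(s * ?p)\<^sup>2 + ?c\<^sup>2 = 1 - (q * s)\<^sup>2"
    using q s by (simp add: power_mult_distrib power_le_one algebra_simps)
  finally show ?thesis by (simp add: OU_def)
qed

text \<open>The pair \<open>(x, mix q x y)\<close> is exchangeable: the reflection with coefficients \<open>q\<close> and
\<open>sqrt (1 - q\<^sup>2)\<close> maps \<open>x\<close> to \<open>mix q x y\<close> and, being an involution, back.\<close>
lemma OU_reversible:
  fixes f :: "'a::euclidean_space \<times> 'a \<Rightarrow> 'c::euclidean_space"
  assumes q: "0 \<le> q" "q \<le> 1" and [measurable]: "f \<in> borel_measurable borel"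
  shows "(\<integral>p. f (mix q (fst p) (snd p), fst p) \<partial>gauss)
       = (\<integral>p. f (fst p, mix q (fst p) (snd p)) \<partial>gauss)"
proof -
  let ?s = "sqrt (1 - q\<^sup>2)"
  let ?f = "\<lambda>p. f (fst p, q *\<^sub>R fst p + ?s *\<^sub>R snd p)"
  have [measurable]: "(\<lambda>p :: 'a \<times> 'a. (fst p, q *\<^sub>R fst p + ?s *\<^sub>R snd p)) \<in> borel_measurable borel"
    by (intro borel_measurable_continuous_onI continuous_intros)
  have sq: "?s * ?s = 1 - q * q" using q by (simp add: power2_eq_square mult_le_one)
  have eq: "q *\<^sub>R (q *\<^sub>R x + ?s *\<^sub>R y) + ?s *\<^sub>R (?s *\<^sub>R x - q *\<^sub>R y) = x" for x y :: 'a
  proof -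
    have "q *\<^sub>R (q *\<^sub>R x + ?s *\<^sub>R y) + ?s *\<^sub>R (?s *\<^sub>R x - q *\<^sub>R y) = (q * q + ?s * ?s) *\<^sub>R x"
      by (simp only: scaleR_add_right scaleR_diff_right scaleR_add_left scaleR_scaleR) (simp add: mult.commute)
    then show ?thesis by (simp only: sq) simp
  qed
  have "(\<integral>p. ?f (q *\<^sub>R fst p + ?s *\<^sub>R snd p, ?s *\<^sub>R fst p - q *\<^sub>R snd p) \<partial>gauss) = (\<integral>p. ?f p \<partial>gauss)"
    using q sqrt_one_minus_le[OF q]
    by (intro integral_gauss_reflection) (auto simp: power_le_one)
  then show ?thesis by (simp add: eq)
qed

text \<open>The Dirichlet form of the reversible kernel \<open>OU q\<close>. It replaces integration by parts: a difference
of integrals becomes a product of two increments, each of first order in the displacement.\<close>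
lemma OU_dirichlet:
  fixes F h :: "'a::euclidean_space \<Rightarrow> real"
  assumes q: "0 \<le> q" "q \<le> 1"
    and F: "exp_bounded F" and h: "exp_bounded h"
    and [measurable]: "F \<in> borel_measurable borel" "h \<in> borel_measurable borel"
  shows "(\<integral>x. F x * h x \<partial>gauss) - (\<integral>x. F x * OU q h x \<partial>gauss)
    = (1/2) * (\<integral>p. (F (mix q (fst p) (snd p)) - F (fst p))
               * (h (mix q (fst p) (snd p)) - h (fst p)) \<partial>gauss)"
proof -
  let ?x = "\<lambda>p :: 'a \<times> 'a. mix q (fst p) (snd p)"
  note [intro] = integrable_exp_bounded exp_bounded_mult exp_bounded_fst exp_bounded_comb F h
  have 1: "(\<integral>p. F (?x p) * h (fst p) \<partial>gauss) = (\<integral>p. F (fst p) * h (?x p) \<partial>gauss)"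
    using OU_reversible[OF q, of "\<lambda>p. F (fst p) * h (snd p)"] by simp
  have 2: "(\<integral>p. F (?x p) * h (?x p) \<partial>gauss) = (\<integral>p. F (fst p) * h (fst p) \<partial>(gauss :: ('a \<times> 'a) measure))"
    using OU_reversible[OF q, of "\<lambda>p. F (fst p) * h (fst p)"] by simp
  have 3: "(\<integral>p. F (fst p) * h (fst p) \<partial>(gauss :: ('a \<times> 'a) measure)) = (\<integral>x. F x * h x \<partial>gauss)"
    by (rule integral_gauss_fst[of "\<lambda>x. F x * h x"]) auto
  have i: "integrable gauss (\<lambda>p. F (?x p) * h (?x p))" "integrable gauss (\<lambda>p. F (?x p) * h (fst p))"
     "integrable gauss (\<lambda>p. F (fst p) * h (?x p))" "integrable (gauss :: ('a \<times> 'a) measure) (\<lambda>p. F (fst p) * h (fst p))"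
    by (intro integrable_exp_bounded exp_bounded_mult exp_bounded_fst exp_bounded_comb F h; measurable)+
  have "(\<integral>p. (F (?x p) - F (fst p)) * (h (?x p) - h (fst p)) \<partial>gauss)
     = (\<integral>p. (F (?x p) * h (?x p) - F (?x p) * h (fst p)) - (F (fst p) * h (?x p) - F (fst p) * h (fst p)) \<partial>gauss)"
    by (simp add: algebra_simps)
  also have "\<dots> = 2 * ((\<integral>x. F x * h x \<partial>gauss) - (\<integral>p. F (fst p) * h (?x p) \<partial>gauss))"
    using i by (simp add: 1 2 3)
  finally show ?thesis by (simp add: integral_OU_pair[OF F h])
qed

section \<open>The covariance formula\<close>

text \<open>\<open>F\<close> has gradient \<open>DF\<close> with a quadratic error in the first order expansion; the constants grow at most
exponentially. Keeping \<open>K\<close> explicit matters for \<open>tame_OU\<close>, where it acquires a factor \<open>s\<close>.\<close>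
definition tame :: "real \<Rightarrow> real \<Rightarrow> ('a::euclidean_space \<Rightarrow> real) \<Rightarrow> ('a \<Rightarrow> 'a) \<Rightarrow> bool" where
  "tame K l F DF \<longleftrightarrow> 0 \<le> K \<and> 0 \<le> l \<and> F \<in> borel_measurable borel \<and> DF \<in> borel_measurable borel \<and>
     (\<forall>x. norm (DF x) \<le> K * exp (l * norm x)) \<and>
     (\<forall>x z. \<bar>F (x + z) - F x - DF x \<bullet> z\<bar> \<le> K * exp (l * (norm x + norm z)) * (norm z)\<^sup>2)"

lemma tameD:
  assumes "tame K l F DF"
  shows "0 \<le> K" "0 \<le> l" "F \<in> borel_measurable borel" "DF \<in> borel_measurable borel"
    "\<And>x. norm (DF x) \<le> K * exp (l * norm x)"
    "\<And>x z. \<bar>F (x + z) - F x - DF x \<bullet> z\<bar> \<le> K * exp (l * (norm x + norm z)) * (norm z)\<^sup>2"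
  using assms by (auto simp: tame_def)

lemma tame_mono:
  assumes "tame K l F DF" "K \<le> K'" "l \<le> l'"
  shows "tame K' l' F DF"
proof -
  note D = tameD[OF assms(1)]
  have e: "K * exp (l * r) \<le> K' * exp (l' * r)" if "0 \<le> r" for r
    using assms D that by (intro mult_mono) (auto intro: mult_right_mono)
  have "norm (DF x) \<le> K' * exp (l' * norm x)" for x
    using order_trans[OF D(5) e] by simp
  moreover have "\<bar>F (x + z) - F x - DF x \<bullet> z\<bar> \<le> K' * exp (l' * (norm x + norm z)) * (norm z)\<^sup>2" for x z
    by (rule order_trans[OF D(6)], rule mult_right_mono, rule e) auto
  ultimately show ?thesis using assms D unfolding tame_def by auto
qed

lemma tame_exp_bounded_grad: "tame K l F DF \<Longrightarrow> exp_bounded DF"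
  by (rule exp_boundedI[OF tameD(1,2,5)])

lemma tame_exp_bounded:
  assumes "tame K l F DF"
  shows "exp_bounded F"
proof (rule exp_bounded_mono)
  note D = tameD[OF assms]
  let ?g = "\<lambda>z::'a. \<bar>F 0\<bar> + K * norm z + K * exp (l * norm z) * (norm z)\<^sup>2"
  show "exp_bounded ?g"
    using D by (intro exp_bounded_intros)
  fix z :: 'a
  have "\<bar>F z\<bar> \<le> \<bar>F 0\<bar> + \<bar>DF 0 \<bullet> z\<bar> + \<bar>F (0 + z) - F 0 - DF 0 \<bullet> z\<bar>" by simp
  also have "\<dots> \<le> \<bar>F 0\<bar> + K * norm z + K * exp (l * norm z) * (norm z)\<^sup>2"
  proof (intro add_mono order_refl)
    show "\<bar>DF 0 \<bullet> z\<bar> \<le> K * norm z"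
      using Cauchy_Schwarz_ineq2[of "DF 0" z] D(5)[of 0] mult_right_mono[of "norm (DF 0)" K "norm z"] by simp
    show "\<bar>F (0 + z) - F 0 - DF 0 \<bullet> z\<bar> \<le> K * exp (l * norm z) * (norm z)\<^sup>2"
      using D(6)[of 0 z] by simp
  qed
  finally show "norm (F z) \<le> norm (?g z)" by simp
qed

text \<open>Differentiating under the integral sign in \<open>OU s F\<close> brings out one factor \<open>s\<close> in the gradient and
two in the remainder. This factor makes the errors of the \<open>n\<close> steps in \<open>gauss_covariance\<close> summable.\<close>
lemma tame_OU:
  fixes F :: "'a::euclidean_space \<Rightarrow> real"
  assumes s: "0 \<le> s" "s \<le> 1" and T: "tame K l F DF"
  shows "tame (s * (K * (\<integral>y. exp (l * norm y) \<partial>(gauss::'a measure)))) l (OU s F) (\<lambda>x. s *\<^sub>R OU s DF x)"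
proof -
  note D = tameD[OF T] and eF = tame_exp_bounded[OF T] and eG = tame_exp_bounded_grad[OF T]
  note [measurable] = D(3,4)
  let ?E = "\<integral>y. exp (l * norm y) \<partial>(gauss::'a measure)" and ?c = "sqrt (1 - s\<^sup>2)"
  have grad: "norm (s *\<^sub>R OU s DF x) \<le> s * (K * ?E) * exp (l * norm x)" for x
    using mult_left_mono[OF norm_OU_le[OF s D(1,2,5,4), of x] s(1)] s by (simp add: ac_simps)
  have rem: "\<bar>OU s F (x + z) - OU s F x - (s *\<^sub>R OU s DF x) \<bullet> z\<bar>
      \<le> s * (K * ?E) * exp (l * (norm x + norm z)) * (norm z)\<^sup>2" for x z
  proof -
    let ?u = "\<lambda>y. s *\<^sub>R x + ?c *\<^sub>R y"
    have i: "integrable gauss (\<lambda>y. F (s *\<^sub>R (x + z) + ?c *\<^sub>R y))" "integrable gauss (\<lambda>y. F (?u y))"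
      "integrable gauss (\<lambda>y. DF (?u y))"
      by (intro integrable_exp_bounded exp_bounded_affine eF eG; measurable)+
    have eq: "OU s F (x + z) - OU s F x - (s *\<^sub>R OU s DF x) \<bullet> z
      = (\<integral>y. F (s *\<^sub>R (x + z) + ?c *\<^sub>R y) - F (?u y) - DF (?u y) \<bullet> (s *\<^sub>R z) \<partial>gauss)"
      unfolding OU_def using i by (simp add: integral_inner_left)
    have "\<bar>\<integral>y. F (s *\<^sub>R (x + z) + ?c *\<^sub>R y) - F (?u y) - DF (?u y) \<bullet> (s *\<^sub>R z) \<partial>gauss\<bar>
        \<le> (\<integral>y. (s * K * exp (l * (norm x + norm z)) * (norm z)\<^sup>2) * exp (l * norm y) \<partial>(gauss::'a measure))"
      unfolding real_norm_def[symmetric]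
    proof (rule expectation_norm_bound)
      show "integrable gauss (\<lambda>y. F (s *\<^sub>R (x + z) + ?c *\<^sub>R y) - F (?u y) - DF (?u y) \<bullet> (s *\<^sub>R z))"
        using i by (intro Bochner_Integration.integrable_diff integrable_inner_left)
      show "integrable gauss (\<lambda>y::'a. (s * K * exp (l * (norm x + norm z)) * (norm z)\<^sup>2) * exp (l * norm y))"
        by (intro integrable_mult_right integrable_exp_norm)
      fix y
      have "norm (F (s *\<^sub>R (x + z) + ?c *\<^sub>R y) - F (?u y) - DF (?u y) \<bullet> (s *\<^sub>R z))
        \<le> K * exp (l * (norm (?u y) + norm (s *\<^sub>R z))) * (norm (s *\<^sub>R z))\<^sup>2"
        using D(6)[of "?u y" "s *\<^sub>R z"] by (simp add: algebra_simps)
      also have "\<dots> \<le> K * exp (l * (norm x + norm z) + l * norm y) * (s * (norm z)\<^sup>2)"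
      proof (intro mult_mono)
        have "norm (?u y) + norm (s *\<^sub>R z) \<le> (norm x + norm y) + norm z"
          using norm_comb_le[OF s, of x y] s by (intro add_mono) (auto simp: mult_left_le_one_le)
        then have "l * (norm (?u y) + norm (s *\<^sub>R z)) \<le> l * ((norm x + norm y) + norm z)"
          using D(2) by (intro mult_left_mono)
        then show "exp (l * (norm (?u y) + norm (s *\<^sub>R z))) \<le> exp (l * (norm x + norm z) + l * norm y)"
          by (simp add: algebra_simps)
        show "(norm (s *\<^sub>R z))\<^sup>2 \<le> s * (norm z)\<^sup>2"
          using s mult_right_mono[of "s * s" s "(norm z)\<^sup>2"]
          by (simp add: power_mult_distrib power2_eq_square[of s] mult_left_le_one_le)
      qed (use D(1) s in auto)
      finally show "norm (F (s *\<^sub>R (x + z) + ?c *\<^sub>R y) - F (?u y) - DF (?u y) \<bullet> (s *\<^sub>R z))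
        \<le> (s * K * exp (l * (norm x + norm z)) * (norm z)\<^sup>2) * exp (l * norm y)"
        by (simp only: exp_add mult.assoc mult.commute mult.left_commute)
    qed
    then show ?thesis unfolding eq by (simp add: ac_simps)
  qed
  have K: "0 \<le> s * (K * ?E)" using D(1) s by simp
  have m: "OU s F \<in> borel_measurable borel" "(\<lambda>x. s *\<^sub>R OU s DF x) \<in> borel_measurable borel"
    by measurable
  show ?thesis
    unfolding tame_def using K D(2) m grad rem by blast
qed

text \<open>The first integral controls the error in \<open>tame_increment_product\<close>, the second the terms of order
\<open>(1 - q)\<^sup>2\<close> that remain in \<open>OU_step\<close> after averaging.\<close>
definition ou_step_const :: "real \<Rightarrow> 'a::euclidean_space itself \<Rightarrow> real" where
  "ou_step_const l _ = 16 * (\<integral>p. exp ((6*l + 4) * (norm (fst p) + norm (snd p))) \<partial>(gauss :: ('a \<times> 'a) measure))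
     + (\<integral>x. exp ((2*l + 2) * norm x) \<partial>(gauss :: 'a measure))"

lemma le_exp: "r \<le> exp r" for r :: real
  using exp_ge_add_one_self[of r] by linarith

lemma power_le_exp: "0 \<le> r \<Longrightarrow> r ^ n \<le> exp (real n * r)" for r :: real
  using power_mono[OF le_exp, of r n] by (simp add: exp_of_nat_mult)

lemma exp_bounded_exp_sum:
  assumes "0 \<le> l"
  shows "exp_bounded (\<lambda>p :: 'a::euclidean_space \<times> 'a. exp (l * (norm (fst p) + norm (snd p))))"
proof -
  have "exp_bounded (\<lambda>x::'a. exp (l * norm x))" by (rule exp_bounded_exp_norm[OF assms])
  from exp_bounded_mult[OF exp_bounded_fst[OF this] exp_bounded_snd[OF this]]
  show ?thesis unfolding distrib_left exp_add .
qed

text \<open>With first order parts \<open>a\<close>, \<open>b\<close> and remainders \<open>R\<close>, \<open>S\<close> the error is \<open>a S + R b + R S\<close>, where \<open>a\<close>, \<open>b\<close>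
are of order \<open>e w\<close> and \<open>R\<close>, \<open>S\<close> of order \<open>(e w)\<^sup>2\<close>; powers of \<open>w\<close> are absorbed in the exponential.\<close>
lemma tame_increment_product:
  assumes F: "tame K l F DF" and H: "tame K' l h Dh"
    and w: "0 \<le> w" "norm x \<le> w" and e: "0 \<le> e" "e \<le> 1" and d: "norm d \<le> 2 * e * w"
  shows "\<bar>(F (x + d) - F x) * (h (x + d) - h x) - (DF x \<bullet> d) * (Dh x \<bullet> d)\<bar>
    \<le> 32 * K * K' * e ^ 3 * exp ((6 * l + 4) * w)"
proof -
  note DF = tameD[OF F] and DH = tameD[OF H]
  define a where "a = DF x \<bullet> d"
  define b where "b = Dh x \<bullet> d"
  define R where "R = F (x + d) - F x - a"
  define S where "S = h (x + d) - h x - b"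
  have dw: "norm d \<le> 2 * w"
    using d e w mult_right_mono[of e 1 "2 * w"] by simp
  have e1: "exp (l * norm x) \<le> exp (l * w)" using DF(2) w by (simp add: mult_left_mono)
  have e2: "exp (l * (norm x + norm d)) \<le> exp (3 * l * w)"
    using mult_left_mono[of "norm x + norm d" "3 * w" l] DF(2) w dw by simp
  have d2: "(norm d)\<^sup>2 \<le> 4 * e\<^sup>2 * w\<^sup>2"
    using power_mono[OF d, of 2] by (simp add: power_mult_distrib)
  have lin: "\<bar>v \<bullet> d\<bar> \<le> k * exp (l * w) * (2 * e * w)" if "norm v \<le> k * exp (l * norm x)" "0 \<le> k" for v k
  proof -
    have "\<bar>v \<bullet> d\<bar> \<le> norm v * norm d" by (rule Cauchy_Schwarz_ineq2)
    also have "\<dots> \<le> (k * exp (l * w)) * (2 * e * w)"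
      using order_trans[OF that(1) mult_left_mono[OF e1 that(2)]] d that(2)
      by (intro mult_mono) auto
    finally show ?thesis .
  qed
  have rem: "k * exp (l * (norm x + norm d)) * (norm d)\<^sup>2 \<le> k * exp (3 * l * w) * (4 * e\<^sup>2 * w\<^sup>2)"
    if "0 \<le> k" for k
    using that e2 d2 by (intro mult_mono) auto
  have a: "\<bar>a\<bar> \<le> K * exp (l * w) * (2 * e * w)" unfolding a_def using DF by (intro lin) auto
  have b: "\<bar>b\<bar> \<le> K' * exp (l * w) * (2 * e * w)" unfolding b_def using DH by (intro lin) auto
  have R: "\<bar>R\<bar> \<le> K * exp (3 * l * w) * (4 * e\<^sup>2 * w\<^sup>2)"
    using order_trans[OF DF(6)[of x d] rem[OF DF(1)]] by (simp add: R_def a_def)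
  have S: "\<bar>S\<bar> \<le> K' * exp (3 * l * w) * (4 * e\<^sup>2 * w\<^sup>2)"
    using order_trans[OF DH(6)[of x d] rem[OF DH(1)]] by (simp add: S_def b_def)
  have KK: "0 \<le> K * K'" using DF DH by simp
  have ex: "exp (3 * l * w) = exp (l * w) ^ 3" "exp (4 * (l * w)) = exp (l * w) ^ 4"
      "exp (6 * (l * w)) = exp (l * w) ^ 6"
    using exp_of_nat_mult[of 3 "l * w"] exp_of_nat_mult[of 4 "l * w"] exp_of_nat_mult[of 6 "l * w"]
    by (simp_all add: mult.assoc)
  have lw: "0 \<le> l * w" using DF w by simp
  have bd: "c * (e ^ k * w ^ k * exp (m * (l * w))) \<le> c * (e ^ 3 * exp ((6 * l + 4) * w))"
    if "3 \<le> k" "k \<le> 4" "m \<le> 6" "0 \<le> c" for k c and m :: real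
  proof (rule mult_left_mono[OF _ that(4)])
    have "e ^ k * w ^ k * exp (m * (l * w)) \<le> e ^ 3 * exp (real k * w) * exp (6 * (l * w))"
      using that e w lw by (intro mult_mono power_le_exp power_decreasing) (auto intro: mult_right_mono)
    also have "\<dots> \<le> e ^ 3 * exp ((6 * l + 4) * w)"
      using e that(2) w mult_right_mono[of "real k" 4 w]
      by (simp add: mult.assoc algebra_simps flip: exp_add) (intro mult_left_mono, auto)
    finally show "e ^ k * w ^ k * exp (m * (l * w)) \<le> e ^ 3 * exp ((6 * l + 4) * w)" .
  qed
  have 1: "\<bar>a\<bar> * \<bar>S\<bar> \<le> 8 * (K * K') * (e ^ 3 * exp ((6 * l + 4) * w))"
  proof -
    have "\<bar>a\<bar> * \<bar>S\<bar> \<le> (K * exp (l * w) * (2 * e * w)) * (K' * exp (3 * l * w) * (4 * e\<^sup>2 * w\<^sup>2))"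
      using a S e w DF DH by (intro mult_mono) auto
    also have "\<dots> = (8 * (K * K')) * (e ^ 3 * w ^ 3 * exp (4 * (l * w)))"
      unfolding ex by (simp add: eval_nat_numeral)
    also have "\<dots> \<le> 8 * (K * K') * (e ^ 3 * exp ((6 * l + 4) * w))"
      using KK by (intro bd) auto
    finally show ?thesis .
  qed
  have 2: "\<bar>R\<bar> * \<bar>b\<bar> \<le> 8 * (K * K') * (e ^ 3 * exp ((6 * l + 4) * w))"
  proof -
    have "\<bar>R\<bar> * \<bar>b\<bar> \<le> (K * exp (3 * l * w) * (4 * e\<^sup>2 * w\<^sup>2)) * (K' * exp (l * w) * (2 * e * w))"
      using R b e w DF DH by (intro mult_mono) auto
    also have "\<dots> = (8 * (K * K')) * (e ^ 3 * w ^ 3 * exp (4 * (l * w)))"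
      unfolding ex by (simp add: eval_nat_numeral)
    also have "\<dots> \<le> 8 * (K * K') * (e ^ 3 * exp ((6 * l + 4) * w))"
      using KK by (intro bd) auto
    finally show ?thesis .
  qed
  have 3: "\<bar>R\<bar> * \<bar>S\<bar> \<le> 16 * (K * K') * (e ^ 3 * exp ((6 * l + 4) * w))"
  proof -
    have "\<bar>R\<bar> * \<bar>S\<bar> \<le> (K * exp (3 * l * w) * (4 * e\<^sup>2 * w\<^sup>2)) * (K' * exp (3 * l * w) * (4 * e\<^sup>2 * w\<^sup>2))"
      using R S e w DF DH by (intro mult_mono) auto
    also have "\<dots> = (16 * (K * K')) * (e ^ 4 * w ^ 4 * exp (6 * (l * w)))"
      unfolding ex by (simp add: eval_nat_numeral)
    also have "\<dots> \<le> 16 * (K * K') * (e ^ 3 * exp ((6 * l + 4) * w))"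
      using KK by (intro bd) auto
    finally show ?thesis .
  qed
  have "(F (x + d) - F x) * (h (x + d) - h x) - a * b = a * S + R * b + R * S"
    by (simp add: R_def S_def algebra_simps)
  then have "\<bar>(F (x + d) - F x) * (h (x + d) - h x) - a * b\<bar> \<le> \<bar>a\<bar> * \<bar>S\<bar> + \<bar>R\<bar> * \<bar>b\<bar> + \<bar>R\<bar> * \<bar>S\<bar>"
    using abs_triangle_ineq[of "a * S + R * b" "R * S"] abs_triangle_ineq[of "a * S" "R * b"]
    unfolding abs_mult by linarith
  also have "\<dots> \<le> 32 * K * K' * e ^ 3 * exp ((6 * l + 4) * w)"
    using 1 2 3 by simp
  finally show ?thesis by (simp add: a_def b_def)
qed

lemma gauss_quadratic:
  fixes u v w :: "'a::euclidean_space"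
  shows "(\<integral>z. c + z \<bullet> u + k * ((z \<bullet> v) * (z \<bullet> w)) \<partial>gauss) = c + k * (v \<bullet> w)"
proof -
  have i: "integrable gauss (\<lambda>z::'a. z \<bullet> u)" "integrable gauss (\<lambda>z::'a. c + z \<bullet> u)"
    by (intro integrable_exp_bounded exp_bounded_intros; measurable)+
  show ?thesis
    using i integrable_mult_right[OF integrable_inner_inner[of v w], of k]
    by (simp add: gauss_inner gauss_inner_inner)
qed

text \<open>Lowering the correlation from 1 to \<open>q\<close> changes the mean of the product by \<open>1 - q\<close> times the mean inner
product of the gradients, up to an error of order \<open>(1 - q)\<^sup>3\<^sup>/\<^sup>2\<close>. The displacement is
\<open>d = - (1 - q) x + sqrt (1 - q\<^sup>2) z\<close>, and averaging \<open>(DF x \<bullet> d) (Dh x \<bullet> d)\<close> over \<open>z\<close> leaves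
\<open>(1 - q\<^sup>2) DF x \<bullet> Dh x\<close>, half of which is \<open>1 - q\<close> to first order.\<close>
lemma OU_step:
  fixes F h :: "'a::euclidean_space \<Rightarrow> real"
  assumes F: "tame K l F DF" and H: "tame K' l h Dh" and q: "0 \<le> q" "q \<le> 1"
  shows "\<bar>(\<integral>x. F x * h x \<partial>gauss) - (\<integral>x. F x * OU q h x \<partial>gauss) - (1 - q) * (\<integral>x. DF x \<bullet> Dh x \<partial>gauss)\<bar>
     \<le> ou_step_const l TYPE('a) * (K * K') * sqrt (1 - q) ^ 3"
proof -
  note DF = tameD[OF F] and DH = tameD[OF H]
  note [measurable] = DF(3,4) DH(3,4)
  note eb = tame_exp_bounded[OF F] tame_exp_bounded[OF H] tame_exp_bounded_grad[OF F]
      tame_exp_bounded_grad[OF H]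
  note eb = eb eb[THEN exp_bounded_fst] eb[THEN exp_bounded_comb]
  \<comment> \<open>The displacement from \<open>x\<close> to \<open>mix q x z\<close> is of order \<open>e\<close>.\<close>
  define e where "e = sqrt (1 - q)"
  define p where "p = sqrt (1 - q\<^sup>2)"
  define d where "d v = - (1 - q) *\<^sub>R fst v + p *\<^sub>R snd v" for v :: "'a \<times> 'a"
  have [measurable]: "d \<in> borel_measurable borel" unfolding d_def[abs_def] by measurable
  have ed: "exp_bounded d" unfolding d_def[abs_def] using exp_bounded_comb[OF exp_bounded_id] .
  have e: "0 \<le> e" "e \<le> 1" "e\<^sup>2 = 1 - q" using q by (auto simp: e_def)
  have p: "0 \<le> p" "p\<^sup>2 = 1 - q\<^sup>2" using q by (auto simp: p_def power_le_one)
  have q2: "(1 - q)\<^sup>2 \<le> e ^ 3"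
    using e power_decreasing[of 3 4 e] by (simp add: e(3)[symmetric] flip: power_mult)
  have pe: "p \<le> 2 * e"
  proof (rule power2_le_imp_le)
    have "(1 - q) * (1 + q) \<le> (1 - q) * 4" using q by (intro mult_left_mono) auto
    then show "p\<^sup>2 \<le> (2 * e)\<^sup>2" using p e by (simp add: power_mult_distrib algebra_simps power2_eq_square)
  qed (use e in auto)
  have x': "q *\<^sub>R fst v + p *\<^sub>R snd v = fst v + d v" for v
    by (simp add: d_def algebra_simps)
  have nd: "norm (d v) \<le> 2 * e * (norm (fst v) + norm (snd v))" for v
  proof -
    have "norm (d v) \<le> norm (- (1 - q) *\<^sub>R fst v) + norm (p *\<^sub>R snd v)"
      unfolding d_def by (rule norm_triangle_ineq)
    also have "\<dots> = (e * e) * norm (fst v) + p * norm (snd v)"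
      using q p e by (simp add: power2_eq_square)
    also have "\<dots> \<le> (2 * e) * norm (fst v) + (2 * e) * norm (snd v)"
      using e pe mult_right_mono[of e 1 e] by (intro add_mono mult_right_mono) auto
    finally show ?thesis by (simp add: algebra_simps)
  qed
  let ?w = "\<lambda>v. norm (fst v) + norm (snd v)"
  let ?P = "\<lambda>v. (F (fst v + d v) - F (fst v)) * (h (fst v + d v) - h (fst v))"
  let ?M = "\<lambda>v. (DF (fst v) \<bullet> d v) * (Dh (fst v) \<bullet> d v)"
  define A where "A = (\<integral>x. (DF x \<bullet> x) * (Dh x \<bullet> x) \<partial>gauss)"
  define B where "B = (\<integral>x. DF x \<bullet> Dh x \<partial>gauss)"
  define E1 where "E1 = (\<integral>p. exp ((6*l + 4) * (norm (fst p) + norm (snd p))) \<partial>(gauss :: ('a \<times> 'a) measure))"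
  define E2 where "E2 = (\<integral>x. exp ((2*l + 2) * norm x) \<partial>(gauss :: 'a measure))"
  have E: "0 \<le> E1" "0 \<le> E2" by (simp_all add: E1_def E2_def)
  have iP: "integrable gauss ?P"
    unfolding x'[symmetric] by (intro integrable_exp_bounded exp_bounded_intros eb) auto
  have eM: "exp_bounded ?M" by (intro exp_bounded_intros ed eb)
  have iM: "integrable gauss ?M" by (intro integrable_exp_bounded eM) auto
  have PM: "\<bar>(\<integral>v. ?P v \<partial>gauss) - (\<integral>v. ?M v \<partial>gauss)\<bar> \<le> 32 * (K * K') * e ^ 3 * E1"
  proof -
    have "\<bar>(\<integral>v. ?P v \<partial>gauss) - (\<integral>v. ?M v \<partial>gauss)\<bar> = norm (\<integral>v. ?P v - ?M v \<partial>gauss)"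
      using iP iM by simp
    also have "\<dots> \<le> (\<integral>v. (32 * (K * K') * e ^ 3) * exp ((6 * l + 4) * ?w v) \<partial>(gauss :: ('a \<times> 'a) measure))"
    proof (rule expectation_norm_bound)
      show "integrable (gauss :: ('a \<times> 'a) measure) (\<lambda>v. (32 * (K * K') * e ^ 3) * exp ((6 * l + 4) * ?w v))"
        using DF(2) by (intro integrable_mult_right integrable_exp_bounded exp_bounded_exp_sum) auto
      fix v
      show "norm (?P v - ?M v) \<le> (32 * (K * K') * e ^ 3) * exp ((6 * l + 4) * ?w v)"
        using tame_increment_product[where x="fst v" and d="d v" and w="?w v", OF F H _ _ e(1,2) nd] by (simp add: ac_simps)
    qed (use iP iM in auto)
    finally show ?thesis by (simp add: E1_def)
  qed
  have M: "(\<integral>v. ?M v \<partial>gauss) = (1 - q)\<^sup>2 * A + (1 - q\<^sup>2) * B"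
  proof -
    have "(\<integral>v. ?M v \<partial>gauss) = (\<integral>x. \<integral>z. ?M (x, z) \<partial>gauss \<partial>gauss)"
      using eM by (rule integral_gauss_prod) auto
    also have "\<dots> = (\<integral>x. (1 - q)\<^sup>2 * ((DF x \<bullet> x) * (Dh x \<bullet> x)) + (1 - q\<^sup>2) * (DF x \<bullet> Dh x) \<partial>gauss)"
    proof (rule expectation_cong[OF refl])
      fix x
      let ?a = "DF x" and ?b = "Dh x"
      let ?u = "(- (p * (1 - q))) *\<^sub>R ((?a \<bullet> x) *\<^sub>R ?b + (?b \<bullet> x) *\<^sub>R ?a)"
      have d: "y \<bullet> d (x, z) = p * (z \<bullet> y) - (1 - q) * (y \<bullet> x)" for y z
        unfolding d_def fst_conv snd_conv inner_add_right inner_scaleR_right by (simp add: inner_commute algebra_simps)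
      have "?M (x, z) = (1 - q)\<^sup>2 * ((?a \<bullet> x) * (?b \<bullet> x)) + z \<bullet> ?u + p\<^sup>2 * ((z \<bullet> ?a) * (z \<bullet> ?b))" for z
        unfolding fst_conv d inner_scaleR_right inner_add_right
        by (simp add: power2_eq_square algebra_simps)
      then have "(\<integral>z. ?M (x, z) \<partial>gauss) = (1 - q)\<^sup>2 * ((?a \<bullet> x) * (?b \<bullet> x)) + p\<^sup>2 * (?a \<bullet> ?b)"
        by (simp only: gauss_quadratic)
      then show "(\<integral>z. ?M (x, z) \<partial>gauss)
          = (1 - q)\<^sup>2 * ((?a \<bullet> x) * (?b \<bullet> x)) + (1 - q\<^sup>2) * (?a \<bullet> ?b)" by (simp only: p)
    qed
    also have "\<dots> = (1 - q)\<^sup>2 * A + (1 - q\<^sup>2) * B"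
      unfolding A_def B_def
    proof (subst expectation_add)
      show "integrable gauss (\<lambda>x. (1 - q)\<^sup>2 * ((DF x \<bullet> x) * (Dh x \<bullet> x)))"
        "integrable gauss (\<lambda>x. (1 - q\<^sup>2) * (DF x \<bullet> Dh x))"
        by (intro integrable_mult_right integrable_exp_bounded exp_bounded_intros eb; measurable)+
    qed simp
    finally show ?thesis .
  qed
  have AB: "\<bar>A\<bar> \<le> K * K' * E2" "\<bar>B\<bar> \<le> K * K' * E2"
  proof -
    have bd: "norm (DF x) * norm (Dh x) \<le> K * K' * exp (2 * l * norm x)" for x
      using mult_mono[OF DF(5)[of x] DH(5)[of x]] DF(1) by (simp add: algebra_simps flip: exp_add)
    have "\<bar>f\<bar> \<le> norm (DF x) * norm (Dh x) * (norm x)\<^sup>2 \<Longrightarrow> \<bar>f\<bar> \<le> K * K' * exp ((2 * l + 2) * norm x)" for f x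
    proof -
      assume "\<bar>f\<bar> \<le> norm (DF x) * norm (Dh x) * (norm x)\<^sup>2"
      also have "\<dots> \<le> K * K' * exp (2 * l * norm x) * exp (2 * norm x)"
        using bd[of x] power_le_exp[of "norm x" 2] DF(1) DH(1) by (intro mult_mono[of "norm (DF x) * norm (Dh x)"]) auto
      also have "\<dots> = K * K' * exp ((2 * l + 2) * norm x)"
        by (simp only: distrib_right exp_add mult.assoc)
      finally show ?thesis .
    qed
    moreover have "\<bar>(DF x \<bullet> x) * (Dh x \<bullet> x)\<bar> \<le> norm (DF x) * norm (Dh x) * (norm x)\<^sup>2" for x
      using mult_mono[OF Cauchy_Schwarz_ineq2[of "DF x" x] Cauchy_Schwarz_ineq2[of "Dh x" x]]
      by (simp add: abs_mult power2_eq_square ac_simps)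
    ultimately have a: "\<bar>(DF x \<bullet> x) * (Dh x \<bullet> x)\<bar> \<le> K * K' * exp ((2 * l + 2) * norm x)" for x by blast
    have b: "\<bar>DF x \<bullet> Dh x\<bar> \<le> K * K' * exp ((2 * l + 2) * norm x)" for x
    proof -
      have "\<bar>DF x \<bullet> Dh x\<bar> \<le> K * K' * exp (2 * l * norm x)"
        using order_trans[OF Cauchy_Schwarz_ineq2 bd] .
      also have "\<dots> \<le> K * K' * exp ((2 * l + 2) * norm x)"
        using DF(1) DH(1) by (intro mult_left_mono) (auto simp: algebra_simps)
      finally show ?thesis .
    qed
    have "norm (\<integral>x. (DF x \<bullet> x) * (Dh x \<bullet> x) \<partial>gauss) \<le> (\<integral>x. (K * K') * exp ((2 * l + 2) * norm x) \<partial>(gauss :: 'a measure))"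
      using a by (intro expectation_norm_bound integrable_mult_right integrable_exp_norm integrable_exp_bounded exp_bounded_intros eb) auto
    then show "\<bar>A\<bar> \<le> K * K' * E2" by (simp add: A_def E2_def)
    have "norm (\<integral>x. DF x \<bullet> Dh x \<partial>gauss) \<le> (\<integral>x. (K * K') * exp ((2 * l + 2) * norm x) \<partial>(gauss :: 'a measure))"
      using b by (intro expectation_norm_bound integrable_mult_right integrable_exp_norm integrable_exp_bounded exp_bounded_intros eb) auto
    then show "\<bar>B\<bar> \<le> K * K' * E2" by (simp add: B_def E2_def)
  qed
  have "(\<integral>x. F x * h x \<partial>gauss) - (\<integral>x. F x * OU q h x \<partial>gauss) = (1/2) * (\<integral>v. ?P v \<partial>gauss)"
    using OU_dirichlet[OF q, of F h] tame_exp_bounded[OF F] tame_exp_bounded[OF H]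
    by (simp add: p_def[symmetric] x')
  then have eq: "(\<integral>x. F x * h x \<partial>gauss) - (\<integral>x. F x * OU q h x \<partial>gauss) - (1 - q) * B
     = (1/2) * ((\<integral>v. ?P v \<partial>gauss) - (\<integral>v. ?M v \<partial>gauss)) + (1/2) * (1 - q)\<^sup>2 * (A - B)"
    unfolding M by (simp add: field_simps power2_eq_square)
  have "\<bar>(1/2) * ((\<integral>v. ?P v \<partial>gauss) - (\<integral>v. ?M v \<partial>gauss)) + (1/2) * (1 - q)\<^sup>2 * (A - B)\<bar>
     \<le> (1/2) * (32 * (K * K') * e ^ 3 * E1) + (1/2) * (1 - q)\<^sup>2 * (2 * (K * K' * E2))"
  proof (rule order_trans[OF abs_triangle_ineq add_mono])
    show "\<bar>(1/2) * ((\<integral>v. ?P v \<partial>gauss) - (\<integral>v. ?M v \<partial>gauss))\<bar> \<le> (1/2) * (32 * (K * K') * e ^ 3 * E1)"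
      unfolding abs_mult abs_divide abs_one abs_numeral by (rule mult_left_mono[OF PM]) simp
    have "\<bar>A - B\<bar> \<le> 2 * (K * K' * E2)" using AB by simp
    then show "\<bar>(1/2) * (1 - q)\<^sup>2 * (A - B)\<bar> \<le> (1/2) * (1 - q)\<^sup>2 * (2 * (K * K' * E2))"
      unfolding abs_mult abs_power2 abs_divide abs_one abs_numeral by (rule mult_left_mono) simp
  qed
  also have "\<dots> \<le> (1/2) * (32 * (K * K') * e ^ 3 * E1) + (1/2) * e ^ 3 * (2 * (K * K' * E2))"
    using DF(1) DH(1) E q2 by (intro add_left_mono mult_right_mono mult_left_mono) auto
  also have "\<dots> = ou_step_const l TYPE('a) * (K * K') * e ^ 3"
    unfolding ou_step_const_def E1_def[symmetric] E2_def[symmetric] by (simp add: algebra_simps)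
  finally show ?thesis unfolding eq[symmetric] by (simp only: B_def e_def)
qed

lemma sum_inverse_sqrt_le: "(\<Sum>k=1..n. 1 / sqrt (real k)) \<le> 2 * sqrt (real n)"
proof (induction n)
  case (Suc n)
  have s: "0 < sqrt (real (Suc n))" "sqrt (real n) \<le> sqrt (real (Suc n))" by auto
  have "1 = (sqrt (real (Suc n)) - sqrt (real n)) * (sqrt (real (Suc n)) + sqrt (real n))"
    by (simp add: algebra_simps)
  also have "\<dots> \<le> (sqrt (real (Suc n)) - sqrt (real n)) * (2 * sqrt (real (Suc n)))"
    using s by (intro mult_left_mono) auto
  finally have "1 / sqrt (real (Suc n)) \<le> 2 * (sqrt (real (Suc n)) - sqrt (real n))"
    using s by (simp add: divide_simps) (simp add: algebra_simps)
  with Suc show ?case by simp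
qed simp

text \<open>Let \<open>D k\<close> be the mean of \<open>F x * H x'\<close> at correlation \<open>k / n\<close>; then \<open>D n - D 0\<close> is the covariance.
The step from \<open>k - 1\<close> to \<open>k\<close> is \<open>OU_step\<close> for \<open>F\<close> and \<open>OU (k / n) H\<close> with the ratio \<open>q = (k - 1) / k\<close>.
Its main term carries the weight \<open>(1 - q) k / n = 1 / n\<close>, its error is of order
\<open>k / n * (1 / k)\<^sup>3\<^sup>/\<^sup>2 = n\<^sup>-\<^sup>1 k\<^sup>-\<^sup>1\<^sup>/\<^sup>2\<close>, and the sum of the errors is of order \<open>n\<^sup>-\<^sup>1\<^sup>/\<^sup>2\<close>.\<close>
theorem gauss_covariance:
  fixes F H :: "'a::euclidean_space \<Rightarrow> real"
  assumes F: "tame K l F DF" and H: "tame K l H DH"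
  shows "(\<lambda>n. (1 / real n) * (\<Sum>k=1..n. \<integral>p. DF (fst p) \<bullet>
            DH (mix (real k / real n) (fst p) (snd p)) \<partial>gauss))
     \<longlonglongrightarrow> (\<integral>x. F x * H x \<partial>gauss) - (\<integral>x. F x \<partial>gauss) * (\<integral>x. H x \<partial>gauss)"
    (is "?S \<longlonglongrightarrow> ?cov")
proof -
  note DF = tameD[OF F] and DH = tameD[OF H]
  note [measurable] = DF(3,4) DH(3,4)
  note eF = tame_exp_bounded[OF F] and eH = tame_exp_bounded[OF H]
  define E where "E = (\<integral>y. exp (l * norm y) \<partial>(gauss::'a measure))"
  define C where "C = ou_step_const l TYPE('a) * (K * (K * E))"
  have E: "0 \<le> E" by (simp add: E_def)
  have C: "0 \<le> C" using E DF(1) by (simp add: C_def ou_step_const_def)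
  have "\<bar>?cov - ?S n\<bar> \<le> 2 * C / sqrt (real n)" if n: "0 < n" for n :: nat
  proof -
    define D where "D k = (\<integral>x. F x * OU (real k / real n) H x \<partial>gauss)" for k :: nat
    define I where "I k = (\<integral>p. DF (fst p) \<bullet>
            DH (mix (real k / real n) (fst p) (snd p)) \<partial>gauss)" for k :: nat
    have step: "\<bar>D k - D (k - 1) - I k / real n\<bar> \<le> C / real n * (1 / sqrt (real k))"
      if k: "1 \<le> k" "k \<le> n" for k
    proof -
      let ?s = "real k / real n" and ?q = "real (k - 1) / real k"
      have s: "0 \<le> ?s" "?s \<le> 1" and q: "0 \<le> ?q" "?q \<le> 1" using k n by auto
      have q1: "1 - ?q = 1 / real k" using k by (simp add: of_nat_diff field_simps)
      have qs: "?q * ?s = real (k - 1) / real n" using k n by simp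
      have a: "(\<integral>x. F x * OU ?q (OU ?s H) x \<partial>gauss) = D (k - 1)"
        by (simp only: OU_semigroup[OF q s eH DH(3)] qs D_def)
      have b: "(\<integral>x. DF x \<bullet> (?s *\<^sub>R OU ?s DH x) \<partial>gauss) = ?s * I k"
        unfolding I_def using tame_exp_bounded_grad[OF F] tame_exp_bounded_grad[OF H]
        by (simp add: integral_OU_pair_inner)
      have c: "(1 - ?q) * (?s * I k) = I k / real n" using k n q1 by simp
      have "\<bar>D k - D (k - 1) - I k / real n\<bar>
          \<le> ou_step_const l TYPE('a) * (K * (?s * (K * E))) * sqrt (1 - ?q) ^ 3"
        using OU_step[OF F tame_OU[OF s H] q]
        unfolding a b c E_def[symmetric] D_def[of k, symmetric] .
      also have "\<dots> = C * (?s * sqrt (1 / real k) ^ 3)"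
        unfolding q1 C_def by (simp only: ac_simps)
      also have "?s * sqrt (1 / real k) ^ 3 = 1 / real n * (1 / sqrt (real k))"
        using k n by (simp add: power3_eq_cube real_sqrt_divide divide_simps)
      finally show ?thesis by (simp add: ac_simps)
    qed
    have "(\<Sum>k=1..n. D k - D (k - 1)) = D n - D 0"
      using sum_telescope''[of 0 n D] by simp
    moreover have "D n = (\<integral>x. F x * H x \<partial>gauss)" using n by (simp add: D_def OU_1)
    moreover have "D 0 = (\<integral>x. F x \<partial>gauss) * (\<integral>x. H x \<partial>gauss)" by (simp add: D_def OU_0)
    ultimately have eq: "?cov - ?S n = (\<Sum>k=1..n. D k - D (k - 1) - I k / real n)"
      by (simp add: sum_subtractf I_def sum_divide_distrib)
    have "\<bar>\<Sum>k=1..n. D k - D (k - 1) - I k / real n\<bar> \<le> (\<Sum>k=1..n. C / real n * (1 / sqrt (real k)))"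
      using step by (intro order_trans[OF sum_abs] sum_mono) auto
    also have "\<dots> \<le> C / real n * (2 * sqrt (real n))"
      unfolding sum_distrib_left[symmetric] using C by (intro mult_left_mono sum_inverse_sqrt_le) auto
    also have "\<dots> = 2 * C / sqrt (real n)"
      using n by (simp add: field_simps)
    finally show ?thesis unfolding eq .
  qed
  then have "eventually (\<lambda>n. norm (?S n - ?cov) \<le> 2 * C / sqrt (real n)) sequentially"
    by (intro eventually_sequentiallyI[of 1]) (simp add: abs_minus_commute)
  moreover have "(\<lambda>n. 2 * C / sqrt (real n)) \<longlonglongrightarrow> 0"
    by (rule real_tendsto_divide_at_top[OF tendsto_const])
       (rule filterlim_compose[OF sqrt_at_top filterlim_real_sequentially])
  ultimately have "(\<lambda>n. ?S n - ?cov) \<longlonglongrightarrow> 0" by (rule Lim_null_comparison)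
  then show ?thesis by (simp add: LIM_zero_iff)
qed

section \<open>Smoothing and the Poincare inequality\<close>

lemma nonpos_if_le_linear:
  fixes X B :: real
  assumes "\<And>t. 0 < t \<Longrightarrow> t \<le> 1 \<Longrightarrow> X \<le> t * B"
  shows "X \<le> 0"
proof (rule field_le_epsilon)
  fix e :: real assume e: "0 < e"
  define t where "t = min 1 (e / (\<bar>B\<bar> + 1))"
  have t: "0 < t" "t \<le> 1" "t \<le> e / (\<bar>B\<bar> + 1)" using e by (auto simp: t_def)
  have "X \<le> t * B" by (rule assms[OF t(1,2)])
  also have "\<dots> \<le> t * (\<bar>B\<bar> + 1)" using t by (intro mult_left_mono) auto
  also have "\<dots> \<le> e" using t(3) by (simp add: pos_le_divide_eq)
  finally show "X \<le> 0 + e" by simp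
qed

text \<open>The Cameron-Martin formula: a shift of the argument becomes an exponential weight, which is smooth in
the shift even when \<open>f\<close> is not.\<close>
lemma gauss_translate:
  fixes f :: "'a::euclidean_space \<Rightarrow> real"
  assumes [measurable]: "f \<in> borel_measurable borel"
  shows "(\<integral>y. f (y + u) \<partial>gauss) = (\<integral>y. f y * exp (y \<bullet> u - (norm u)\<^sup>2 / 2) \<partial>gauss)"
proof -
  have d: "std_gaussian_density (y - u) = std_gaussian_density y * exp (y \<bullet> u - (norm u)\<^sup>2 / 2)" for y :: 'a
  proof -
    have "- (norm (y - u))\<^sup>2 / 2 = - (norm y)\<^sup>2 / 2 + (y \<bullet> u - (norm u)\<^sup>2 / 2)"
      by (simp add: power2_norm_eq_inner inner_simps inner_commute field_simps)
    then show ?thesis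
      unfolding std_gaussian_density_eq by (simp only: exp_add mult.assoc)
  qed
  have "(\<integral>y. f (y + u) \<partial>gauss) = (\<integral>y. std_gaussian_density (y + u - u) * f (y + u) \<partial>lborel)"
    by (simp add: integral_gauss)
  also have "\<dots> = (\<integral>y. std_gaussian_density (y - u) * f y \<partial>lborel)"
    by (rule integral_lborel_translate) simp
  also have "\<dots> = (\<integral>y. f y * exp (y \<bullet> u - (norm u)\<^sup>2 / 2) \<partial>gauss)"
    by (simp add: integral_gauss d ac_simps)
  finally show ?thesis .
qed

lemma exp_second_order: "\<bar>exp x - 1 - x\<bar> \<le> x\<^sup>2 * exp \<bar>x\<bar> / 2" for x :: real
proof -
  obtain t where t: "\<bar>t\<bar> \<le> \<bar>x\<bar>" "exp x = (\<Sum>m<2. x ^ m / fact m) + exp t / fact 2 * x\<^sup>2"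
    using Maclaurin_exp_le[of x 2] by blast
  have "exp t \<le> exp \<bar>x\<bar>" using t(1) by simp
  then have "exp t / 2 * x\<^sup>2 \<le> exp \<bar>x\<bar> / 2 * x\<^sup>2" by (intro mult_right_mono) auto
  moreover have "exp x - 1 - x = exp t / 2 * x\<^sup>2"
    using t(2) by (simp add: numeral_2_eq_2 lessThan_Suc)
  moreover have "0 \<le> exp t / 2 * x\<^sup>2" by simp
  ultimately have "\<bar>exp x - 1 - x\<bar> \<le> exp \<bar>x\<bar> / 2 * x\<^sup>2" by linarith
  then show ?thesis by (simp add: mult.commute)
qed

lemma exp_tilt_bound:
  fixes y u :: "'a::euclidean_space"
  assumes u: "norm u \<le> \<rho>"
  shows "\<bar>exp (y \<bullet> u - (norm u)\<^sup>2 / 2) - 1 - y \<bullet> u\<bar> \<le> (norm u)\<^sup>2 * exp ((2 + \<rho>) * (norm y + \<rho>))"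
proof -
  define a where "a = norm y + \<rho>"
  define t where "t = y \<bullet> u - (norm u)\<^sup>2 / 2"
  have r: "0 \<le> \<rho>" using u norm_ge_zero[of u] by linarith
  then have a: "0 \<le> a" by (simp add: a_def)
  have "\<bar>t\<bar> \<le> \<bar>y \<bullet> u\<bar> + (norm u)\<^sup>2 / 2" using zero_le_power2[of "norm u"] unfolding t_def by linarith
  also have "\<dots> \<le> norm y * norm u + \<rho> * norm u"
  proof (rule add_mono[OF Cauchy_Schwarz_ineq2])
    have "norm u * norm u \<le> \<rho> * norm u" using u by (rule mult_right_mono) simp
    then show "(norm u)\<^sup>2 / 2 \<le> \<rho> * norm u"
      using mult_nonneg_nonneg[OF r norm_ge_zero[of u]] unfolding power2_eq_square by linarith
  qed
  finally have t: "\<bar>t\<bar> \<le> norm u * a" by (simp add: a_def algebra_simps)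
  then have t': "\<bar>t\<bar> \<le> \<rho> * a" using mult_right_mono[OF u a] by linarith
  have "t\<^sup>2 * exp \<bar>t\<bar> \<le> ((norm u)\<^sup>2 * a\<^sup>2) * exp (\<rho> * a)"
    using power_mono[OF t, of 2] t' a by (intro mult_mono) (auto simp: power_mult_distrib)
  also have "\<dots> \<le> ((norm u)\<^sup>2 * exp (2 * a)) * exp (\<rho> * a)"
    using power_le_exp[OF a, of 2] by (intro mult_right_mono mult_left_mono) auto
  also have "\<dots> = (norm u)\<^sup>2 * exp ((2 + \<rho>) * a)" by (simp only: distrib_right exp_add mult.assoc)
  finally have 1: "\<bar>exp t - 1 - t\<bar> \<le> (norm u)\<^sup>2 * exp ((2 + \<rho>) * a) / 2"
    using exp_second_order[of t] by linarith
  have "(norm u)\<^sup>2 * 1 \<le> (norm u)\<^sup>2 * exp ((2 + \<rho>) * a)"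
    using a r by (intro mult_left_mono) auto
  then have "\<bar>exp t - 1 - t\<bar> + (norm u)\<^sup>2 / 2 \<le> (norm u)\<^sup>2 * exp ((2 + \<rho>) * a)" using 1 by linarith
  moreover have "\<bar>exp t - 1 - y \<bullet> u\<bar> \<le> \<bar>exp t - 1 - t\<bar> + (norm u)\<^sup>2 / 2"
    using zero_le_power2[of "norm u"] unfolding t_def by linarith
  ultimately show ?thesis unfolding t_def a_def by linarith
qed

text \<open>For \<open>r < 1\<close> the operator \<open>OU r\<close> smooths any function of exponential growth. By Cameron-Martin,
\<open>OU r T (x + z)\<close> is the integral of \<open>T (mix r x y)\<close> against \<open>exp (y \<bullet> u - |u|\<^sup>2 / 2)\<close> with
\<open>u = (r / sqrt (1 - r\<^sup>2)) z\<close>, and the weight is \<open>1 + y \<bullet> u\<close> up to \<open>O(|u|\<^sup>2)\<close>. That bound is used for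
\<open>|z| \<le> 1\<close>; for larger \<open>z\<close> the remainder is bounded term by term, as then \<open>1 \<le> |z|\<^sup>2\<close>.\<close>
lemma tame_OU_smoothing:
  fixes T :: "'a::euclidean_space \<Rightarrow> real"
  assumes r: "0 \<le> r" "r < 1" and T: "exp_bounded T" and [measurable]: "T \<in> borel_measurable borel"
  obtains K l DU where "tame K l (OU r T) DU"
proof -
  obtain K l where K: "0 \<le> K" "0 \<le> l" "\<And>x. norm (T x) \<le> K * exp (l * norm x)"
    using T by (rule exp_boundedE) blast
  define c where "c = sqrt (1 - r\<^sup>2)"
  define \<rho> where "\<rho> = r / c"
  have "r\<^sup>2 < 1" using r by (simp add: power_less_one_iff)
  then have c: "0 < c" by (simp add: c_def)
  have \<rho>: "0 \<le> \<rho>" using c r by (simp add: \<rho>_def)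
  define DU where "DU x = \<rho> *\<^sub>R (\<integral>y. T (r *\<^sub>R x + c *\<^sub>R y) *\<^sub>R y \<partial>gauss)" for x
  define E where "E m = (\<integral>y. exp (m * norm y) \<partial>(gauss :: 'a measure))" for m
  have E0: "0 \<le> E m" for m by (simp add: E_def)
  define C1 where "C1 = \<rho>\<^sup>2 * (K * exp ((2 + \<rho>) * \<rho>) * E (l + (2 + \<rho>)))"
  define C2 where "C2 = K * E l"
  define C3 where "C3 = \<rho> * (K * E (l + 1))"
  have C: "0 \<le> C1" "0 \<le> C2" "0 \<le> C3" using K E0 \<rho> by (auto simp: C1_def C2_def C3_def)
  have r': "r \<le> 1" using r by simp
  have Tb: "\<bar>T (r *\<^sub>R x + c *\<^sub>R y)\<bar> \<le> K * (exp (l * norm x) * exp (l * norm y))" for x y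
  proof -
    have "\<bar>T (r *\<^sub>R x + c *\<^sub>R y)\<bar> \<le> K * exp (l * norm (r *\<^sub>R x + c *\<^sub>R y))"
      using K(3) by (simp add: real_norm_def)
    also have "\<dots> \<le> K * exp (l * (norm x + norm y))"
      using norm_comb_le[OF r(1) r', of x y] K by (intro mult_left_mono) (auto simp: c_def intro!: mult_left_mono)
    finally show ?thesis by (simp add: distrib_left exp_add)
  qed
  have eT: "exp_bounded (\<lambda>y. T (r *\<^sub>R x + c *\<^sub>R y))" for x by (rule exp_bounded_affine[OF T])
  have [measurable]: "DU \<in> borel_measurable borel" unfolding DU_def[abs_def] by measurable
  have U: "\<bar>OU r T x\<bar> \<le> C2 * exp (l * norm x)" for x
    using norm_OU_le[OF r(1) r' K] by (simp add: C2_def E_def)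
  have D: "norm (DU x) \<le> C3 * exp (l * norm x)" for x
  proof -
    have "norm (\<integral>y. T (r *\<^sub>R x + c *\<^sub>R y) *\<^sub>R y \<partial>gauss) \<le> (\<integral>y. (K * exp (l * norm x)) * exp ((l + 1) * norm y) \<partial>(gauss :: 'a measure))"
    proof (rule expectation_norm_bound)
      show "integrable gauss (\<lambda>y. T (r *\<^sub>R x + c *\<^sub>R y) *\<^sub>R y)"
        by (intro integrable_exp_bounded exp_bounded_intros eT) measurable
      show "integrable gauss (\<lambda>y::'a. (K * exp (l * norm x)) * exp ((l + 1) * norm y))"
        by (intro integrable_mult_right integrable_exp_norm)
      fix y
      have "norm (T (r *\<^sub>R x + c *\<^sub>R y) *\<^sub>R y) \<le> (K * (exp (l * norm x) * exp (l * norm y))) * exp (norm y)"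
        using Tb[of x y] le_exp[of "norm y"] K(1) unfolding norm_scaleR by (intro mult_mono) auto
      also have "\<dots> = (K * exp (l * norm x)) * exp ((l + 1) * norm y)"
        by (simp only: distrib_right exp_add mult.assoc mult_1)
      finally show "norm (T (r *\<^sub>R x + c *\<^sub>R y) *\<^sub>R y) \<le> (K * exp (l * norm x)) * exp ((l + 1) * norm y)" .
    qed
    then have "\<rho> * norm (\<integral>y. T (r *\<^sub>R x + c *\<^sub>R y) *\<^sub>R y \<partial>gauss) \<le> \<rho> * (K * exp (l * norm x) * E (l + 1))"
      using \<rho> by (intro mult_left_mono) (auto simp: E_def)
    then show ?thesis using \<rho> by (simp add: DU_def C3_def ac_simps)
  qed
  have small: "\<bar>OU r T (x + z) - OU r T x - DU x \<bullet> z\<bar> \<le> C1 * exp (l * norm x) * (norm z)\<^sup>2" if z: "norm z \<le> 1" for x z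
  proof -
    \<comment> \<open>The shift in the Gaussian variable \<open>y\<close> that produces the shift \<open>r z\<close> of the argument of \<open>T\<close>.\<close>
    let ?u = "\<rho> *\<^sub>R z" and ?T = "\<lambda>y. T (r *\<^sub>R x + c *\<^sub>R y)"
    let ?e = "\<lambda>y. exp (y \<bullet> ?u - (norm ?u)\<^sup>2 / 2)"
    have u: "norm ?u \<le> \<rho>" using z \<rho> by (simp add: mult_left_le)
    have cu: "c *\<^sub>R ?u = r *\<^sub>R z" using c by (simp add: \<rho>_def)
    have ee: "exp_bounded ?e"
    proof (rule exp_boundedI[of 1 "norm ?u"])
      fix y :: 'a
      have "y \<bullet> ?u - (norm ?u)\<^sup>2 / 2 \<le> norm ?u * norm y"
        using norm_cauchy_schwarz[of y ?u] zero_le_power2[of "norm ?u"]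
        unfolding mult.commute[of "norm ?u" "norm y"] by linarith
      then show "norm (?e y) \<le> 1 * exp (norm ?u * norm y)" by simp
    qed auto
    have i: "integrable gauss (\<lambda>y. ?T y * ?e y)" "integrable gauss ?T" "integrable gauss (\<lambda>y. ?T y *\<^sub>R y)"
      by (intro integrable_exp_bounded exp_bounded_intros eT ee; measurable)+
    have "OU r T (x + z) = (\<integral>y. ?T (y + ?u) \<partial>gauss)"
      unfolding OU_def c_def[symmetric] scaleR_add_right cu by (simp add: ac_simps)
    also have "\<dots> = (\<integral>y. ?T y * ?e y \<partial>gauss)" by (rule gauss_translate) measurable
    finally have 1: "OU r T (x + z) = (\<integral>y. ?T y * ?e y \<partial>gauss)" .
    have 2: "DU x \<bullet> z = (\<integral>y. ?T y * (y \<bullet> ?u) \<partial>gauss)"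
    proof -
      have "DU x \<bullet> z = (\<integral>y. (?T y *\<^sub>R y) \<bullet> ?u \<partial>gauss)"
        using i(3) by (subst integral_inner_left) (auto simp: DU_def)
      then show ?thesis by (simp only: inner_scaleR_left)
    qed
    have i3: "integrable gauss (\<lambda>y. ?T y * (y \<bullet> ?u))"
      using integrable_inner_left[OF i(3), of ?u] by (simp only: inner_scaleR_left)
    have x: "OU r T x = (\<integral>y. ?T y \<partial>gauss)" by (simp add: OU_def c_def)
    have eq: "OU r T (x + z) - OU r T x - DU x \<bullet> z = (\<integral>y. ?T y * (?e y - 1 - y \<bullet> ?u) \<partial>gauss)"
      unfolding 1 2 x using i i3 by (simp add: right_diff_distrib)
    have "norm (\<integral>y. ?T y * (?e y - 1 - y \<bullet> ?u) \<partial>gauss)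
      \<le> (\<integral>y. (K * exp (l * norm x) * (norm ?u)\<^sup>2 * exp ((2 + \<rho>) * \<rho>)) * exp ((l + (2 + \<rho>)) * norm y) \<partial>(gauss :: 'a measure))"
    proof (rule expectation_norm_bound)
      show "integrable gauss (\<lambda>y. ?T y * (?e y - 1 - y \<bullet> ?u))"
        using i i3 by (simp add: right_diff_distrib)
      show "integrable gauss (\<lambda>y::'a. (K * exp (l * norm x) * (norm ?u)\<^sup>2 * exp ((2 + \<rho>) * \<rho>)) * exp ((l + (2 + \<rho>)) * norm y))"
        by (intro integrable_mult_right integrable_exp_norm)
      fix y
      have "norm (?T y * (?e y - 1 - y \<bullet> ?u))
        \<le> (K * (exp (l * norm x) * exp (l * norm y))) * ((norm ?u)\<^sup>2 * exp ((2 + \<rho>) * (norm y + \<rho>)))"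
        unfolding real_norm_def abs_mult
        using Tb[of x y] exp_tilt_bound[OF u, of y] K(1) by (intro mult_mono) auto
      also have "\<dots> = (K * exp (l * norm x) * (norm ?u)\<^sup>2 * exp ((2 + \<rho>) * \<rho>)) * exp ((l + (2 + \<rho>)) * norm y)"
      proof -
        have "exp ((2 + \<rho>) * (norm y + \<rho>)) = exp ((2 + \<rho>) * norm y) * exp ((2 + \<rho>) * \<rho>)"
          unfolding distrib_left[of "2 + \<rho>" "norm y"] exp_add ..
        moreover have "exp ((l + (2 + \<rho>)) * norm y) = exp (l * norm y) * exp ((2 + \<rho>) * norm y)"
          unfolding distrib_right[of l "2 + \<rho>"] exp_add ..
        ultimately show ?thesis by (simp only: mult.assoc mult.commute mult.left_commute)
      qed
      finally show "norm (?T y * (?e y - 1 - y \<bullet> ?u))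
         \<le> (K * exp (l * norm x) * (norm ?u)\<^sup>2 * exp ((2 + \<rho>) * \<rho>)) * exp ((l + (2 + \<rho>)) * norm y)" .
    qed
    also have "\<dots> = C1 * exp (l * norm x) * (norm z)\<^sup>2"
      using \<rho> by (simp add: C1_def E_def power_mult_distrib)
    finally show ?thesis unfolding eq by simp
  qed
  define KK where "KK = C1 + 2 * C2 + C3"
  have KK: "0 \<le> KK" using C by (simp add: KK_def)
  have "tame KK l (OU r T) DU"
    unfolding tame_def
  proof (intro conjI allI)
    show "norm (DU x) \<le> KK * exp (l * norm x)" for x
      using order_trans[OF D mult_right_mono[of C3 KK]] C by (simp add: KK_def)
    fix x z :: 'a
    let ?w = "exp (l * (norm x + norm z))"
    have w: "exp (l * norm x) \<le> ?w" using K(2) by (simp add: mult_left_mono)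
    show "\<bar>OU r T (x + z) - OU r T x - DU x \<bullet> z\<bar> \<le> KK * ?w * (norm z)\<^sup>2"
    proof (cases "norm z \<le> 1")
      case True
      have "C1 * exp (l * norm x) * (norm z)\<^sup>2 \<le> KK * ?w * (norm z)\<^sup>2"
        using C w by (intro mult_right_mono mult_mono) (auto simp: KK_def)
      then show ?thesis using small[OF True, of x] by linarith
    next
      case False
      then have z: "1 \<le> norm z" by simp
      have z2: "norm z \<le> (norm z)\<^sup>2" "1 \<le> (norm z)\<^sup>2"
        using z mult_left_mono[OF z, of "norm z"] by (auto simp: power2_eq_square)
      have "\<bar>OU r T (x + z)\<bar> \<le> C2 * ?w"
      proof (rule order_trans[OF U])
        show "C2 * exp (l * norm (x + z)) \<le> C2 * ?w"
          using C K norm_triangle_ineq[of x z] by (intro mult_left_mono) (auto intro!: mult_left_mono)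
      qed
      moreover have "\<bar>OU r T x\<bar> \<le> C2 * ?w"
        using order_trans[OF U mult_left_mono[OF w C(2)]] .
      moreover have "\<bar>DU x \<bullet> z\<bar> \<le> (C3 * ?w) * norm z"
        using order_trans[OF Cauchy_Schwarz_ineq2 mult_right_mono[OF order_trans[OF D mult_left_mono[OF w C(3)]]]] by simp
      moreover have "(C3 * ?w) * norm z \<le> (C3 * ?w) * (norm z)\<^sup>2"
        using z2 C by (intro mult_left_mono) auto
      moreover have "C2 * ?w * 1 \<le> C2 * ?w * (norm z)\<^sup>2"
        using z2 C by (intro mult_left_mono) auto
      moreover have "0 \<le> C1 * ?w * (norm z)\<^sup>2" using C by simp
      ultimately have "\<bar>OU r T (x + z) - OU r T x - DU x \<bullet> z\<bar>
          \<le> C1 * ?w * (norm z)\<^sup>2 + C2 * ?w * (norm z)\<^sup>2 + C2 * ?w * (norm z)\<^sup>2 + C3 * ?w * (norm z)\<^sup>2"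
        by linarith
      then show ?thesis by (simp add: KK_def algebra_simps)
    qed
  qed (use KK K in auto)
  then show ?thesis by (rule that)
qed

lemma OU_square_le:
  fixes M :: "'a::euclidean_space \<Rightarrow> real"
  assumes M: "exp_bounded M" and [measurable]: "M \<in> borel_measurable borel"
  shows "(OU r M x)\<^sup>2 \<le> OU r (\<lambda>y. (M y)\<^sup>2) x"
proof -
  let ?f = "\<lambda>y. M (mix r x y)"
  have e: "exp_bounded ?f" by (rule exp_bounded_affine[OF M])
  have i: "integrable gauss ?f" "integrable gauss (\<lambda>y. (?f y)\<^sup>2)"
    by (intro integrable_exp_bounded exp_bounded_power e; measurable)+
  have "0 \<le> gauss.variance ?f" by (rule gauss.variance_positive)
  then show ?thesis using gauss.variance_eq[OF i] by (simp add: OU_def)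
qed

text \<open>An average of functions with local Lipschitz constant \<open>M\<close> has as local Lipschitz constant the average
of \<open>M\<close>. To bound the gradient \<open>g\<close>, compare \<open>OU r T\<close> at \<open>x\<close> and at \<open>x + t g\<close>, divide by \<open>t\<close>, and let
\<open>t\<close> tend to 0.\<close>
lemma OU_gradient_le:
  fixes T M :: "'a::euclidean_space \<Rightarrow> real"
  assumes r: "0 \<le> r" "r < 1" and T: "exp_bounded T" and M: "exp_bounded M"
    and [measurable]: "T \<in> borel_measurable borel" "M \<in> borel_measurable borel"
    and lip: "\<And>x z. \<bar>T (x + z) - T x\<bar> \<le> norm z * M x + C * (norm z)\<^sup>2"
    and U: "tame K l (OU r T) DU"
  shows "norm (DU x) \<le> OU r M x"
proof -
  define A where "A = OU r M x"
  define g where "g = DU x"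
  let ?u = "\<lambda>y. mix r x y"
  have M0: "0 \<le> M x" for x
  proof -
    have "- M x \<le> 0"
    proof (rule nonpos_if_le_linear)
      fix t :: real assume t: "0 < t" "t \<le> 1"
      obtain b :: 'a where b: "norm b = 1" using vector_choose_size[of 1] by auto
      have "0 \<le> t * M x + C * t\<^sup>2" using lip[of x "t *\<^sub>R b"] b t by simp
      then have "0 \<le> t * (M x + t * C)" by (simp add: algebra_simps power2_eq_square)
      then show "- M x \<le> t * C" using t by (simp add: zero_le_mult_iff)
    qed
    then show ?thesis by simp
  qed
  have A0: "0 \<le> A" unfolding A_def OU_def by (rule expectation_nonneg) (rule M0)
  have inc: "\<bar>OU r T (x + z) - OU r T x\<bar> \<le> norm z * A + \<bar>C\<bar> * (norm z)\<^sup>2" for z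
  proof -
    have i: "integrable gauss (\<lambda>y. T (mix r (x + z) y))" "integrable gauss (\<lambda>y. T (?u y))"
      "integrable gauss (\<lambda>y. M (?u y))"
      by (intro integrable_exp_bounded exp_bounded_affine T M; measurable)+
    have "norm (\<integral>y. T (mix r (x + z) y) - T (?u y) \<partial>gauss)
      \<le> (\<integral>y. norm z * M (?u y) + \<bar>C\<bar> * (norm z)\<^sup>2 \<partial>gauss)"
    proof (rule expectation_norm_bound)
      fix y
      have "\<bar>T (?u y + r *\<^sub>R z) - T (?u y)\<bar> \<le> norm (r *\<^sub>R z) * M (?u y) + C * (norm (r *\<^sub>R z))\<^sup>2" by (rule lip)
      also have "\<dots> \<le> norm z * M (?u y) + \<bar>C\<bar> * (norm z)\<^sup>2"
      proof (intro add_mono)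
        have rz: "norm (r *\<^sub>R z) \<le> norm z" using r by (simp add: mult_left_le_one_le)
        show "norm (r *\<^sub>R z) * M (?u y) \<le> norm z * M (?u y)" by (rule mult_right_mono[OF rz M0])
        show "C * (norm (r *\<^sub>R z))\<^sup>2 \<le> \<bar>C\<bar> * (norm z)\<^sup>2"
          using power_mono[OF rz, of 2] by (intro mult_mono) auto
      qed
      finally show "norm (T (mix r (x + z) y) - T (?u y)) \<le> norm z * M (?u y) + \<bar>C\<bar> * (norm z)\<^sup>2"
        by (simp add: scaleR_add_right ac_simps)
    qed (use i in auto)
    then show ?thesis using i by (simp add: OU_def A_def)
  qed
  have "(norm g)\<^sup>2 - norm g * A \<le> 0"
  proof (rule nonpos_if_le_linear)
    fix t :: real assume t: "0 < t" "t \<le> 1"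
    let ?E = "exp (l * (norm x + norm g))"
    have K: "0 \<le> K" "0 \<le> l" using tameD[OF U] by auto
    have ng: "norm (t *\<^sub>R g) \<le> norm g" using t by (simp add: mult_left_le_one_le)
    have "g \<bullet> (t *\<^sub>R g) \<le> \<bar>OU r T (x + t *\<^sub>R g) - OU r T x\<bar> + \<bar>OU r T (x + t *\<^sub>R g) - OU r T x - DU x \<bullet> (t *\<^sub>R g)\<bar>"
      by (simp add: g_def)
    also have "\<dots> \<le> (norm (t *\<^sub>R g) * A + \<bar>C\<bar> * (norm (t *\<^sub>R g))\<^sup>2) + K * exp (l * (norm x + norm (t *\<^sub>R g))) * (norm (t *\<^sub>R g))\<^sup>2"
      by (intro add_mono inc tameD(6)[OF U])
    also have "\<dots> \<le> (norm (t *\<^sub>R g) * A + \<bar>C\<bar> * (norm (t *\<^sub>R g))\<^sup>2) + K * ?E * (norm (t *\<^sub>R g))\<^sup>2"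
      using K ng by (intro add_left_mono mult_right_mono mult_left_mono) (auto intro!: mult_left_mono)
    also have "\<dots> = t * (norm g * A + t * ((\<bar>C\<bar> + K * ?E) * (norm g)\<^sup>2))"
      using t by (simp add: power2_eq_square algebra_simps)
    finally have "t * (norm g)\<^sup>2 \<le> t * (norm g * A + t * ((\<bar>C\<bar> + K * ?E) * (norm g)\<^sup>2))"
      by (simp add: power2_norm_eq_inner)
    then have "(norm g)\<^sup>2 \<le> norm g * A + t * ((\<bar>C\<bar> + K * ?E) * (norm g)\<^sup>2)"
      using t by (simp only: mult_le_cancel_left_pos)
    then show "(norm g)\<^sup>2 - norm g * A \<le> t * ((\<bar>C\<bar> + K * ?E) * (norm g)\<^sup>2)" by simp
  qed
  then have "norm g * norm g \<le> norm g * A" by (simp add: power2_eq_square)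
  then have "norm g \<le> A"
    using A0 by (cases "norm g = 0") (auto simp: mult_le_cancel_left)
  then show ?thesis by (simp add: g_def A_def)
qed

text \<open>The Poincare inequality for tame functions: in the covariance formula with \<open>F = H\<close>, Cauchy-Schwarz
bounds every term by the mean squared norm of the gradient.\<close>
lemma gauss_variance_le_gradient:
  fixes U :: "'a::euclidean_space \<Rightarrow> real"
  assumes U: "tame K l U DU"
  shows "(\<integral>x. (U x)\<^sup>2 \<partial>gauss) - (\<integral>x. U x \<partial>gauss)\<^sup>2 \<le> (\<integral>x. (norm (DU x))\<^sup>2 \<partial>gauss)"
proof -
  note [measurable] = tameD(3,4)[OF U]
  note eG = tame_exp_bounded_grad[OF U]
  let ?G = "\<integral>x. (norm (DU x))\<^sup>2 \<partial>gauss"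
  have en: "exp_bounded (\<lambda>x. (norm (DU x))\<^sup>2)" by (intro exp_bounded_intros eG)
  have I: "(\<integral>p. DU (fst p) \<bullet> DU (mix s (fst p) (snd p)) \<partial>gauss) \<le> ?G"
    if s: "0 \<le> s" "s \<le> 1" for s
  proof -
    let ?x = "\<lambda>p :: 'a \<times> 'a. mix s (fst p) (snd p)"
    have i: "integrable gauss (\<lambda>p. DU (fst p) \<bullet> DU (?x p))"
      "integrable (gauss :: ('a \<times> 'a) measure) (\<lambda>p. (norm (DU (fst p)))\<^sup>2)" "integrable gauss (\<lambda>p. (norm (DU (?x p)))\<^sup>2)"
      by (intro integrable_exp_bounded exp_bounded_intros exp_bounded_fst[OF eG] exp_bounded_comb[OF eG]; measurable)+
    have "(\<integral>p. DU (fst p) \<bullet> DU (?x p) \<partial>gauss) \<le> (\<integral>p. (norm (DU (fst p)))\<^sup>2 / 2 + (norm (DU (?x p)))\<^sup>2 / 2 \<partial>gauss)"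
    proof (rule expectation_mono)
      fix p :: "'a \<times> 'a"
      have "DU (fst p) \<bullet> DU (?x p) \<le> norm (DU (fst p)) * norm (DU (?x p))" by (rule norm_cauchy_schwarz)
      also have "\<dots> \<le> (norm (DU (fst p)))\<^sup>2 / 2 + (norm (DU (?x p)))\<^sup>2 / 2"
        using sum_squares_bound[of "norm (DU (fst p))" "norm (DU (?x p))"] by simp
      finally show "DU (fst p) \<bullet> DU (?x p) \<le> (norm (DU (fst p)))\<^sup>2 / 2 + (norm (DU (?x p)))\<^sup>2 / 2" .
    qed (use i in auto)
    also have "\<dots> = ?G"
      using i integral_gauss_fst[OF en, where 'b='a]
        integral_gauss_comb[OF en, of "sqrt (1 - s\<^sup>2)" s] sqrt_one_minus_le[OF s] s
      by (simp add: power_le_one)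
    finally show ?thesis .
  qed
  have "(1 / real n) * (\<Sum>k=1..n. \<integral>p. DU (fst p) \<bullet>
            DU (mix (real k / real n) (fst p) (snd p)) \<partial>gauss) \<le> ?G" if n: "1 \<le> n" for n :: nat
  proof -
    have "(\<Sum>k=1..n. \<integral>p. DU (fst p) \<bullet>
            DU (mix (real k / real n) (fst p) (snd p)) \<partial>gauss) \<le> (\<Sum>k=1..n. ?G)"
      using n by (intro sum_mono I) auto
    then show ?thesis using n by (simp add: field_simps)
  qed
  then have "(\<integral>x. U x * U x \<partial>gauss) - (\<integral>x. U x \<partial>gauss) * (\<integral>x. U x \<partial>gauss) \<le> ?G"
    by (intro LIMSEQ_le_const2[OF gauss_covariance[OF U U]] exI[of _ 1]) auto
  then show ?thesis by (simp add: power2_eq_square)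
qed

text \<open>The function \<open>T\<close> has only a local Lipschitz constant \<open>M\<close> here. The inequality holds for the
smoothing \<open>OU r T\<close>, whose gradient is at most \<open>OU r M\<close>, and passes to the limit \<open>r \<rightarrow> 1\<close> because
\<open>OU r T\<close> differs from \<open>T\<close> by at most \<open>sqrt (1 - r\<^sup>2)\<close> times a fixed integrable function.\<close>
theorem gauss_poincare:
  fixes T M :: "'a::euclidean_space \<Rightarrow> real"
  assumes T: "exp_bounded T" and M: "exp_bounded M"
    and [measurable]: "T \<in> borel_measurable borel" "M \<in> borel_measurable borel"
    and lip: "\<And>x z. \<bar>T (x + z) - T x\<bar> \<le> norm z * M x + C * (norm z)\<^sup>2"
  shows "(\<integral>x. (T x)\<^sup>2 \<partial>gauss) - (\<integral>x. T x \<partial>gauss)\<^sup>2 \<le> (\<integral>x. (M x)\<^sup>2 \<partial>gauss)"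
proof -
  \<comment> \<open>Up to the factor \<open>sqrt (1 - r\<^sup>2)\<close>, \<open>b (x, y)\<close> bounds the change of \<open>T\<close> from \<open>x\<close> to \<open>mix r x y\<close>; \<open>B\<close> is its mean over \<open>y\<close>.\<close>
  define b where "b p = (norm (fst p) + norm (snd p)) * \<bar>M (fst p)\<bar> + \<bar>C\<bar> * (norm (fst p) + norm (snd p))\<^sup>2" for p :: "'a \<times> 'a"
  define B where "B x = (\<integral>y. b (x, y) \<partial>gauss)" for x
  have b_eq: "b = (\<lambda>p. (norm (fst p) + norm (snd p)) * \<bar>M (fst p)\<bar> + \<bar>C\<bar> * (norm (fst p) + norm (snd p))\<^sup>2)"
    by (auto simp: b_def)
  have bm [measurable]: "b \<in> borel_measurable (borel \<Otimes>\<^sub>M borel)" unfolding b_eq by measurable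
  have eN: "exp_bounded (\<lambda>x::'a. norm x)" by (intro exp_bounded_intros)
  have Bm [measurable]: "B \<in> borel_measurable borel" unfolding B_def[abs_def] by measurable
  have ib: "integrable gauss (\<lambda>y. b (x, y))" for x
    unfolding b_def fst_conv snd_conv
    by (intro integrable_exp_bounded exp_bounded_intros eN) measurable
  obtain E0 where B_eq: "\<And>x. B x = (norm x + E0) * \<bar>M x\<bar> + \<bar>C\<bar> * ((norm x)\<^sup>2 + 2 * norm x * E0 + (\<integral>y. (norm y)\<^sup>2 \<partial>(gauss::'a measure)))"
  proof
    fix x :: 'a
    have i: "integrable (gauss :: 'a measure) norm" "integrable (gauss :: 'a measure) (\<lambda>y. (norm y)\<^sup>2)"
      by (intro integrable_exp_bounded exp_bounded_power eN; measurable)+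
    have "B x = (\<integral>y. norm x * \<bar>M x\<bar> + \<bar>M x\<bar> * norm y + (\<bar>C\<bar> * (norm x)\<^sup>2 + (\<bar>C\<bar> * (2 * norm x)) * norm y + \<bar>C\<bar> * (norm y)\<^sup>2) \<partial>(gauss::'a measure))"
      unfolding B_def b_def
      by (intro expectation_cong refl) (simp add: power2_sum algebra_simps)
    also have "\<dots> = norm x * \<bar>M x\<bar> + \<bar>M x\<bar> * (\<integral>y. norm y \<partial>(gauss::'a measure)) + (\<bar>C\<bar> * (norm x)\<^sup>2 +
      (\<bar>C\<bar> * (2 * norm x)) * (\<integral>y. norm y \<partial>(gauss::'a measure)) + \<bar>C\<bar> * (\<integral>y. (norm y)\<^sup>2 \<partial>(gauss::'a measure)))"
      using i by simp
    finally show "B x = (norm x + (\<integral>y. norm y \<partial>(gauss::'a measure))) * \<bar>M x\<bar> + \<bar>C\<bar> * ((norm x)\<^sup>2 + 2 * norm x * (\<integral>y. norm y \<partial>(gauss::'a measure)) + (\<integral>y. (norm y)\<^sup>2 \<partial>(gauss::'a measure)))"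
      by (simp add: algebra_simps)
  qed
  have eB: "exp_bounded B"
    unfolding B_eq[abs_def] by (intro exp_bounded_intros eN M)
  have B0: "0 \<le> B x" for x unfolding B_def b_def by (rule expectation_nonneg) simp
  define R where "R = (\<integral>x. (B x)\<^sup>2 + 2 * B x * \<bar>T x\<bar> \<partial>gauss)"
  have "(\<integral>x. (T x)\<^sup>2 \<partial>gauss) - (\<integral>x. T x \<partial>gauss)\<^sup>2 - (\<integral>x. (M x)\<^sup>2 \<partial>gauss) \<le> 0"
  proof (rule nonpos_if_le_linear)
    fix c :: real assume c: "0 < c" "c \<le> 1"
    \<comment> \<open>Parametrised by \<open>c = sqrt (1 - r\<^sup>2)\<close>, the smoothing error is linear in \<open>c\<close>.\<close>
    define r where "r = sqrt (1 - c\<^sup>2)"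
    have r: "0 \<le> r" "r < 1" using c by (auto simp: r_def power_le_one)
    have rc: "sqrt (1 - r\<^sup>2) = c" using c by (simp add: r_def power_le_one)
    have rr: "r * r = 1 - c\<^sup>2" using c by (simp add: r_def power_le_one)
    have r1: "1 - r \<le> c"
    proof -
      have "(1 - r) * (1 - r) \<le> (1 - r) * (1 + r)" using r by (intro mult_left_mono) auto
      then have "(1 - r)\<^sup>2 \<le> c\<^sup>2"
        using rr by (simp add: power2_eq_square algebra_simps)
      then show ?thesis using power2_le_imp_le[of "1 - r" c] c by simp
    qed
    obtain K l DU where U: "tame K l (OU r T) DU"
      using tame_OU_smoothing[OF r T] by auto
    have eU: "exp_bounded (OU r T)" and [measurable]: "DU \<in> borel_measurable borel"
      using tame_exp_bounded[OF U] tameD[OF U] by auto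
    have "(\<integral>x. (OU r T x)\<^sup>2 \<partial>gauss) - (\<integral>x. OU r T x \<partial>gauss)\<^sup>2 \<le> (\<integral>x. (norm (DU x))\<^sup>2 \<partial>gauss)"
      by (rule gauss_variance_le_gradient[OF U])
    also have "\<dots> \<le> (\<integral>x. OU r (\<lambda>y. (M y)\<^sup>2) x \<partial>gauss)"
    proof (rule expectation_mono)
      show "integrable gauss (\<lambda>x. (norm (DU x))\<^sup>2)"
        by (intro integrable_exp_bounded exp_bounded_intros tame_exp_bounded_grad[OF U]) measurable
      show "integrable gauss (OU r (\<lambda>y. (M y)\<^sup>2))"
        using r by (intro integrable_exp_bounded exp_bounded_OU exp_bounded_power M) auto
      show "(norm (DU x))\<^sup>2 \<le> OU r (\<lambda>y. (M y)\<^sup>2) x" for x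
      proof -
        have "(norm (DU x))\<^sup>2 \<le> (OU r M x)\<^sup>2"
          by (intro power_mono OU_gradient_le[OF r T M _ _ lip U]) auto
        also have "\<dots> \<le> OU r (\<lambda>y. (M y)\<^sup>2) x" by (intro OU_square_le M) auto
        finally show ?thesis .
      qed
    qed
    also have "\<dots> = (\<integral>x. (M x)\<^sup>2 \<partial>gauss)"
      using r by (intro integral_OU exp_bounded_power M) auto
    finally have 1: "(\<integral>x. (OU r T x)\<^sup>2 \<partial>gauss) - (\<integral>x. T x \<partial>gauss)\<^sup>2 \<le> (\<integral>x. (M x)\<^sup>2 \<partial>gauss)"
      using r integral_OU[OF _ _ T, of r] by simp
    have near: "\<bar>OU r T x - T x\<bar> \<le> c * B x" for x
    proof -
      have i: "integrable gauss (\<lambda>y. T (r *\<^sub>R x + c *\<^sub>R y))"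
        by (intro integrable_exp_bounded exp_bounded_affine T) measurable
      have "norm (\<integral>y. T (r *\<^sub>R x + c *\<^sub>R y) - T x \<partial>gauss) \<le> (\<integral>y. c * b (x, y) \<partial>gauss)"
      proof (rule expectation_norm_bound)
        fix y
        let ?d = "(r - 1) *\<^sub>R x + c *\<^sub>R y" and ?w = "norm x + norm y"
        have "norm ?d \<le> norm ((r - 1) *\<^sub>R x) + norm (c *\<^sub>R y)" by (rule norm_triangle_ineq)
        also have "\<dots> = (1 - r) * norm x + c * norm y" using r c by simp
        also have "\<dots> \<le> c * norm x + c * norm y" using r1 by (intro add_right_mono mult_right_mono) auto
        finally have d: "norm ?d \<le> c * ?w" by (simp add: distrib_left)
        have d2: "(norm ?d)\<^sup>2 \<le> c * ?w\<^sup>2"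
        proof -
          have "(norm ?d)\<^sup>2 \<le> (c * ?w)\<^sup>2" using d by (rule power_mono) simp
          also have "\<dots> = c * (c * ?w\<^sup>2)" by (simp add: power_mult_distrib power2_eq_square[of c])
          also have "\<dots> \<le> 1 * (c * ?w\<^sup>2)" using c by (intro mult_right_mono) auto
          finally show ?thesis by simp
        qed
        have "\<bar>T (x + ?d) - T x\<bar> \<le> norm ?d * M x + C * (norm ?d)\<^sup>2" by (rule lip)
        also have "\<dots> \<le> (c * ?w) * \<bar>M x\<bar> + \<bar>C\<bar> * (c * ?w\<^sup>2)"
        proof (rule add_mono)
          show "norm ?d * M x \<le> (c * ?w) * \<bar>M x\<bar>"
            using d c by (intro order_trans[OF mult_left_mono[OF abs_ge_self] mult_right_mono]) auto
          show "C * (norm ?d)\<^sup>2 \<le> \<bar>C\<bar> * (c * ?w\<^sup>2)"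
            using d2 by (intro order_trans[OF mult_right_mono[OF abs_ge_self] mult_left_mono]) auto
        qed
        also have "\<dots> = c * b (x, y)" by (simp add: b_def algebra_simps)
        also have "x + ?d = r *\<^sub>R x + c *\<^sub>R y" by (simp add: algebra_simps)
        finally show "norm (T (r *\<^sub>R x + c *\<^sub>R y) - T x) \<le> c * b (x, y)" by simp
      qed (use i ib in auto)
      then show ?thesis using i by (simp add: OU_def rc B_def)
    qed
    have "(\<integral>x. (T x)\<^sup>2 \<partial>gauss) \<le> (\<integral>x. (OU r T x)\<^sup>2 + c * ((B x)\<^sup>2 + 2 * B x * \<bar>T x\<bar>) \<partial>gauss)"
    proof (rule expectation_mono)
      show "integrable gauss (\<lambda>x. (T x)\<^sup>2)" "integrable gauss (\<lambda>x. (OU r T x)\<^sup>2 + c * ((B x)\<^sup>2 + 2 * B x * \<bar>T x\<bar>))"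
        by (intro integrable_exp_bounded exp_bounded_intros T eB eU; measurable)+
      fix x
      let ?e = "T x - OU r T x"
      have e: "\<bar>?e\<bar> \<le> c * B x" using near[of x] by (simp add: abs_minus_commute)
      have "(T x)\<^sup>2 = (OU r T x)\<^sup>2 + (2 * T x * ?e - ?e\<^sup>2)" by (simp add: power2_eq_square algebra_simps)
      also have "2 * T x * ?e - ?e\<^sup>2 \<le> c * ((B x)\<^sup>2 + 2 * B x * \<bar>T x\<bar>)"
      proof -
        have "T x * ?e \<le> \<bar>T x\<bar> * \<bar>?e\<bar>" by (simp flip: abs_mult)
        also have "\<dots> \<le> \<bar>T x\<bar> * (c * B x)" using e by (intro mult_left_mono) auto
        finally have "2 * T x * ?e - ?e\<^sup>2 \<le> 2 * (\<bar>T x\<bar> * (c * B x)) - 0"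
          by (intro diff_mono) auto
        also have "\<dots> \<le> 2 * (\<bar>T x\<bar> * (c * B x)) + c * (B x)\<^sup>2" using c by simp
        finally show ?thesis by (simp add: algebra_simps)
      qed
      finally show "(T x)\<^sup>2 \<le> (OU r T x)\<^sup>2 + c * ((B x)\<^sup>2 + 2 * B x * \<bar>T x\<bar>)" by simp
    qed
    also have "\<dots> = (\<integral>x. (OU r T x)\<^sup>2 \<partial>gauss) + c * R"
    proof (subst expectation_add)
      show "integrable gauss (\<lambda>x. (OU r T x)\<^sup>2)" "integrable gauss (\<lambda>x. c * ((B x)\<^sup>2 + 2 * B x * \<bar>T x\<bar>))"
        by (intro integrable_exp_bounded exp_bounded_intros T eB eU; measurable)+
    qed (simp add: R_def)
    finally show "(\<integral>x. (T x)\<^sup>2 \<partial>gauss) - (\<integral>x. T x \<partial>gauss)\<^sup>2 - (\<integral>x. (M x)\<^sup>2 \<partial>gauss) \<le> c * R"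
      using 1 by linarith
  qed
  then show ?thesis by simp
qed

section \<open>Projection onto a closed convex cone\<close>

lemma tame_lin:
  fixes F :: "'a::euclidean_space \<Rightarrow> real"
  assumes "F \<in> borel_measurable borel" "DF \<in> borel_measurable borel" "\<And>x. norm (DF x) \<le> 2 * norm x"
    "\<And>x z. \<bar>F (x + z) - F x - DF x \<bullet> z\<bar> \<le> 2 * (norm z)\<^sup>2"
  shows "tame 2 1 F DF"
  unfolding tame_def
proof (intro conjI allI)
  fix x z :: 'a
  show "norm (DF x) \<le> 2 * exp (1 * norm x)"
    using assms(3)[of x] le_exp[of "norm x"] unfolding mult_1 by linarith
  have "2 * 1 * (norm z)\<^sup>2 \<le> 2 * exp (1 * (norm x + norm z)) * (norm z)\<^sup>2"
    by (intro mult_right_mono mult_left_mono) auto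
  then show "\<bar>F (x + z) - F x - DF x \<bullet> z\<bar> \<le> 2 * exp (1 * (norm x + norm z)) * (norm z)\<^sup>2"
    using assms(4)[of x z] by linarith
qed (use assms in auto)

locale closed_cone =
  fixes C :: "'a::euclidean_space set"
  assumes closed: "closed C" and cone: "convex_cone C"
begin

abbreviation prj :: "'a \<Rightarrow> 'a" where "prj \<equiv> closest_point C"

lemma nonempty: "C \<noteq> {}" and convex: "convex C"
  using cone by (auto simp: convex_cone_def)

lemma proj_in: "prj x \<in> C"
  by (rule closest_point_in_set[OF closed nonempty])

lemma proj_scale: "u \<in> C \<Longrightarrow> 0 \<le> t \<Longrightarrow> t *\<^sub>R u \<in> C"
  by (rule convex_cone_scaleR[OF cone])

lemma proj_residual_orthogonal: "(x - prj x) \<bullet> prj x = 0"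
proof -
  have "(x - prj x) \<bullet> (2 *\<^sub>R prj x - prj x) \<le> 0" "(x - prj x) \<bullet> (0 *\<^sub>R prj x - prj x) \<le> 0"
    by (rule closest_point_dot[OF convex closed proj_scale[OF proj_in]]; simp)+
  moreover have "2 *\<^sub>R prj x - prj x = prj x" by (simp add: scaleR_2)
  ultimately show ?thesis by simp
qed

text \<open>The variational inequality for the projection, together with the orthogonality of \<open>prj x\<close> and the residual: half of Moreau's decomposition.\<close>
lemma proj_residual_polar: "u \<in> C \<Longrightarrow> (x - prj x) \<bullet> u \<le> 0"
  using closest_point_dot[OF convex closed, of u x] proj_residual_orthogonal[of x]
  by (simp add: inner_diff_right)

lemma proj_inner: "x \<bullet> prj x = (norm (prj x))\<^sup>2"
  using proj_residual_orthogonal[of x] by (simp add: inner_diff_left power2_norm_eq_inner)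

lemma norm_proj_le: "norm (prj x) \<le> norm x"
proof (cases "prj x = 0")
  case False
  have "norm (prj x) * norm (prj x) \<le> norm x * norm (prj x)"
    using norm_cauchy_schwarz[of x "prj x"] by (simp add: proj_inner power2_eq_square)
  then show ?thesis using False by simp
qed simp

lemma norm_proj_diff_le: "norm (prj x - prj y) \<le> norm (x - y)"
  using closest_point_lipschitz[OF convex closed nonempty, of x y] by (simp add: dist_norm)

lemma borel_measurable_proj [measurable]: "prj \<in> borel_measurable borel"
  by (intro borel_measurable_continuous_onI continuous_on_closest_point convex closed nonempty)

lemma exp_bounded_proj: "exp_bounded prj"
  by (rule exp_bounded_mono[OF exp_bounded_id norm_proj_le])

definition sqproj :: "'a \<Rightarrow> real" where "sqproj x = (norm (prj x))\<^sup>2"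

lemma borel_measurable_sqproj [measurable]: "sqproj \<in> borel_measurable borel"
  unfolding sqproj_def[abs_def] by measurable

lemma exp_bounded_sqproj: "exp_bounded sqproj"
  unfolding sqproj_def[abs_def] by (intro exp_bounded_intros exp_bounded_proj)

text \<open>The function \<open>sqproj\<close> is the supremum over \<open>u \<in> C\<close> of the affine functions
\<open>2 (x \<bullet> u) - |u|\<^sup>2\<close>, attained at \<open>u = prj x\<close>. So it is convex with subgradient \<open>2 prj x\<close>.\<close>
lemma sqproj_lower: "sqproj x + 2 * (prj x \<bullet> z) \<le> sqproj (x + z)"
proof -
  let ?p = "prj x" and ?q = "prj (x + z)"
  have "(x + z - ?q) \<bullet> ?p \<le> 0" by (rule proj_residual_polar[OF proj_in])
  then have "?p \<bullet> x + ?p \<bullet> z \<le> ?q \<bullet> ?p" by (simp add: inner_diff_left inner_diff_right inner_add_left inner_add_right inner_commute)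
  moreover have "?p \<bullet> x = ?p \<bullet> ?p" using proj_inner[of x] by (simp add: power2_norm_eq_inner inner_commute)
  moreover have "0 \<le> (?q - ?p) \<bullet> (?q - ?p)" by simp
  then have "2 * (?q \<bullet> ?p) \<le> ?q \<bullet> ?q + ?p \<bullet> ?p" by (simp add: inner_diff_left inner_diff_right inner_commute)
  ultimately show ?thesis by (simp add: sqproj_def power2_norm_eq_inner)
qed

text \<open>Convexity at \<open>x + z\<close>, applied backwards, together with the 1-Lipschitz property of the projection.\<close>
lemma sqproj_upper: "sqproj (x + z) \<le> sqproj x + 2 * (prj x \<bullet> z) + 2 * (norm z)\<^sup>2"
proof -
  have "sqproj (x + z) - 2 * (prj (x + z) \<bullet> z) \<le> sqproj x"
    using sqproj_lower[of "x + z" "- z"] by simp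
  moreover have "(prj (x + z) - prj x) \<bullet> z \<le> (norm z)\<^sup>2"
  proof -
    have "(prj (x + z) - prj x) \<bullet> z \<le> norm (prj (x + z) - prj x) * norm z" by (rule norm_cauchy_schwarz)
    also have "\<dots> \<le> norm z * norm z"
      using norm_proj_diff_le[of "x + z" x] by (intro mult_right_mono) auto
    finally show ?thesis by (simp add: power2_eq_square)
  qed
  ultimately show ?thesis by (simp add: inner_diff_left)
qed

lemma tame_sqproj: "tame 2 1 sqproj (\<lambda>x. 2 *\<^sub>R prj x)"
proof (rule tame_lin)
  show "norm (2 *\<^sub>R prj x) \<le> 2 * norm x" for x using norm_proj_le[of x] by simp
  show "\<bar>sqproj (x + z) - sqproj x - 2 *\<^sub>R prj x \<bullet> z\<bar> \<le> 2 * (norm z)\<^sup>2" for x z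
    using sqproj_lower[of x z] sqproj_upper[of x z] by simp
qed auto

lemma tame_sqnorm: "tame 2 1 (\<lambda>x::'a. (norm x)\<^sup>2) (\<lambda>x. 2 *\<^sub>R x)"
proof (rule tame_lin)
  show "\<bar>(norm (x + z))\<^sup>2 - (norm x)\<^sup>2 - 2 *\<^sub>R x \<bullet> z\<bar> \<le> 2 * (norm z)\<^sup>2" for x z :: 'a
    by (simp add: power2_norm_eq_inner inner_simps inner_commute)
qed auto

lemma tame_residual: "tame 2 1 (\<lambda>x. (norm x)\<^sup>2 - sqproj x) (\<lambda>x. 2 *\<^sub>R (x - prj x))"
proof (rule tame_lin)
  show "norm (2 *\<^sub>R (x - prj x)) \<le> 2 * norm x" for x
  proof -
    have "(norm (x - prj x))\<^sup>2 \<le> (norm x)\<^sup>2"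
      using proj_inner[of x] by (simp add: power2_norm_eq_inner inner_simps inner_commute)
    then show ?thesis by (simp add: power2_le_iff_abs_le)
  qed
  show "\<bar>(norm (x + z))\<^sup>2 - sqproj (x + z) - ((norm x)\<^sup>2 - sqproj x) - 2 *\<^sub>R (x - prj x) \<bullet> z\<bar> \<le> 2 * (norm z)\<^sup>2" for x z
  proof -
    have "(norm (x + z))\<^sup>2 - (norm x)\<^sup>2 - 2 * (x \<bullet> z) = (norm z)\<^sup>2"
      by (simp add: power2_norm_eq_inner inner_simps inner_commute)
    then show ?thesis
      using sqproj_lower[of x z] sqproj_upper[of x z] zero_le_power2[of "norm z"]
      by (simp add: inner_diff_left abs_le_iff)
  qed
qed auto

definition \<delta> :: real where "\<delta> = (\<integral>x. sqproj x \<partial>gauss)"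
definition var :: real where "var = (\<integral>x. (sqproj x)\<^sup>2 \<partial>gauss) - \<delta>\<^sup>2"

lemma integrable_sqproj: "integrable gauss sqproj" "integrable gauss (\<lambda>x. (sqproj x)\<^sup>2)"
  by (intro integrable_exp_bounded exp_bounded_power exp_bounded_sqproj; measurable)+

lemma variance_upper: "var \<le> 4 * \<delta>"
proof -
  have "(\<integral>x. (sqproj x)\<^sup>2 \<partial>gauss) - (\<integral>x. sqproj x \<partial>gauss)\<^sup>2 \<le> (\<integral>x. (norm (2 *\<^sub>R prj x))\<^sup>2 \<partial>gauss)"
    by (rule gauss_variance_le_gradient[OF tame_sqproj])
  also have "\<dots> = 4 * \<delta>" by (simp add: \<delta>_def sqproj_def power_mult_distrib)
  finally show ?thesis by (simp add: var_def \<delta>_def)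
qed

text \<open>Each term of the covariance formula is \<open>4 s \<delta>\<close>, because \<open>prj x \<bullet> x = |prj x|\<^sup>2\<close> and the independent
component averages to 0; the mean of \<open>4 s\<close> over \<open>0 \<le> s \<le> 1\<close> is 2.\<close>
lemma covariance_sqnorm:
  "(\<integral>x. sqproj x * (norm x)\<^sup>2 \<partial>gauss) - \<delta> * (\<integral>x. (norm x)\<^sup>2 \<partial>(gauss :: 'a measure)) = 2 * \<delta>"
proof (rule LIMSEQ_unique)
  have I: "(\<integral>p. (2 *\<^sub>R prj (fst p)) \<bullet> (2 *\<^sub>R (mix s (fst p) (snd p))) \<partial>gauss) = 4 * s * \<delta>" for s
  proof -
    have i: "integrable gauss (\<lambda>y. y \<bullet> u)" for u :: 'a
      by (intro integrable_exp_bounded exp_bounded_intros) measurable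
    have "(\<integral>p. (2 *\<^sub>R prj (fst p)) \<bullet> (2 *\<^sub>R (mix s (fst p) (snd p))) \<partial>gauss)
       = (\<integral>x. \<integral>y. (2 *\<^sub>R prj x) \<bullet> (2 *\<^sub>R (mix s x y)) \<partial>gauss \<partial>gauss)"
    proof (subst integral_gauss_prod)
      show "exp_bounded (\<lambda>p. (2 *\<^sub>R prj (fst p)) \<bullet> (2 *\<^sub>R (mix s (fst p) (snd p))))"
        by (intro exp_bounded_intros exp_bounded_fst[OF exp_bounded_proj] exp_bounded_comb[OF exp_bounded_id])
    qed simp_all
    also have "\<dots> = (\<integral>x. (4 * s) * sqproj x \<partial>gauss)"
    proof (rule expectation_cong[OF refl])
      fix x
      have "(2 *\<^sub>R prj x) \<bullet> (2 *\<^sub>R (mix s x y)) = (4 * s) * sqproj x + y \<bullet> ((4 * sqrt (1 - s\<^sup>2)) *\<^sub>R prj x)" for y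
        using proj_inner[of x] by (simp add: inner_add_right inner_commute sqproj_def algebra_simps)
      then show "(\<integral>y. (2 *\<^sub>R prj x) \<bullet> (2 *\<^sub>R (mix s x y)) \<partial>gauss) = (4 * s) * sqproj x"
        using i[of "(4 * sqrt (1 - s\<^sup>2)) *\<^sub>R prj x"] gauss_inner[of "(4 * sqrt (1 - s\<^sup>2)) *\<^sub>R prj x"]
        by (simp only:) (subst expectation_add, simp_all)
    qed
    also have "\<dots> = 4 * s * \<delta>" by (simp add: \<delta>_def)
    finally show ?thesis .
  qed
  have "(1 / real n) * (\<Sum>k=1..n. 4 * (real k / real n) * \<delta>) = 2 * \<delta> * (1 + inverse (real n))" if "1 \<le> n" for n
  proof -
    have "(\<Sum>k=1..n. 4 * (real k / real n) * \<delta>) = (4 * \<delta> / real n) * (\<Sum>k=1..n. real k)"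
      unfolding sum_distrib_left by (intro sum.cong refl) simp
    also have "(\<Sum>k=1..n. real k) = real n * (real n + 1) / 2"
      by (induction n) (auto simp: field_simps)
    finally have S: "(\<Sum>k=1..n. 4 * (real k / real n) * \<delta>) = 4 * \<delta> / real n * (real n * (real n + 1) / 2)" .
    show ?thesis unfolding S using that by (simp add: field_simps)
  qed
  then have ev: "eventually (\<lambda>n. 2 * \<delta> * (1 + inverse (real n)) = (1 / real n) * (\<Sum>k=1..n. 4 * (real k / real n) * \<delta>)) sequentially"
    by (intro eventually_sequentiallyI[of 1]) simp
  have "(\<lambda>n. 2 * \<delta> * (1 + inverse (real n))) \<longlonglongrightarrow> 2 * \<delta> * (1 + 0)"
    by (intro tendsto_intros LIMSEQ_inverse_real_of_nat)
      (rule tendsto_inverse_0_at_top[OF filterlim_real_sequentially])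
  then show "(\<lambda>n. (1 / real n) * (\<Sum>k=1..n. 4 * (real k / real n) * \<delta>)) \<longlonglongrightarrow> 2 * \<delta>"
    using Lim_transform_eventually[OF _ ev] by simp
  show "(\<lambda>n. (1 / real n) * (\<Sum>k=1..n. 4 * (real k / real n) * \<delta>))
     \<longlonglongrightarrow> (\<integral>x. sqproj x * (norm x)\<^sup>2 \<partial>gauss) - \<delta> * (\<integral>x. (norm x)\<^sup>2 \<partial>(gauss :: 'a measure))"
    using gauss_covariance[OF tame_sqproj tame_sqnorm] unfolding I \<delta>_def[symmetric] .
qed

text \<open>The gradients are \<open>2 prj x\<close>, in the cone, and \<open>2 (x' - prj x')\<close>, in its polar, whatever the two
points are. So all terms of the covariance formula are nonpositive.\<close>
lemma covariance_residual:
  "(\<integral>x. sqproj x * ((norm x)\<^sup>2 - sqproj x) \<partial>gauss) - \<delta> * (\<integral>x. (norm x)\<^sup>2 - sqproj x \<partial>gauss) \<le> 0"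
  unfolding \<delta>_def
proof (rule LIMSEQ_le_const2[OF gauss_covariance[OF tame_sqproj tame_residual]], intro exI allI impI)
  have "(\<integral>p. 2 *\<^sub>R prj (fst p) \<bullet> 2 *\<^sub>R (f p - prj (f p)) \<partial>gauss) \<le> 0" for f :: "'a \<times> 'a \<Rightarrow> 'a"
  proof -
    have "0 \<le> (\<integral>p. - (2 *\<^sub>R prj (fst p) \<bullet> 2 *\<^sub>R (f p - prj (f p))) \<partial>gauss)"
      using proj_residual_polar[OF proj_in] by (intro expectation_nonneg) (simp add: inner_commute)
    then show ?thesis by simp
  qed
  then show "1 / real n * (\<Sum>k=1..n. \<integral>p. 2 *\<^sub>R prj (fst p) \<bullet>
     2 *\<^sub>R (mix (real k / real n) (fst p) (snd p) -
           prj (mix (real k / real n) (fst p) (snd p))) \<partial>gauss) \<le> 0" for n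
    by (intro mult_nonneg_nonpos sum_nonpos) auto
qed

text \<open>\<open>sqproj\<close> is the difference of \<open>|x|\<^sup>2\<close>, whose covariance with \<open>sqproj\<close> is \<open>2 \<delta>\<close>, and the squared
residual, whose covariance with it is nonpositive.\<close>
lemma variance_lower: "2 * \<delta> \<le> var"
proof -
  have eN: "exp_bounded (\<lambda>x::'a. (norm x)\<^sup>2)" by (intro exp_bounded_intros)
  have i: "integrable gauss (\<lambda>x. sqproj x * (norm x)\<^sup>2)" "integrable (gauss :: 'a measure) (\<lambda>x. (norm x)\<^sup>2)"
    by (intro integrable_exp_bounded exp_bounded_mult exp_bounded_sqproj eN; measurable)+
  have "(\<integral>x. sqproj x * ((norm x)\<^sup>2 - sqproj x) \<partial>gauss) = (\<integral>x. sqproj x * (norm x)\<^sup>2 \<partial>gauss) - (\<integral>x. (sqproj x)\<^sup>2 \<partial>gauss)"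
    using i integrable_sqproj by (simp add: right_diff_distrib power2_eq_square)
  moreover have "(\<integral>x. (norm x)\<^sup>2 - sqproj x \<partial>gauss) = (\<integral>x. (norm x)\<^sup>2 \<partial>(gauss :: 'a measure)) - \<delta>"
    using i integrable_sqproj by (simp add: \<delta>_def)
  ultimately have "2 * \<delta> - ((\<integral>x. (sqproj x)\<^sup>2 \<partial>gauss) - \<delta> * \<delta>) \<le> 0"
    using covariance_residual covariance_sqnorm by (simp add: right_diff_distrib)
  then show ?thesis by (simp add: var_def power2_eq_square)
qed

text \<open>For a self-dual cone the residual \<open>x - prj x\<close> is minus a point of the cone, and that point satisfies
the variational characterisation of the projection of \<open>- x\<close>.\<close>
lemma proj_uminus_self_dual:
  assumes sd: "polar_cone C = uminus ` C"
  shows "prj (- x) = prj x - x"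
proof (rule closest_point_unique[OF convex closed, symmetric])
  let ?y = "prj x - x"
  have "x - prj x \<in> polar_cone C"
    using proj_residual_polar by (simp add: polar_cone_def)
  then obtain w where "w \<in> C" "x - prj x = - w" unfolding sd by auto
  then show y: "?y \<in> C" by (metis minus_diff_eq minus_minus)
  show "\<forall>u\<in>C. dist (- x) ?y \<le> dist (- x) u"
  proof
    fix u assume "u \<in> C"
    then have "- u \<in> polar_cone C" unfolding sd by simp
    then have "(- u) \<bullet> prj x \<le> 0" using proj_in[of x] by (simp add: polar_cone_def)
    then have u: "0 \<le> u \<bullet> prj x" by simp
    have "(norm (- x - ?y))\<^sup>2 \<le> (norm (- x - u))\<^sup>2"
    proof -
      have "- x - u = - prj x + (?y - u)" by simp
      then have "(norm (- x - u))\<^sup>2 = (norm (prj x))\<^sup>2 - 2 * (prj x \<bullet> (?y - u)) + (norm (?y - u))\<^sup>2"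
        by (simp only: power2_norm_eq_inner inner_add_left inner_add_right inner_minus_left inner_minus_right inner_commute)
      moreover have "prj x \<bullet> (?y - u) = - (u \<bullet> prj x)"
        using proj_inner[of x] by (simp add: inner_diff_right power2_norm_eq_inner inner_commute)
      ultimately show ?thesis using u by simp
    qed
    then show "dist (- x) ?y \<le> dist (- x) u" by (simp add: dist_norm power2_le_iff_abs_le)
  qed
qed

lemma delta_self_dual:
  assumes sd: "polar_cone C = uminus ` C"
  shows "\<delta> = real (DIM('a)) / 2"
proof -
  have "sqproj (- x) = (norm x)\<^sup>2 - sqproj x" for x
    unfolding sqproj_def proj_uminus_self_dual[OF sd]
    using proj_inner[of x] by (simp add: power2_norm_eq_inner inner_simps inner_commute)
  then have "(\<integral>x. sqproj (- x) \<partial>gauss) = (\<integral>x. (norm x)\<^sup>2 - sqproj x \<partial>gauss)" by simp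
  also have "\<dots> = real (DIM('a)) - \<delta>"
  proof -
    have "integrable (gauss :: 'a measure) (\<lambda>x. (norm x)\<^sup>2)"
      by (intro integrable_exp_bounded exp_bounded_intros) measurable
    then show ?thesis using integrable_sqproj by (simp add: \<delta>_def integral_sqnorm)
  qed
  also have "(\<integral>x. sqproj (- x) \<partial>gauss) = \<delta>"
    unfolding \<delta>_def by (rule gauss_uminus[OF exp_bounded_sqproj]) measurable
  finally show ?thesis by simp
qed

text \<open>Both factors are 1-Lipschitz functions of the pair \<open>p\<close>, so the inner product has the local Lipschitz
constant \<open>|prj (fst p)| + |prj (mix s (fst p) (snd p))|\<close>, whose mean square is at most \<open>4 \<delta>\<close>.\<close>
lemma variance_proj_inner:
  assumes s: "0 \<le> s" "s \<le> 1"
  defines "t \<equiv> \<lambda>p :: 'a \<times> 'a. prj (fst p) \<bullet> prj (mix s (fst p) (snd p))"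
  shows "(\<integral>p. (t p)\<^sup>2 \<partial>gauss) - (\<integral>p. t p \<partial>gauss)\<^sup>2 \<le> 4 * \<delta>"
proof -
  let ?x = "\<lambda>p :: 'a \<times> 'a. mix s (fst p) (snd p)"
  let ?M = "\<lambda>p :: 'a \<times> 'a. norm (prj (?x p)) + norm (prj (fst p))"
  note e1 = exp_bounded_fst[OF exp_bounded_proj, where 'c='a] and e2 = exp_bounded_comb[OF exp_bounded_proj, of s "sqrt (1 - s\<^sup>2)"]
  have nx: "norm (?x z) \<le> norm z" for z
  proof -
    have "norm (?x z) \<le> s * norm (fst z) + sqrt (1 - s\<^sup>2) * norm (snd z)"
      using norm_triangle_ineq[of "s *\<^sub>R fst z" "sqrt (1 - s\<^sup>2) *\<^sub>R snd z"] s sqrt_one_minus_le[OF s] by simp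
    also have "\<dots> \<le> norm z"
    proof (rule power2_le_imp_le)
      have "(s * norm (fst z) + sqrt (1 - s\<^sup>2) * norm (snd z))\<^sup>2
         \<le> (s\<^sup>2 + (sqrt (1 - s\<^sup>2))\<^sup>2) * ((norm (fst z))\<^sup>2 + (norm (snd z))\<^sup>2)"
        using zero_le_power2[of "s * norm (snd z) - sqrt (1 - s\<^sup>2) * norm (fst z)"]
        by (simp only: power2_eq_square algebra_simps)
      also have "\<dots> = (norm z)\<^sup>2" using s by (simp add: norm_prod_def power_le_one)
      finally show "(s * norm (fst z) + sqrt (1 - s\<^sup>2) * norm (snd z))\<^sup>2 \<le> (norm z)\<^sup>2" .
    qed simp
    finally show ?thesis .
  qed
  have "(\<integral>p. (t p)\<^sup>2 \<partial>gauss) - (\<integral>p. t p \<partial>gauss)\<^sup>2 \<le> (\<integral>p. (?M p)\<^sup>2 \<partial>gauss)"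
  proof (rule gauss_poincare[where C=1])
    show "exp_bounded t" unfolding t_def by (intro exp_bounded_inner e1 e2)
    show "exp_bounded ?M" by (intro exp_bounded_intros e1 e2)
    show "t \<in> borel_measurable borel" "?M \<in> borel_measurable borel" unfolding t_def by measurable
    fix p z :: "'a \<times> 'a"
    let ?a = "prj (fst p)" and ?b = "prj (?x p)" and ?da = "prj (fst (p + z)) - prj (fst p)" and ?db = "prj (?x (p + z)) - prj (?x p)"
    have da: "norm ?da \<le> norm z"
      using norm_proj_diff_le[of "fst (p + z)" "fst p"] norm_fst_le[of "fst z" "snd z"] by simp
    have "?x (p + z) - ?x p = ?x z" by (simp add: scaleR_add_right)
    then have db: "norm ?db \<le> norm z"
      using norm_proj_diff_le[of "?x (p + z)" "?x p"] nx[of z] by simp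
    have "t (p + z) - t p = ?da \<bullet> ?b + ?a \<bullet> ?db + ?da \<bullet> ?db"
      by (simp add: t_def inner_diff_left inner_diff_right)
    then have "\<bar>t (p + z) - t p\<bar> \<le> \<bar>?da \<bullet> ?b\<bar> + \<bar>?a \<bullet> ?db\<bar> + \<bar>?da \<bullet> ?db\<bar>" by linarith
    also have "\<dots> \<le> norm z * norm ?b + norm ?a * norm z + norm z * norm z"
      using da db by (intro add_mono order_trans[OF Cauchy_Schwarz_ineq2] mult_mono) auto
    finally show "\<bar>t (p + z) - t p\<bar> \<le> norm z * ?M p + 1 * (norm z)\<^sup>2"
      by (simp add: algebra_simps power2_eq_square)
  qed
  also have "\<dots> \<le> (\<integral>p. 2 * sqproj (?x p) + 2 * sqproj (fst p) \<partial>gauss)"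
  proof (rule expectation_mono)
    show "integrable gauss (\<lambda>p. (?M p)\<^sup>2)"
      by (intro integrable_exp_bounded exp_bounded_intros e1 e2) measurable
    show "integrable gauss (\<lambda>p. 2 * sqproj (?x p) + 2 * sqproj (fst p))"
      by (intro integrable_exp_bounded exp_bounded_intros exp_bounded_fst[OF exp_bounded_sqproj] exp_bounded_comb[OF exp_bounded_sqproj]) measurable
    show "(?M p)\<^sup>2 \<le> 2 * sqproj (?x p) + 2 * sqproj (fst p)" for p
      using sum_squares_bound[of "norm (prj (?x p))" "norm (prj (fst p))"]
      by (simp add: sqproj_def power2_sum)
  qed
  also have "\<dots> = 4 * \<delta>"
  proof -
    have i: "integrable gauss (\<lambda>p. sqproj (?x p))" "integrable (gauss :: ('a \<times> 'a) measure) (\<lambda>p. sqproj (fst p))"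
      by (intro integrable_exp_bounded exp_bounded_fst[OF exp_bounded_sqproj] exp_bounded_comb[OF exp_bounded_sqproj]; measurable)+
    have "(\<integral>p. sqproj (?x p) \<partial>gauss) = \<delta>"
      using integral_gauss_comb[OF exp_bounded_sqproj, of "sqrt (1 - s\<^sup>2)" s] s sqrt_one_minus_le[OF s]
      by (simp add: \<delta>_def power_le_one)
    moreover have "(\<integral>p. sqproj (fst p) \<partial>(gauss :: ('a \<times> 'a) measure)) = \<delta>"
      unfolding \<delta>_def by (rule integral_gauss_fst[OF exp_bounded_sqproj]) measurable
    ultimately show ?thesis using i by simp
  qed
  finally show ?thesis .
qed

end

abbreviation "\<phi> \<equiv> std_normal_density"

section \<open>Stein's equation for the normal law\<close>

lemma std_normal_density_deriv: "(\<phi> has_real_derivative - (v * \<phi> v)) (at v)"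
proof -
  have "((\<lambda>v. c * exp (- v\<^sup>2 / 2)) has_real_derivative - (v * (c * exp (- v\<^sup>2 / 2)))) (at v)" for c :: real
    by (auto intro!: derivative_eq_intros)
  from this[of "1 / sqrt (2 * pi)"] show ?thesis by (simp only: std_normal_density_def[abs_def])
qed

lemma std_normal_density_at_top: "(\<phi> \<longlongrightarrow> 0) at_top"
proof -
  have "((\<lambda>v::real. (1 / sqrt (2 * pi)) * exp (- v\<^sup>2 / 2)) \<longlongrightarrow> 0) at_top"
    by real_asymp
  then show ?thesis by (simp add: std_normal_density_def[abs_def])
qed

text \<open>On \<open>{v..}\<close> replace the factor \<open>v\<close> by the larger \<open>y\<close>; \<open>y \<phi> y\<close> has the antiderivative \<open>- \<phi> y\<close>.\<close>
lemma std_normal_tail: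
  assumes v: "0 \<le> v"
  shows "v * (\<integral>y. indicator {v..} y * \<phi> y \<partial>lborel) \<le> \<phi> v"
proof -
  have nn: "(\<integral>\<^sup>+y. ennreal (y * \<phi> y) * indicator {v..} y \<partial>lborel) = ennreal (0 - (- \<phi> v))"
    using v
    by (intro nn_integral_FTC_atLeast[where F="\<lambda>y. - \<phi> y"])
       (auto intro!: derivative_eq_intros std_normal_density_deriv tendsto_eq_intros std_normal_density_at_top)
  have i: "integrable lborel (\<lambda>y. indicator {v..} y * \<phi> y)"
    by (rule Bochner_Integration.integrable_bound[OF integrable_normal_density[of 1 0]]) (auto split: split_indicator)
  have "ennreal (v * (\<integral>y. indicator {v..} y * \<phi> y \<partial>lborel)) = ennreal (\<integral>y. v * (indicator {v..} y * \<phi> y) \<partial>lborel)"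
    by simp
  also have "\<dots> = (\<integral>\<^sup>+y. ennreal (v * (indicator {v..} y * \<phi> y)) \<partial>lborel)"
    using i v by (intro nn_integral_eq_integral[symmetric]) auto
  also have "\<dots> \<le> (\<integral>\<^sup>+y. ennreal (y * \<phi> y) * indicator {v..} y \<partial>lborel)"
    using v by (intro nn_integral_mono) (auto split: split_indicator intro!: ennreal_leI mult_right_mono)
  finally show ?thesis by (simp add: nn)
qed

lemma std_normal_tail_left:
  assumes v: "v \<le> 0"
  shows "- v * (\<integral>y. indicator {..v} y * \<phi> y \<partial>lborel) \<le> \<phi> v"
proof -
  have "(\<integral>y. indicator {..v} y * \<phi> y \<partial>lborel) = (\<integral>y. indicator {..v} (0 + (-1) * y) * \<phi> (0 + (-1) * y) \<partial>lborel)"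
    by (subst lborel_integral_real_affine[where c="-1" and t=0]) auto
  also have "\<dots> = (\<integral>y. indicator {-v..} y * \<phi> y \<partial>lborel)"
    by (intro expectation_cong refl) (auto simp: std_normal_density_def split: split_indicator)
  finally show ?thesis using std_normal_tail[of "- v"] v by (simp add: std_normal_density_def)
qed

text \<open>The solution is \<open>g v = J v / \<phi> v\<close> with \<open>J v\<close> the integral of \<open>(h - m) \<phi>\<close> over \<open>{..v}\<close>. As the integral
over the whole line vanishes, \<open>|J v|\<close> is bounded by either tail of \<open>\<phi>\<close>, so \<open>|v g v| \<le> 1\<close> by the tail
estimates, and the equation gives \<open>|g'| \<le> 1 + 1\<close>.\<close>
lemma stein_solution:
  fixes h :: "real \<Rightarrow> real"
  assumes cont: "continuous_on UNIV h" and h: "\<And>v. 0 \<le> h v" "\<And>v. h v \<le> 1"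
  defines "m \<equiv> (\<integral>y. \<phi> y * h y \<partial>lborel)"
  obtains g g' where "\<And>v. (g has_real_derivative g' v) (at v)"
    "\<And>v. g' v = v * g v + h v - m" "\<And>v. \<bar>g' v\<bar> \<le> 2"
proof -
  have [measurable]: "h \<in> borel_measurable borel"
    by (rule borel_measurable_continuous_onI[OF cont])
  have contphi: "continuous_on UNIV \<phi>"
    by (intro continuous_at_imp_continuous_on ballI DERIV_isCont[OF std_normal_density_deriv])
  have ih: "integrable lborel (\<lambda>y. \<phi> y * h y)"
    using h by (intro Bochner_Integration.integrable_bound[OF integrable_normal_density[of 1 0]])
       (auto simp: abs_mult mult_left_le)
  have m: "0 \<le> m" "m \<le> 1"
  proof -
    show "0 \<le> m" unfolding m_def using h by (intro expectation_nonneg) auto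
    have "m \<le> (\<integral>y. \<phi> y \<partial>lborel)" unfolding m_def
      using h by (intro expectation_mono ih) (auto simp: mult_left_le)
    then show "m \<le> 1" by simp
  qed
  have hm: "\<bar>h v - m\<bar> \<le> 1" for v using h[of v] m by simp
  define k where "k y = (h y - m) * \<phi> y" for y
  have [measurable]: "k \<in> borel_measurable borel" unfolding k_def[abs_def] by measurable
  have k_le: "\<bar>k y\<bar> \<le> \<phi> y" for y
    unfolding k_def abs_mult using mult_right_mono[OF hm, of "\<phi> y" y] by simp
  have ik: "integrable lborel k"
    using k_le by (intro Bochner_Integration.integrable_bound[OF integrable_normal_density[of 1 0]]) auto
  have k0: "(\<integral>y. k y \<partial>lborel) = 0"
  proof -
    have "(\<integral>y. k y \<partial>lborel) = (\<integral>y. \<phi> y * h y - m * \<phi> y \<partial>lborel)" by (simp add: k_def algebra_simps)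
    also have "\<dots> = m - m * 1" using ih by (simp add: m_def)
    finally show ?thesis by simp
  qed
  have contk: "continuous_on A k" for A
    unfolding k_def[abs_def] by (intro continuous_intros continuous_on_subset[OF cont] continuous_on_subset[OF contphi]) auto
  have iA: "integrable lborel (\<lambda>y. indicator A y * k y)" "integrable lborel (\<lambda>y. indicator A y * \<phi> y)"
    if "A \<in> sets borel" for A :: "real set"
    using that integrable_real_mult_indicator[OF _ ik, of A] integrable_real_mult_indicator[OF _ integrable_normal_density[of 1 0], of A]
    by (auto simp: mult.commute)
  have kA: "\<bar>\<integral>y. indicator A y * k y \<partial>lborel\<bar> \<le> (\<integral>y. indicator A y * \<phi> y \<partial>lborel)" if A: "A \<in> sets borel" for A :: "real set"
  proof -
    have "norm (\<integral>y. indicator A y * k y \<partial>lborel) \<le> (\<integral>y. indicator A y * \<phi> y \<partial>lborel)"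
      using iA[OF A] k_le by (intro expectation_norm_bound) (auto split: split_indicator)
    then show ?thesis by simp
  qed
  define J where "J v = (\<integral>y. indicator {..v} y * k y \<partial>lborel)" for v
  have J_right: "\<bar>J v\<bar> \<le> (\<integral>y. indicator {v..} y * \<phi> y \<partial>lborel)" for v
  proof -
    have "(\<integral>y. k y \<partial>lborel) = (\<integral>y. indicator {..v} y * k y + indicator {v<..} y * k y \<partial>lborel)"
      by (intro expectation_cong refl) (auto split: split_indicator)
    also have "\<dots> = J v + (\<integral>y. indicator {v<..} y * k y \<partial>lborel)"
      unfolding J_def by (intro expectation_add iA) auto
    finally have "\<bar>J v\<bar> = \<bar>\<integral>y. indicator {v<..} y * k y \<partial>lborel\<bar>" using k0 by simp
    also have "\<dots> \<le> (\<integral>y. indicator {v<..} y * \<phi> y \<partial>lborel)" by (rule kA) simp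
    also have "\<dots> \<le> (\<integral>y. indicator {v..} y * \<phi> y \<partial>lborel)"
      by (intro expectation_mono iA) (auto split: split_indicator)
    finally show ?thesis .
  qed
  have J_left: "\<bar>J v\<bar> \<le> (\<integral>y. indicator {..v} y * \<phi> y \<partial>lborel)" for v
    unfolding J_def by (rule kA) simp
  have vJ: "\<bar>v * J v\<bar> \<le> \<phi> v" for v
  proof (cases "0 \<le> v")
    case True
    then have "\<bar>v * J v\<bar> \<le> v * (\<integral>y. indicator {v..} y * \<phi> y \<partial>lborel)"
      unfolding abs_mult using J_right[of v] by (simp add: mult_left_mono)
    then show ?thesis using std_normal_tail[OF True] by linarith
  next
    case False
    then have "\<bar>v * J v\<bar> \<le> - v * (\<integral>y. indicator {..v} y * \<phi> y \<partial>lborel)"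
      unfolding abs_mult using mult_left_mono[OF J_left[of v], of "- v"] by simp
    then show ?thesis using std_normal_tail_left[of v] False by linarith
  qed
  have J_deriv: "(J has_real_derivative k v) (at v)" for v
  proof -
    have eq: "J x = J (v - 1) + integral {v - 1..x} k" if x: "v - 1 \<le> x" for x
    proof -
      have "J x = (\<integral>y. indicator {..v-1} y * k y + indicator {v-1<..x} y * k y \<partial>lborel)"
        unfolding J_def using x by (intro expectation_cong refl) (auto split: split_indicator)
      also have "\<dots> = J (v - 1) + (\<integral>y. indicator {v-1<..x} y * k y \<partial>lborel)"
        unfolding J_def by (intro expectation_add iA) auto
      also have "(\<integral>y. indicator {v-1<..x} y * k y \<partial>lborel) = (\<integral>y. indicator {v-1..x} y * k y \<partial>lborel)"
      proof (rule integral_cong_AE)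
        have "AE y in lborel. y \<noteq> v - 1" by (rule AE_lborel_singleton)
        then show "AE y in lborel. indicator {v-1<..x} y * k y = indicator {v-1..x} y * k y"
          by eventually_elim (auto split: split_indicator)
      qed auto
      also have "\<dots> = integral {v-1..x} k"
      proof -
        have "set_integrable lborel {v-1..x} k"
          using iA(1)[of "{v-1..x}"] by (simp add: set_integrable_def)
        from set_borel_integral_eq_integral(2)[OF this] show ?thesis
          by (simp add: set_lebesgue_integral_def)
      qed
      finally show ?thesis .
    qed
    have "((\<lambda>x. integral {v - 1..x} k) has_real_derivative k v) (at v within {v - 1..v + 1})"
      by (rule integral_has_real_derivative[OF contk]) auto
    then have "((\<lambda>x. J (v - 1) + integral {v - 1..x} k) has_real_derivative k v) (at v within {v - 1..v + 1})"
      by (auto intro!: derivative_eq_intros)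
    then have "((\<lambda>x. J (v - 1) + integral {v - 1..x} k) has_real_derivative k v) (at v)"
      by (subst (asm) at_within_interior) (auto simp: interior_atLeastAtMost_real)
    moreover have "eventually (\<lambda>x. J (v - 1) + integral {v - 1..x} k = J x) (nhds v)"
      by (rule eventually_mono[OF eventually_nhds_in_open[of "{v - 1<..}" v]]) (auto intro!: eq[symmetric])
    ultimately show ?thesis by (simp add: DERIV_cong_ev[OF refl _ refl])
  qed
  define e where "e v = sqrt (2 * pi) * exp (v\<^sup>2 / 2)" for v :: real
  have e: "\<phi> v * e v = 1" for v
    by (simp add: e_def std_normal_density_def flip: exp_add)
  have e_deriv: "(e has_real_derivative v * e v) (at v)" for v
    unfolding e_def[abs_def] by (auto intro!: derivative_eq_intros)
  define g where "g v = J v * e v" for v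
  define g' where "g' v = v * g v + h v - m" for v
  show ?thesis
  proof (rule that[of g g'])
    fix v
    have "(g has_real_derivative k v * e v + (v * e v) * J v) (at v)"
      unfolding g_def[abs_def] by (rule DERIV_mult[OF J_deriv e_deriv, THEN DERIV_cong]) simp
    moreover have "k v * e v = h v - m" using e[of v] by (simp add: k_def)
    ultimately show "(g has_real_derivative g' v) (at v)"
      by (elim DERIV_cong) (simp add: g'_def g_def)
    show "g' v = v * g v + h v - m" by (rule g'_def)
    have "\<bar>v * g v\<bar> = \<bar>v * J v\<bar> * e v" by (simp add: g_def abs_mult e_def)
    also have "\<dots> \<le> \<phi> v * e v" using vJ[of v] by (intro mult_right_mono) (auto simp: e_def)
    finally have "\<bar>v * g v\<bar> \<le> 1" using e by simp
    then show "\<bar>g' v\<bar> \<le> 2" using hm[of v] by (simp add: g'_def)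
  qed
qed

section \<open>Total variation through Lipschitz test functions\<close>

lemma lipschitz_imp_borel:
  fixes h :: "real \<Rightarrow> real"
  assumes lip: "\<And>v w. \<bar>h v - h w\<bar> \<le> L * \<bar>v - w\<bar>"
  shows "continuous_on UNIV h" "h \<in> borel_measurable borel"
proof -
  have "0 \<le> L" using lip[of 0 1] by simp
  then show "continuous_on UNIV h"
    by (intro lipschitz_on_continuous_on[OF lipschitz_onI[of _ _ L]])
       (use lip in \<open>auto simp: dist_real_def\<close>)
  then show "h \<in> borel_measurable borel" by (rule borel_measurable_continuous_onI)
qed

text \<open>The functions \<open>max 0 (1 - n dist v K)\<close> decrease to the indicator of a closed set \<open>K\<close>, which gives the
bound for closed sets. A Borel set is approximated from inside by compact sets, for \<open>\<mu>\<close> to bound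
\<open>\<mu> A - \<nu> A\<close> and for \<open>\<nu>\<close> to bound \<open>\<nu> A - \<mu> A\<close>.\<close>
lemma lipschitz_test_imp_tv:
  fixes \<mu> \<nu> :: "real measure"
  assumes p: "prob_space \<mu>" "prob_space \<nu>" and s [simp, measurable_cong]: "sets \<mu> = sets borel" "sets \<nu> = sets borel"
    and test: "\<And>h L. (\<And>v w. \<bar>h v - h w\<bar> \<le> L * \<bar>v - w\<bar>) \<Longrightarrow> (\<And>v. 0 \<le> h v) \<Longrightarrow> (\<And>v. h v \<le> 1) \<Longrightarrow>
        \<bar>(\<integral>v. h v \<partial>\<mu>) - (\<integral>v. h v \<partial>\<nu>)\<bar> \<le> B"
    and A: "A \<in> sets borel"
  shows "\<bar>measure \<mu> A - measure \<nu> A\<bar> \<le> B"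
proof -
  interpret \<mu>: prob_space \<mu> by fact
  interpret \<nu>: prob_space \<nu> by fact
  have cl: "\<bar>measure \<mu> K - measure \<nu> K\<bar> \<le> B" if K: "closed K" for K
  proof (cases "K = {}")
    case True
    have "\<bar>(\<integral>v. 0 \<partial>\<mu>) - (\<integral>v. 0 \<partial>\<nu>)\<bar> \<le> B"
      by (rule test[where L=0]) simp_all
    with True show ?thesis by simp
  next
    case False
    define h where "h n v = max 0 (1 - real n * infdist v K)" for n v
    have lip: "\<bar>h n v - h n w\<bar> \<le> real n * \<bar>v - w\<bar>" for n v w
    proof -
      have "\<bar>h n v - h n w\<bar> \<le> real n * \<bar>infdist v K - infdist w K\<bar>"
      proof -
        have m: "\<bar>max 0 a - max 0 b\<bar> \<le> \<bar>a - b\<bar>" for a b :: real by (auto simp: max_def abs_if)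
        have "\<bar>(1 - real n * a) - (1 - real n * b)\<bar> = real n * \<bar>a - b\<bar>" for a b
          using abs_mult[of "real n" "b - a"] by (simp add: right_diff_distrib abs_minus_commute)
        then show ?thesis unfolding h_def using m[of "1 - real n * infdist v K" "1 - real n * infdist w K"] by simp
      qed
      also have "\<dots> \<le> real n * \<bar>v - w\<bar>"
        using infdist_triangle_abs[of v K w] by (intro mult_left_mono) (auto simp: dist_real_def)
      finally show ?thesis .
    qed
    have h01: "0 \<le> h n v" "h n v \<le> 1" for n v
      by (auto simp: h_def infdist_nonneg)
    have [measurable]: "K \<in> sets borel" using K by simp
    have [measurable]: "h n \<in> borel_measurable borel" for n
      unfolding h_def[abs_def] by (intro borel_measurable_continuous_onI continuous_intros)
    have lim: "(\<lambda>n. h n v) \<longlonglongrightarrow> indicator K v" for v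
    proof (cases "v \<in> K")
      case True
      then show ?thesis by (simp add: h_def)
    next
      case vK: False
      then have pos: "0 < infdist v K"
        using in_closed_iff_infdist_zero[OF K False, of v] infdist_nonneg[of v K] by linarith
      have "eventually (\<lambda>n. 1 / infdist v K \<le> real n) sequentially"
        using filterlim_real_sequentially by (auto simp: filterlim_at_top)
      then have "eventually (\<lambda>n. 0 = h n v) sequentially"
        by eventually_elim (use pos in \<open>auto simp: h_def divide_simps mult.commute\<close>)
      then show ?thesis using vK by (auto intro!: tendsto_eventually elim: eventually_mono)
    qed
    have l: "(\<lambda>n. \<integral>v. h n v \<partial>M) \<longlonglongrightarrow> measure M K" if M: "prob_space M" and [simp, measurable_cong]: "sets M = sets borel" for M
    proof -
      interpret M: prob_space M by fact
      have "(\<lambda>n. \<integral>v. h n v \<partial>M) \<longlonglongrightarrow> (\<integral>v. indicator K v \<partial>M)"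
        using h01 lim by (intro integral_dominated_convergence[where w="\<lambda>_. 1"]) (auto intro!: AE_I2)
      then show ?thesis by simp
    qed
    show ?thesis
      using test[OF lip h01] by (intro LIMSEQ_le_const2[OF tendsto_rabs[OF tendsto_diff[OF l[OF p(1) s(1)] l[OF p(2) s(2)]]]]) auto
  qed
  have one: "measure M A - measure N A \<le> B"
    if M: "prob_space M" "sets M = sets borel" and N: "prob_space N" "sets N = sets borel"
      and c: "\<And>K. closed K \<Longrightarrow> \<bar>measure M K - measure N K\<bar> \<le> B" for M N :: "real measure"
  proof (rule field_le_epsilon)
    fix e :: real assume e: "0 < e"
    interpret M: prob_space M by fact
    interpret N: prob_space N by fact
    have "emeasure M A = (SUP K \<in> {K. K \<subseteq> A \<and> compact K}. emeasure M K)"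
      using A M by (intro inner_regular) auto
    moreover have "emeasure M A - ennreal e < emeasure M A \<or> emeasure M A = 0"
      using e M.emeasure_eq_measure[of A]
      by (cases "measure M A = 0") (auto simp: ennreal_minus_if ennreal_less_iff zero_less_measure_iff)
    ultimately obtain K where K: "K \<subseteq> A" "compact K" "measure M A \<le> measure M K + e"
    proof (elim disjE, goal_cases)
      case 1
      then obtain K where K: "K \<subseteq> A" "compact K" "emeasure M A - ennreal e < emeasure M K"
        by (auto simp: less_SUP_iff)
      then have "measure M A - e \<le> measure M K"
        using e unfolding M.emeasure_eq_measure
        by (auto simp: ennreal_minus_if ennreal_less_iff split: if_splits)
      then show ?case using K 1(1)[of K] by simp
    next
      case 2
      then show ?case using e by (intro 2(1)[of "{}"]) (auto simp: M.emeasure_eq_measure)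
    qed
    have "measure N K \<le> measure N A"
      using K A N by (intro N.finite_measure_mono) auto
    moreover have "\<bar>measure M K - measure N K\<bar> \<le> B" using K by (intro c compact_imp_closed)
    ultimately show "measure M A - measure N A \<le> B + e" using K(3) by linarith
  qed
  have "measure \<mu> A - measure \<nu> A \<le> B" by (rule one[OF p(1) s(1) p(2) s(2) cl])
  moreover have "measure \<nu> A - measure \<mu> A \<le> B"
    using cl by (intro one[OF p(2) s(2) p(1) s(1)]) (simp add: abs_minus_commute)
  ultimately show ?thesis by linarith
qed

section \<open>Chi-squared moments and intrinsic volumes\<close>

lemma prob_space_std_normal: "prob_space (std_normal_distribution)"
  by (rule prob_space_normal_density) simp

lemma std_normal_even_moment:
  "integrable (std_normal_distribution) (\<lambda>x. x ^ (2 * k))"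
  "(\<integral>x. x ^ (2 * k) \<partial>std_normal_distribution) = fact (2 * k) / (2 ^ k * fact k)"
proof -
  show "integrable (std_normal_distribution) (\<lambda>x. x ^ (2 * k))"
    by (subst integrable_density) (auto intro: integrable_std_normal_moment)
  show "(\<integral>x. x ^ (2 * k) \<partial>std_normal_distribution) = fact (2 * k) / (2 ^ k * fact k)"
    by (subst integral_density) (auto simp: integral_std_normal_moment_even)
qed

context
  fixes k :: nat
begin

abbreviation (input) "gauss_pi \<equiv> (Pi\<^sub>M {..<k} (\<lambda>_. std_normal_distribution))"

lemma prob_space_gauss_pi: "prob_space gauss_pi"
  by (rule prob_space_PiM) (rule prob_space_std_normal)

text \<open>The monomials with even exponents \<open>2 * n i\<close> cover both moments of the sum of squares needed below.\<close>
lemma gauss_pi_prod: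
  fixes n :: "nat \<Rightarrow> nat"
  shows "integrable gauss_pi (\<lambda>x. \<Prod>i<k. (x i) ^ (2 * n i))"
    "(\<integral>x. (\<Prod>i<k. (x i) ^ (2 * n i)) \<partial>gauss_pi) = (\<Prod>i<k. fact (2 * n i) / (2 ^ n i * fact (n i)))"
proof -
  interpret product_sigma_finite "\<lambda>_::nat. density lborel std_normal_density"
    by (intro product_sigma_finite.intro prob_space_imp_sigma_finite prob_space_std_normal)
  show "integrable gauss_pi (\<lambda>x. \<Prod>i<k. (x i) ^ (2 * n i))"
    by (rule product_integrable_prod) (auto simp: std_normal_even_moment)
  show "(\<integral>x. (\<Prod>i<k. (x i) ^ (2 * n i)) \<partial>gauss_pi) = (\<Prod>i<k. fact (2 * n i) / (2 ^ n i * fact (n i)))"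
    by (subst product_integral_prod) (auto simp: std_normal_even_moment)
qed

lemma gauss_pi_square:
  assumes i: "i < k"
  shows "integrable gauss_pi (\<lambda>x. (x i)\<^sup>2)" "(\<integral>x. (x i)\<^sup>2 \<partial>gauss_pi) = 1"
proof -
  let ?n = "\<lambda>l. if l = i then 1 else 0 :: nat"
  have eq: "(\<Prod>l<k. (x l) ^ (2 * ?n l)) = (x i)\<^sup>2" for x :: "nat \<Rightarrow> real"
  proof -
    have "(\<Prod>l<k. (x l) ^ (2 * ?n l)) = (\<Prod>l<k. if l = i then (x l)\<^sup>2 else 1)"
      by (intro prod.cong) auto
    then show ?thesis using i by simp
  qed
  have "(\<Prod>l<k. fact (2 * ?n l) / (2 ^ ?n l * fact (?n l))) = (1::real)"
    by (intro prod.neutral) (auto simp: fact_numeral)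
  then show "integrable gauss_pi (\<lambda>x. (x i)\<^sup>2)" "(\<integral>x. (x i)\<^sup>2 \<partial>gauss_pi) = 1"
    using gauss_pi_prod[of ?n] unfolding eq by auto
qed

lemma gauss_pi_square_square:
  assumes i: "i < k" and j: "j < k"
  shows "integrable gauss_pi (\<lambda>x. (x i)\<^sup>2 * (x j)\<^sup>2)" "(\<integral>x. (x i)\<^sup>2 * (x j)\<^sup>2 \<partial>gauss_pi) = (if i = j then 3 else 1)"
proof -
  let ?n = "\<lambda>l. (if l = i then 1 else 0) + (if l = j then 1 else 0) :: nat"
  have eq: "(\<Prod>l<k. (x l) ^ (2 * ?n l)) = (x i)\<^sup>2 * (x j)\<^sup>2" for x :: "nat \<Rightarrow> real"
  proof -
    have "(\<Prod>l<k. (x l) ^ (2 * ?n l)) = (\<Prod>l<k. (if l = i then (x l)\<^sup>2 else 1) * (if l = j then (x l)\<^sup>2 else 1))"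
      by (intro prod.cong) (auto simp: eval_nat_numeral)
    then show ?thesis using i j by (simp add: prod.distrib)
  qed
  have "(\<Prod>l<k. fact (2 * ?n l) / (2 ^ ?n l * fact (?n l))) = (if i = j then 3 else 1 :: real)"
  proof (cases "i = j")
    case True
    have "(\<Prod>l<k. fact (2 * ?n l) / (2 ^ ?n l * fact (?n l))) = (\<Prod>l<k. if l = i then 3 else 1 :: real)"
      using True by (intro prod.cong) (auto simp: fact_numeral)
    then show ?thesis using True i by simp
  next
    case False
    then have "(\<Prod>l<k. fact (2 * ?n l) / (2 ^ ?n l * fact (?n l))) = (1::real)"
      by (intro prod.neutral) (auto simp: fact_numeral)
    then show ?thesis using False by simp
  qed
  then show "integrable gauss_pi (\<lambda>x. (x i)\<^sup>2 * (x j)\<^sup>2)" "(\<integral>x. (x i)\<^sup>2 * (x j)\<^sup>2 \<partial>gauss_pi) = (if i = j then 3 else 1)"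
    using gauss_pi_prod[of ?n] unfolding eq by auto
qed

lemma gauss_pi_sum:
  shows "integrable gauss_pi (\<lambda>x. \<Sum>i<k. (x i)\<^sup>2)" "(\<integral>x. (\<Sum>i<k. (x i)\<^sup>2) \<partial>gauss_pi) = real k"
  using gauss_pi_square by (auto simp: expectation_sum)

lemma gauss_pi_sum_square:
  shows "integrable gauss_pi (\<lambda>x. (\<Sum>i<k. (x i)\<^sup>2)\<^sup>2)" "(\<integral>x. (\<Sum>i<k. (x i)\<^sup>2)\<^sup>2 \<partial>gauss_pi) = (real k)\<^sup>2 + 2 * real k"
proof -
  have eq: "(\<Sum>i<k. (x i)\<^sup>2)\<^sup>2 = (\<Sum>i<k. \<Sum>j<k. (x i)\<^sup>2 * (x j)\<^sup>2)" for x :: "nat \<Rightarrow> real"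
    unfolding power2_eq_square[of "sum _ _"] by (rule sum_product)
  show "integrable gauss_pi (\<lambda>x. (\<Sum>i<k. (x i)\<^sup>2)\<^sup>2)"
    unfolding eq by (intro Bochner_Integration.integrable_sum gauss_pi_square_square) auto
  have "(\<integral>x. (\<Sum>i<k. (x i)\<^sup>2)\<^sup>2 \<partial>gauss_pi) = (\<Sum>i<k. \<integral>x. (\<Sum>j<k. (x i)\<^sup>2 * (x j)\<^sup>2) \<partial>gauss_pi)"
    unfolding eq by (intro expectation_sum Bochner_Integration.integrable_sum gauss_pi_square_square) auto
  also have "\<dots> = (\<Sum>i<k. \<Sum>j<k. if i = j then 3 else 1)"
  proof (intro sum.cong refl)
    fix i assume i: "i \<in> {..<k}"
    have "(\<integral>x. (\<Sum>j<k. (x i)\<^sup>2 * (x j)\<^sup>2) \<partial>gauss_pi) = (\<Sum>j<k. \<integral>x. (x i)\<^sup>2 * (x j)\<^sup>2 \<partial>gauss_pi)"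
      using i by (intro expectation_sum gauss_pi_square_square) auto
    then show "(\<integral>x. (\<Sum>j<k. (x i)\<^sup>2 * (x j)\<^sup>2) \<partial>gauss_pi) = (\<Sum>j<k. if i = j then 3 else 1)"
      using i by (simp add: gauss_pi_square_square)
  qed
  also have "\<dots> = (\<Sum>i<k. \<Sum>j<k. 1 + (if i = j then 2 else 0))"
    by (intro sum.cong) auto
  also have "\<dots> = (real k)\<^sup>2 + 2 * real k"
    by (simp add: sum.distrib power2_eq_square distrib_left)
  finally show "(\<integral>x. (\<Sum>i<k. (x i)\<^sup>2)\<^sup>2 \<partial>gauss_pi) = (real k)\<^sup>2 + 2 * real k" .
qed

lemma integral_chi_squared:
  fixes f :: "real \<Rightarrow> real"
  assumes [measurable]: "f \<in> borel_measurable borel"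
  shows "(\<integral>y. f y \<partial>chi_squared k) = (\<integral>x. f (\<Sum>i<k. (x i)\<^sup>2) \<partial>gauss_pi)"
  unfolding chi_squared_def by (subst integral_distr) auto

lemma prob_space_chi_squared: "prob_space (chi_squared k)"
  unfolding chi_squared_def by (rule prob_space.prob_space_distr[OF prob_space_gauss_pi]) simp

end

lemma sets_chi_squared [simp, measurable_cong]: "sets (chi_squared k) = sets borel"
  by (simp add: chi_squared_def)

lemma tendsto_integral_truncate:
  fixes X :: "'a \<Rightarrow> real"
  assumes i: "integrable M X" and X: "\<And>x. 0 \<le> X x"
  shows "(\<lambda>m. \<integral>x. min (real m) (X x) \<partial>M) \<longlonglongrightarrow> (\<integral>x. X x \<partial>M)"
proof (rule integral_dominated_convergence[where w=X])
  have [measurable]: "X \<in> borel_measurable M" using i by auto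
  show "(\<lambda>x. min (real m) (X x)) \<in> borel_measurable M" "X \<in> borel_measurable M" for m by auto
  show "AE x in M. (\<lambda>m. min (real m) (X x)) \<longlonglongrightarrow> X x"
  proof (rule AE_I2)
    fix x
    have "eventually (\<lambda>m. X x \<le> real m) sequentially"
      using filterlim_real_sequentially by (auto simp: filterlim_at_top)
    then show "(\<lambda>m. min (real m) (X x)) \<longlonglongrightarrow> X x"
      by (intro tendsto_eventually) (auto elim: eventually_mono)
  qed
  show "AE x in M. norm (min (real m) (X x)) \<le> X x" for m using X by (auto intro!: AE_I2 simp: abs_if min_def)
qed (rule i)

text \<open>The defining identity of the intrinsic volumes is available for bounded test functions only, so it
is applied to the truncations of the \<open>k\<close>-th power at \<open>m\<close>, and \<open>m\<close> tends to infinity.\<close>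
lemma intrinsic_volume_moment:
  fixes C :: "'a::euclidean_space set"
  assumes v: "conic_intrinsic_volumes C v" and [measurable]: "closest_point C \<in> borel_measurable borel"
    and i: "integrable gauss (\<lambda>x. ((norm (closest_point C x))\<^sup>2) ^ k)"
    and c: "\<And>j::nat. integrable (Pi\<^sub>M {..<j} (\<lambda>_. std_normal_distribution)) (\<lambda>x. (\<Sum>i<j. (x i)\<^sup>2) ^ k)"
      "\<And>j::nat. (\<integral>x. (\<Sum>i<j. (x i)\<^sup>2) ^ k \<partial>Pi\<^sub>M {..<j} (\<lambda>_. std_normal_distribution)) = \<mu> j"
  shows "(\<integral>x. ((norm (closest_point C x))\<^sup>2) ^ k \<partial>gauss) = (\<Sum>j\<le>DIM('a). v j * \<mu> j)"
proof (rule LIMSEQ_unique)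
  show "(\<lambda>m. \<integral>x. min (real m) (((norm (closest_point C x))\<^sup>2) ^ k) \<partial>gauss)
     \<longlonglongrightarrow> (\<integral>x. ((norm (closest_point C x))\<^sup>2) ^ k \<partial>gauss)"
    by (rule tendsto_integral_truncate[OF i]) simp
  have "(\<integral>x. min (real m) (((norm (closest_point C x))\<^sup>2) ^ k) \<partial>gauss)
    = (\<Sum>j\<le>DIM('a). v j * (\<integral>x. min (real m) ((\<Sum>i<j. (x i)\<^sup>2) ^ k) \<partial>Pi\<^sub>M {..<j} (\<lambda>_. std_normal_distribution)))" for m
  proof -
    \<comment> \<open>The test function is defined on the whole plane; \<open>max 0\<close> makes it bounded there and changes nothing on squared norms.\<close>
    let ?h = "\<lambda>y::real. min (real m) ((max 0 y) ^ k)"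
    let ?f = "\<lambda>p :: real \<times> real. ?h (fst p)"
    have b: "bounded (range ?f)"
      by (intro boundedI[of _ "real m"]) (auto simp: abs_if min_def)
    have m: "?f \<in> borel_measurable borel" by measurable
    have "(\<integral>x. min (real m) (((norm (closest_point C x))\<^sup>2) ^ k) \<partial>gauss)
      = (\<integral>x. ?f ((norm (closest_point C x))\<^sup>2, (norm (closest_point (polar_cone C) x))\<^sup>2) \<partial>density lborel std_gaussian_density)"
      by (simp add: gauss_def max_absorb2)
    also have "\<dots> = (\<Sum>j\<le>DIM('a). v j * (\<integral>p. ?f p \<partial>(chi_squared j \<Otimes>\<^sub>M chi_squared (DIM('a) - j))))"
      using v m b unfolding conic_intrinsic_volumes_def by blast
    also have "\<dots> = (\<Sum>j\<le>DIM('a). v j * (\<integral>x. min (real m) ((\<Sum>i<j. (x i)\<^sup>2) ^ k) \<partial>Pi\<^sub>M {..<j} (\<lambda>_. std_normal_distribution)))"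
    proof (intro sum.cong refl arg_cong2[where f="(*)"])
      fix j
      interpret A: prob_space "chi_squared j" by (rule prob_space_chi_squared)
      interpret B: prob_space "chi_squared (DIM('a) - j)" by (rule prob_space_chi_squared)
      interpret AB: pair_prob_space "chi_squared j" "chi_squared (DIM('a) - j)" ..
      have "(\<integral>p. ?f p \<partial>(chi_squared j \<Otimes>\<^sub>M chi_squared (DIM('a) - j))) = (\<integral>y. ?h y \<partial>chi_squared j)"
      proof -
        have "integrable (chi_squared j \<Otimes>\<^sub>M chi_squared (DIM('a) - j)) ?f"
          by (rule AB.integrable_const_bound[of _ "real m"]) (auto simp: abs_if min_def)
        from AB.integral_fst'[OF this] show ?thesis by (simp add: B.prob_space)
      qed
      also have "\<dots> = (\<integral>x. ?h (\<Sum>i<j. (x i)\<^sup>2) \<partial>Pi\<^sub>M {..<j} (\<lambda>_. std_normal_distribution))"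
        by (rule integral_chi_squared) measurable
      finally show "(\<integral>p. ?f p \<partial>(chi_squared j \<Otimes>\<^sub>M chi_squared (DIM('a) - j)))
        = (\<integral>x. min (real m) ((\<Sum>i<j. (x i)\<^sup>2) ^ k) \<partial>Pi\<^sub>M {..<j} (\<lambda>_. std_normal_distribution))"
        by (simp add: max_absorb2 sum_nonneg)
    qed
    finally show ?thesis .
  qed
  moreover have "(\<lambda>m. \<Sum>j\<le>DIM('a). v j * (\<integral>x. min (real m) ((\<Sum>i<j. (x i)\<^sup>2) ^ k) \<partial>Pi\<^sub>M {..<j} (\<lambda>_. std_normal_distribution)))
      \<longlonglongrightarrow> (\<Sum>j\<le>DIM('a). v j * \<mu> j)"
    unfolding c(2)[symmetric]
    by (intro tendsto_sum tendsto_mult tendsto_const tendsto_integral_truncate c(1)) (simp add: sum_nonneg)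
  ultimately show "(\<lambda>m. \<integral>x. min (real m) (((norm (closest_point C x))\<^sup>2) ^ k) \<partial>gauss)
     \<longlonglongrightarrow> (\<Sum>j\<le>DIM('a). v j * \<mu> j)" by simp
qed

lemma intrinsic_volume_expectation:
  fixes C :: "'a::euclidean_space set" and f :: "nat \<Rightarrow> real"
  assumes Q: "prob_space Q" and V [measurable]: "V \<in> measurable Q (count_space UNIV)"
    and v: "(\<Sum>j\<le>d. v j) = 1" and PV: "\<And>j. j \<le> d \<Longrightarrow> measure Q {\<omega> \<in> space Q. V \<omega> = j} = v j"
  shows "(\<integral>\<omega>. f (V \<omega>) \<partial>Q) = (\<Sum>j\<le>d. v j * f j)"
proof -
  interpret Q: prob_space Q by fact
  let ?E = "\<lambda>j. {\<omega> \<in> space Q. V \<omega> = j}"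
  have E [measurable]: "?E j \<in> sets Q" for j by measurable
  have "measure Q (\<Union>j\<in>{..d}. ?E j) = (\<Sum>j\<le>d. measure Q (?E j))"
    by (intro Q.finite_measure_finite_Union) (auto simp: disjoint_family_on_def)
  also have "\<dots> = 1" using PV v by simp
  finally have "AE \<omega> in Q. \<omega> \<in> (\<Union>j\<in>{..d}. ?E j)"
    by (intro Q.AE_prob_1)
  then have "AE \<omega> in Q. f (V \<omega>) = (\<Sum>j\<le>d. f j * indicator (?E j) \<omega>)"
  proof eventually_elim
    case (elim \<omega>)
    then have "V \<omega> \<le> d" "\<omega> \<in> space Q" by auto
    then have "(\<Sum>j\<le>d. f j * indicator (?E j) \<omega>) = (\<Sum>j\<le>d. if j = V \<omega> then f j else 0)"
      by (intro sum.cong) (auto simp: indicator_def)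
    then show ?case using \<open>V \<omega> \<le> d\<close> by simp
  qed
  then have "(\<integral>\<omega>. f (V \<omega>) \<partial>Q) = (\<integral>\<omega>. (\<Sum>j\<le>d. f j * indicator (?E j) \<omega>) \<partial>Q)"
    by (intro integral_cong_AE) measurable
  also have "\<dots> = (\<Sum>j\<le>d. f j * measure Q (?E j))"
    by (subst expectation_sum) (auto simp: Q.emeasure_eq_measure)
  also have "\<dots> = (\<Sum>j\<le>d. v j * f j)"
    using PV by (intro sum.cong) auto
  finally show ?thesis .
qed

context closed_cone begin

text \<open>The intrinsic volumes mix chi-squared laws: \<open>\<delta> = E V\<close> and \<open>E (sqproj\<^sup>2) = E (V\<^sup>2 + 2 V)\<close>.\<close>
lemma variance_intrinsic_volumes:
  assumes V: "intrinsic_volume_variable C Q V"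
  shows "prob_space.variance Q (\<lambda>\<omega>. real (V \<omega>)) = var - 2 * \<delta>"
proof -
  obtain v where Q: "prob_space Q" "V \<in> measurable Q (count_space UNIV)"
    and v: "conic_intrinsic_volumes C v" and PV: "\<And>j. j \<le> DIM('a) \<Longrightarrow> measure Q {\<omega> \<in> space Q. V \<omega> = j} = v j"
    using V unfolding intrinsic_volume_variable_def by blast
  have v1: "(\<Sum>j\<le>DIM('a). v j) = 1" using v by (simp add: conic_intrinsic_volumes_def)
  note E = intrinsic_volume_expectation[OF Q v1 PV]
  have 1: "\<delta> = (\<Sum>j\<le>DIM('a). v j * real j)"
    using intrinsic_volume_moment[OF v borel_measurable_proj, of 1 real] integrable_sqproj[unfolded sqproj_def[abs_def]] gauss_pi_sum
    by (simp add: \<delta>_def sqproj_def)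
  have 2: "(\<integral>x. (sqproj x)\<^sup>2 \<partial>gauss) = (\<Sum>j\<le>DIM('a). v j * ((real j)\<^sup>2 + 2 * real j))"
    using intrinsic_volume_moment[OF v borel_measurable_proj, of 2 "\<lambda>j. (real j)\<^sup>2 + 2 * real j"] integrable_sqproj[unfolded sqproj_def[abs_def]] gauss_pi_sum_square
    by (simp add: sqproj_def)
  have "prob_space.variance Q (\<lambda>\<omega>. real (V \<omega>)) = (\<Sum>j\<le>DIM('a). v j * (real j - \<delta>)\<^sup>2)"
    using E[of real] E[of "\<lambda>j. (real j - \<delta>)\<^sup>2"] by (simp add: 1)
  also have "\<dots> = (\<Sum>j\<le>DIM('a). v j * ((real j)\<^sup>2 + 2 * real j) - 2 * (v j * real j) - 2 * \<delta> * (v j * real j) + \<delta>\<^sup>2 * v j)"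
    by (intro sum.cong refl) (simp add: power2_eq_square algebra_simps)
  also have "\<dots> = (\<Sum>j\<le>DIM('a). v j * ((real j)\<^sup>2 + 2 * real j)) - 2 * (\<Sum>j\<le>DIM('a). v j * real j)
      - 2 * \<delta> * (\<Sum>j\<le>DIM('a). v j * real j) + \<delta>\<^sup>2 * (\<Sum>j\<le>DIM('a). v j)"
    by (simp only: sum.distrib sum_subtractf sum_distrib_left)
  also have "\<dots> = var - 2 * \<delta>"
    unfolding 2[symmetric] 1[symmetric] v1 var_def by (simp add: power2_eq_square)
  finally show ?thesis .
qed

end

section \<open>The normal approximation\<close>

text \<open>Any exponentially bounded function of base point and displacement may serve as the error constant.\<close>
lemma tameI:
  fixes F :: "'a::euclidean_space \<Rightarrow> real"
  assumes m: "F \<in> borel_measurable borel" "DF \<in> borel_measurable borel"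
    and D: "exp_bounded DF" and B: "exp_bounded B"
    and rem: "\<And>x z. \<bar>F (x + z) - F x - DF x \<bullet> z\<bar> \<le> (B (x, z) :: real) * (norm z)\<^sup>2"
  obtains K l where "tame K l F DF"
proof -
  obtain K l where K: "0 \<le> K" "0 \<le> l" "\<And>x. norm (DF x) \<le> K * exp (l * norm x)"
    using D by (rule exp_boundedE) blast
  obtain K' l' where K': "0 \<le> K'" "0 \<le> l'" "\<And>p. norm (B p) \<le> K' * exp (l' * norm p)"
    using B by (rule exp_boundedE) blast
  have "tame (K + K') (l + l') F DF"
    unfolding tame_def
  proof (intro conjI allI)
    fix x z :: 'a
    show "norm (DF x) \<le> (K + K') * exp ((l + l') * norm x)"
      using K K' by (intro order_trans[OF K(3) mult_mono]) (auto intro: mult_right_mono)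
    have "B (x, z) \<le> K' * exp (l' * norm (x, z))" using K'(3)[of "(x, z)"] by simp
    also have "\<dots> \<le> (K + K') * exp ((l + l') * (norm x + norm z))"
      using K K' norm_Pair_le[of x z] by (intro mult_mono) (auto intro!: mult_mono)
    finally show "\<bar>F (x + z) - F x - DF x \<bullet> z\<bar> \<le> (K + K') * exp ((l + l') * (norm x + norm z)) * (norm z)\<^sup>2"
      by (intro order_trans[OF rem mult_right_mono]) auto
  qed (use K K' m in auto)
  then show ?thesis by (rule that)
qed

text \<open>The chain rule. Writing \<open>w - v\<close> for the increment of \<open>F\<close>, which is of first order in \<open>z\<close>, the error
is \<open>(g' \<xi> - g' v) (w - v)\<close> for an intermediate point \<open>\<xi>\<close>, plus \<open>g' v\<close> times the error of \<open>F\<close>. The local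
Lipschitz bound on \<open>g'\<close> is the one that solutions of Stein's equation satisfy.\<close>
lemma tame_compose:
  fixes F :: "'a::euclidean_space \<Rightarrow> real" and g g' :: "real \<Rightarrow> real"
  assumes F: "tame K l F DF" and g: "\<And>v. (g has_real_derivative g' v) (at v)"
    and [measurable]: "g' \<in> borel_measurable borel"
    and g'2: "\<And>v. \<bar>g' v\<bar> \<le> b"
    and lip: "\<And>v w. \<bar>g' v - g' w\<bar> \<le> L * (1 + \<bar>v\<bar> + \<bar>w\<bar>) * \<bar>v - w\<bar>" and L: "0 \<le> L"
  obtains K' l' where "tame K' l' (\<lambda>x. g (F x)) (\<lambda>x. g' (F x) *\<^sub>R DF x)"
proof -
  note D = tameD[OF F]
  note [measurable] = D(3,4)
  have "continuous_on UNIV g"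
    by (intro continuous_at_imp_continuous_on ballI DERIV_isCont[OF g])
  then have [measurable]: "g \<in> borel_measurable borel" by (rule borel_measurable_continuous_onI)
  have b: "0 \<le> b" using g'2[of 0] by linarith
  note eF = tame_exp_bounded[OF F] and eG = tame_exp_bounded_grad[OF F]
  define E where "E p = exp (l * (norm (fst p) + norm (snd p)))" for p :: "'a \<times> 'a"
  \<comment> \<open>\<open>W\<close> is a local Lipschitz constant of \<open>F\<close>; the factor \<open>exp |z|\<close> dominates \<open>1 + |z|\<close>.\<close>
  define W where "W p = K * E p * exp (norm (snd p))" for p :: "'a \<times> 'a"
  have eE: "exp_bounded E" unfolding E_def[abs_def] by (rule exp_bounded_exp_sum[OF D(2)])
  have ee: "exp_bounded (\<lambda>p :: 'a \<times> 'a. exp (norm (snd p)))"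
    using exp_bounded_snd[OF exp_bounded_exp_norm[of 1]] by simp
  have eW: "exp_bounded W" unfolding W_def[abs_def] by (intro exp_bounded_intros eE ee)
  have W0: "0 \<le> W p" for p using D by (simp add: W_def E_def)
  define B where "B p = L * (1 + 2 * \<bar>F (fst p)\<bar> + W p * exp (norm (snd p))) * (W p)\<^sup>2 + b * (K * E p)" for p
  have eB: "exp_bounded B" unfolding B_def[abs_def]
    by (intro exp_bounded_intros eW eE ee exp_bounded_fst[OF eF])
  have eD: "exp_bounded (\<lambda>x. g' (F x) *\<^sub>R DF x)"
  proof (rule exp_bounded_mono[of "\<lambda>x. b *\<^sub>R DF x"])
    show "exp_bounded (\<lambda>x. b *\<^sub>R DF x)" by (intro exp_bounded_intros eG)
    show "norm (g' (F x) *\<^sub>R DF x) \<le> norm (b *\<^sub>R DF x)" for x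
      using g'2[of "F x"] b by (simp add: mult_right_mono)
  qed
  have rem: "\<bar>g (F (x + z)) - g (F x) - (g' (F x) *\<^sub>R DF x) \<bullet> z\<bar> \<le> B (x, z) * (norm z)\<^sup>2" for x z
  proof -
    define v where "v = F x"
    define w where "w = F (x + z)"
    have R: "\<bar>w - v - DF x \<bullet> z\<bar> \<le> K * E (x, z) * (norm z)\<^sup>2"
      using D(6)[of x z] by (simp add: v_def w_def E_def)
    have wv: "\<bar>w - v\<bar> \<le> W (x, z) * norm z"
    proof -
      have 1: "\<bar>DF x \<bullet> z\<bar> \<le> K * E (x, z) * norm z"
      proof -
        have "norm (DF x) \<le> K * E (x, z)"
          using D(1,2) by (intro order_trans[OF D(5)] mult_left_mono) (auto simp: E_def mult_left_mono)
        then show ?thesis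
          by (intro order_trans[OF Cauchy_Schwarz_ineq2] mult_right_mono) auto
      qed
      have "\<bar>w - v\<bar> \<le> K * E (x, z) * norm z + K * E (x, z) * (norm z)\<^sup>2" using R 1 by linarith
      also have "\<dots> = K * E (x, z) * (1 + norm z) * norm z" by (simp add: algebra_simps power2_eq_square)
      also have "\<dots> \<le> K * E (x, z) * exp (norm z) * norm z"
        using D(1) by (intro mult_right_mono mult_left_mono exp_ge_add_one_self) (auto simp: E_def)
      finally show ?thesis by (simp add: W_def)
    qed
    obtain \<xi> where \<xi>: "\<bar>\<xi> - v\<bar> \<le> \<bar>w - v\<bar>" "g w - g v = (w - v) * g' \<xi>"
    proof (cases v w rule: linorder_cases)
      case less
      from MVT2[OF less, of g g'] g obtain t where "v < t" "t < w" "g w - g v = (w - v) * g' t" by auto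
      then show ?thesis by (intro that[of t]) auto
    next
      case equal
      then show ?thesis by (intro that[of v]) auto
    next
      case greater
      from MVT2[OF greater, of g g'] g obtain t where "w < t" "t < v" "g v - g w = (v - w) * g' t" by auto
      then show ?thesis by (intro that[of t]) (auto simp: algebra_simps)
    qed
    have "\<bar>g' \<xi> - g' v\<bar> \<le> L * (1 + 2 * \<bar>v\<bar> + W (x, z) * exp (norm z)) * \<bar>w - v\<bar>"
    proof -
      have "W (x, z) * norm z \<le> W (x, z) * exp (norm z)"
        using W0 by (intro mult_left_mono le_exp)
      then have "1 + \<bar>\<xi>\<bar> + \<bar>v\<bar> \<le> 1 + 2 * \<bar>v\<bar> + W (x, z) * exp (norm z)" using \<xi>(1) wv by linarith
      then have "L * (1 + \<bar>\<xi>\<bar> + \<bar>v\<bar>) * \<bar>\<xi> - v\<bar> \<le> L * (1 + 2 * \<bar>v\<bar> + W (x, z) * exp (norm z)) * \<bar>w - v\<bar>"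
        using L \<xi>(1) by (intro mult_mono mult_left_mono) auto
      then show ?thesis using lip[of \<xi> v] by linarith
    qed
    then have "\<bar>g' \<xi> - g' v\<bar> * \<bar>w - v\<bar> \<le> L * (1 + 2 * \<bar>v\<bar> + W (x, z) * exp (norm z)) * \<bar>w - v\<bar> * \<bar>w - v\<bar>"
      by (rule mult_right_mono) simp
    also have "\<dots> = L * (1 + 2 * \<bar>v\<bar> + W (x, z) * exp (norm z)) * (\<bar>w - v\<bar>)\<^sup>2"
      by (simp only: power2_eq_square mult.assoc)
    also have "\<dots> \<le> L * (1 + 2 * \<bar>v\<bar> + W (x, z) * exp (norm z)) * (W (x, z) * norm z)\<^sup>2"
      using L wv W0 by (intro mult_left_mono power_mono) auto
    finally have A: "\<bar>g' \<xi> - g' v\<bar> * \<bar>w - v\<bar> \<le> L * (1 + 2 * \<bar>v\<bar> + W (x, z) * exp (norm z)) * (W (x, z))\<^sup>2 * (norm z)\<^sup>2"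
      by (simp add: power_mult_distrib mult.assoc)
    have Bd: "\<bar>g' v\<bar> * \<bar>w - v - DF x \<bullet> z\<bar> \<le> b * (K * E (x, z) * (norm z)\<^sup>2)"
      using R g'2[of v] b by (intro mult_mono) auto
    have "g w - g v - g' v * (DF x \<bullet> z) = (g' \<xi> - g' v) * (w - v) + g' v * (w - v - DF x \<bullet> z)"
      using \<xi>(2) by (simp add: algebra_simps)
    then have "\<bar>g w - g v - g' v * (DF x \<bullet> z)\<bar> \<le> \<bar>g' \<xi> - g' v\<bar> * \<bar>w - v\<bar> + \<bar>g' v\<bar> * \<bar>w - v - DF x \<bullet> z\<bar>"
      using abs_triangle_ineq[of "(g' \<xi> - g' v) * (w - v)" "g' v * (w - v - DF x \<bullet> z)"] by (simp only: abs_mult)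
    also have "\<dots> \<le> B (x, z) * (norm z)\<^sup>2"
      using A Bd unfolding B_def fst_conv snd_conv v_def[symmetric] by (simp add: distrib_right mult.assoc)
    finally show ?thesis by (simp add: v_def w_def)
  qed
  show ?thesis
    by (rule tameI[OF _ _ eD eB rem]) (auto intro: that)
qed

lemma tame_affine:
  assumes F: "tame K l F DF"
  shows "tame (\<bar>a\<bar> * K) l (\<lambda>x. a * F x + c) (\<lambda>x. a *\<^sub>R DF x)"
proof -
  note D = tameD[OF F]
  note [measurable] = D(3,4)
  have "\<bar>a * F (x + z) + c - (a * F x + c) - (a *\<^sub>R DF x) \<bullet> z\<bar> \<le> \<bar>a\<bar> * K * exp (l * (norm x + norm z)) * (norm z)\<^sup>2" for x z
  proof -
    have "a * F (x + z) + c - (a * F x + c) - (a *\<^sub>R DF x) \<bullet> z = a * (F (x + z) - F x - DF x \<bullet> z)"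
      by (simp add: algebra_simps)
    then show ?thesis
      using mult_left_mono[OF D(6)[of x z], of "\<bar>a\<bar>"] by (simp add: abs_mult mult.assoc)
  qed
  moreover have "norm (a *\<^sub>R DF x) \<le> \<bar>a\<bar> * K * exp (l * norm x)" for x
    using mult_left_mono[OF D(5)[of x], of "\<bar>a\<bar>"] by (simp add: mult.assoc)
  moreover have "(\<lambda>x. a * F x + c) \<in> borel_measurable borel" "(\<lambda>x. a *\<^sub>R DF x) \<in> borel_measurable borel"
    by measurable
  ultimately show ?thesis using D(1,2) unfolding tame_def by (intro conjI allI) simp_all
qed

lemma gauss_abs_expectation_le:
  fixes f :: "'a::euclidean_space \<Rightarrow> real"
  assumes f: "exp_bounded f" and [measurable]: "f \<in> borel_measurable borel"
    and v: "(\<integral>x. (f x)\<^sup>2 \<partial>gauss) \<le> b\<^sup>2" "0 \<le> b"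
  shows "(\<integral>x. \<bar>f x\<bar> \<partial>gauss) \<le> b"
proof (rule power2_le_imp_le[OF _ v(2)])
  have i: "integrable gauss (\<lambda>x. \<bar>f x\<bar>)" "integrable gauss (\<lambda>x. \<bar>f x\<bar>\<^sup>2)"
    by (intro integrable_exp_bounded exp_bounded_intros f; measurable)+
  have "0 \<le> gauss.variance (\<lambda>x. \<bar>f x\<bar>)" by (rule gauss.variance_positive)
  then show "(\<integral>x. \<bar>f x\<bar> \<partial>gauss)\<^sup>2 \<le> b\<^sup>2" using gauss.variance_eq[OF i] v(1) unfolding power2_abs by linarith
qed

context closed_cone begin

text \<open>With \<open>S = (sqproj - \<delta>) / \<sigma>\<close>, the left hand side is the absolute value of \<open>E (g' S) - E (S g S)\<close> for
the solution \<open>g\<close> of Stein's equation. Both \<open>E (S g S)\<close> and \<open>1 = E (S\<^sup>2)\<close> are covariances and hence limits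
of averages; multiplying the second by \<open>E (g' S)\<close> and subtracting leaves terms
\<open>(4 / \<sigma>\<^sup>2) E (g' S (t - E t))\<close>, each at most \<open>(4 / \<sigma>\<^sup>2) 2 (2 sqrt \<delta>)\<close> by \<open>variance_proj_inner\<close>.\<close>
lemma stein_bound_standardized:
  fixes h :: "real \<Rightarrow> real"
  assumes pos: "0 < \<delta>"
    and lip: "\<And>v w. \<bar>h v - h w\<bar> \<le> L * \<bar>v - w\<bar>" and h01: "\<And>v. 0 \<le> h v" "\<And>v. h v \<le> 1"
  shows "\<bar>(\<integral>x. h ((sqproj x - \<delta>) / sqrt var) \<partial>gauss) - (\<integral>y. \<phi> y * h y \<partial>lborel)\<bar> \<le> 16 * sqrt \<delta> / var"
proof -
  have var: "0 < var" using variance_lower pos by linarith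
  define \<sigma> where "\<sigma> = sqrt var"
  have \<sigma>: "0 < \<sigma>" "\<sigma> * \<sigma> = var" using var by (auto simp: \<sigma>_def)
  have L: "0 \<le> L" using lip[of 0 1] by simp
  note conth = lipschitz_imp_borel(1)[OF lip]
  define m where "m = (\<integral>y. \<phi> y * h y \<partial>lborel)"
  obtain g g' where g: "\<And>v. (g has_real_derivative g' v) (at v)"
    and g': "\<And>v. g' v = v * g v + h v - m" and g'2: "\<And>v. \<bar>g' v\<bar> \<le> 2"
    using stein_solution[OF conth h01] unfolding m_def by blast
  have contg: "continuous_on UNIV g"
    by (intro continuous_at_imp_continuous_on ballI DERIV_isCont[OF g])
  have [measurable]: "g \<in> borel_measurable borel" "h \<in> borel_measurable borel"
    by (auto intro: borel_measurable_continuous_onI contg conth)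
  have g'_eq: "g' = (\<lambda>v. v * g v + h v - m)" using g' by auto
  have [measurable]: "g' \<in> borel_measurable borel" unfolding g'_eq by measurable
  have glip: "\<bar>g v - g w\<bar> \<le> 2 * \<bar>v - w\<bar>" for v w
  proof -
    have "norm (g v - g w) \<le> 2 * norm (v - w)"
      by (rule field_differentiable_bound[of UNIV g g']) (use g g'2 in auto)
    then show ?thesis by simp
  qed
  have g'lip: "\<bar>g' v - g' w\<bar> \<le> (\<bar>g 0\<bar> + 2 + L) * (1 + \<bar>v\<bar> + \<bar>w\<bar>) * \<bar>v - w\<bar>" for v w
  proof -
    have gv: "\<bar>g v\<bar> \<le> \<bar>g 0\<bar> + 2 * \<bar>v\<bar>" using glip[of v 0] by simp
    have "g' v - g' w = (v - w) * g v + w * (g v - g w) + (h v - h w)"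
      by (simp add: g' algebra_simps)
    then have "\<bar>g' v - g' w\<bar> \<le> \<bar>v - w\<bar> * \<bar>g v\<bar> + \<bar>w\<bar> * \<bar>g v - g w\<bar> + \<bar>h v - h w\<bar>"
      using abs_triangle_ineq[of "(v - w) * g v + w * (g v - g w)" "h v - h w"]
        abs_triangle_ineq[of "(v - w) * g v" "w * (g v - g w)"] by (simp only: abs_mult)
    also have "\<dots> \<le> \<bar>v - w\<bar> * (\<bar>g 0\<bar> + 2 * \<bar>v\<bar>) + \<bar>w\<bar> * (2 * \<bar>v - w\<bar>) + L * \<bar>v - w\<bar>"
      using gv glip lip by (intro add_mono mult_left_mono) auto
    also have "\<dots> = (\<bar>g 0\<bar> + 2 * \<bar>v\<bar> + 2 * \<bar>w\<bar> + L) * \<bar>v - w\<bar>" by (simp add: algebra_simps)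
    also have "\<dots> \<le> ((\<bar>g 0\<bar> + 2 + L) * (1 + \<bar>v\<bar> + \<bar>w\<bar>)) * \<bar>v - w\<bar>"
    proof (rule mult_right_mono)
      \<comment> \<open>The product on the right exceeds the sum on the left by exactly this quantity, up to the constant 2.\<close>
      have "0 \<le> (\<bar>g 0\<bar> + L) * (\<bar>v\<bar> + \<bar>w\<bar>)" using L by simp
      then show "\<bar>g 0\<bar> + 2 * \<bar>v\<bar> + 2 * \<bar>w\<bar> + L \<le> (\<bar>g 0\<bar> + 2 + L) * (1 + \<bar>v\<bar> + \<bar>w\<bar>)"
        by (simp add: algebra_simps)
    qed simp
    finally show ?thesis .
  qed
  define S where "S x = (1 / \<sigma>) * sqproj x + (- (\<delta> / \<sigma>))" for x
  have S: "S x = (sqproj x - \<delta>) / \<sigma>" for x by (simp add: S_def diff_divide_distrib)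
  define DS where "DS x = (1 / \<sigma>) *\<^sub>R (2 *\<^sub>R prj x)" for x
  have [measurable]: "S \<in> borel_measurable borel" unfolding S_def[abs_def] by measurable
  have tS: "tame (\<bar>1 / \<sigma>\<bar> * 2) 1 S DS"
    unfolding S_def[abs_def] DS_def[abs_def] by (rule tame_affine[OF tame_sqproj])
  obtain K l where tG: "tame K l (\<lambda>x. g (S x)) (\<lambda>x. g' (S x) *\<^sub>R DS x)"
    using tame_compose[OF tS g _ g'2 g'lip] L by auto
  define K0 where "K0 = max K (\<bar>1 / \<sigma>\<bar> * 2)"
  define l0 where "l0 = max l 1"
  have tS': "tame K0 l0 S DS" and tG': "tame K0 l0 (\<lambda>x. g (S x)) (\<lambda>x. g' (S x) *\<^sub>R DS x)"
    by (auto intro!: tame_mono[OF tS] tame_mono[OF tG] simp: K0_def l0_def)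
  have eS: "exp_bounded S" and eg: "exp_bounded (\<lambda>x. g (S x))"
    using tame_exp_bounded[OF tS] tame_exp_bounded[OF tG] .
  have eg': "exp_bounded (\<lambda>x. g' (S x))"
    by (rule exp_bounded_mono[OF exp_bounded_const[of "2::real"]]) (use g'2 in auto)
  have i: "integrable gauss (\<lambda>x. g' (S x))" "integrable gauss (\<lambda>x. S x * g (S x))"
    by (intro integrable_exp_bounded exp_bounded_mult eS eg eg'; measurable)+
  have S0: "(\<integral>x. S x \<partial>gauss) = 0"
    unfolding S_def using integrable_sqproj by (simp add: \<delta>_def[symmetric])
  have S1: "(\<integral>x. S x * S x \<partial>gauss) = 1"
  proof -
    have "(\<integral>x. S x * S x \<partial>gauss) = (\<integral>x. (1 / var) * ((sqproj x)\<^sup>2 - 2 * \<delta> * sqproj x + \<delta>\<^sup>2) \<partial>gauss)"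
      unfolding S by (intro expectation_cong refl)
        (simp add: \<sigma>(2)[symmetric] power2_eq_square algebra_simps diff_divide_distrib add_divide_distrib)
    also have "\<dots> = (1 / var) * ((\<integral>x. (sqproj x)\<^sup>2 \<partial>gauss) - 2 * \<delta> * \<delta> + \<delta>\<^sup>2)"
      using integrable_sqproj by (simp add: \<delta>_def[symmetric])
    also have "\<dots> = (1 / var) * var" by (simp add: var_def power2_eq_square)
    finally show ?thesis using var by simp
  qed
  define Eg where "Eg = (\<integral>x. g' (S x) \<partial>gauss)"
  define X where "X s = (\<lambda>p :: 'a \<times> 'a. mix s (fst p) (snd p))" for s :: real
  \<comment> \<open>The terms of the covariance formula for the pairs \<open>g S\<close>, \<open>S\<close> and \<open>S\<close>, \<open>S\<close>.\<close>
  define A where "A s = (\<integral>p. g' (S (fst p)) *\<^sub>R DS (fst p) \<bullet> DS (X s p) \<partial>gauss)" for s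
  define B where "B s = (\<integral>p. DS (fst p) \<bullet> DS (X s p) \<partial>gauss)" for s
  have AB: "\<bar>A s - B s * Eg\<bar> \<le> 16 * sqrt \<delta> / var" if s: "0 \<le> s" "s \<le> 1" for s
  proof -
    define t where "t p = prj (fst p) \<bullet> prj (X s p)" for p
    define E where "E = (\<integral>p. t p \<partial>gauss)"
    have [measurable]: "t \<in> borel_measurable borel" unfolding t_def[abs_def] X_def by measurable
    have et: "exp_bounded t" unfolding t_def[abs_def] X_def
      by (intro exp_bounded_inner exp_bounded_fst[OF exp_bounded_proj] exp_bounded_comb[OF exp_bounded_proj])
    note eg1 = exp_bounded_fst[OF eg', where 'c='a]
    have it: "integrable gauss t" "integrable gauss (\<lambda>p. (t p)\<^sup>2)"
      "integrable gauss (\<lambda>p. g' (S (fst p)) * t p)" "integrable gauss (\<lambda>p. g' (S (fst p)) * (t p - E))"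
      "integrable gauss (\<lambda>p. 2 * \<bar>t p - E\<bar>)" "integrable (gauss :: ('a \<times> 'a) measure) (\<lambda>p. g' (S (fst p)))"
      by (intro integrable_exp_bounded exp_bounded_intros et eg1; measurable)+
    have DD: "DS x \<bullet> DS y = 4 / var * (prj x \<bullet> prj y)" for x y
      by (simp add: DS_def \<sigma>(2)[symmetric])
    have A: "A s = 4 / var * (\<integral>p. g' (S (fst p)) * t p \<partial>gauss)"
      unfolding A_def by (simp add: DD t_def mult.left_commute)
    have Bs: "B s = 4 / var * E"
      unfolding B_def E_def by (simp add: DD t_def[abs_def])
    have Eg2: "(\<integral>p. g' (S (fst p)) \<partial>(gauss :: ('a \<times> 'a) measure)) = Eg"
      unfolding Eg_def by (rule integral_gauss_fst[OF eg']) measurable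
    have "(\<integral>p. (t p - E)\<^sup>2 \<partial>gauss) = (\<integral>p. (t p)\<^sup>2 \<partial>gauss) - E\<^sup>2"
      unfolding E_def by (rule gauss.variance_eq[OF it(1,2)])
    also have "\<dots> \<le> (2 * sqrt \<delta>)\<^sup>2"
      using variance_proj_inner[OF s] pos by (simp add: t_def X_def E_def power_mult_distrib)
    finally have T: "(\<integral>p. \<bar>t p - E\<bar> \<partial>gauss) \<le> 2 * sqrt \<delta>"
      using pos by (intro gauss_abs_expectation_le exp_bounded_intros et) auto
    have "(\<integral>p. g' (S (fst p)) * (t p - E) \<partial>gauss) = (\<integral>p. g' (S (fst p)) * t p \<partial>gauss) - E * Eg"
    proof -
      have "(\<integral>p. g' (S (fst p)) * (t p - E) \<partial>gauss) = (\<integral>p. g' (S (fst p)) * t p - E * g' (S (fst p)) \<partial>gauss)"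
        by (intro expectation_cong refl) (simp add: algebra_simps)
      then show ?thesis using it(3,6) by (simp add: Eg2)
    qed
    then have "A s - B s * Eg = 4 / var * (\<integral>p. g' (S (fst p)) * (t p - E) \<partial>gauss)"
      unfolding A Bs by (simp add: right_diff_distrib)
    moreover have "norm (\<integral>p. g' (S (fst p)) * (t p - E) \<partial>gauss) \<le> (\<integral>p. 2 * \<bar>t p - E\<bar> \<partial>gauss)"
      using it g'2 by (intro expectation_norm_bound) (auto simp: abs_mult mult_right_mono)
    then have "\<bar>\<integral>p. g' (S (fst p)) * (t p - E) \<partial>gauss\<bar> \<le> 4 * sqrt \<delta>"
      using T by simp
    ultimately have "\<bar>A s - B s * Eg\<bar> \<le> 4 / var * (4 * sqrt \<delta>)"
      using var by (simp add: abs_mult divide_right_mono)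
    then show ?thesis by simp
  qed
  have lA: "(\<lambda>n. (1 / real n) * (\<Sum>k=1..n. A (real k / real n))) \<longlonglongrightarrow> (\<integral>x. S x * g (S x) \<partial>gauss)"
    using gauss_covariance[OF tG' tS'] unfolding S0 by (simp add: A_def X_def mult.commute)
  have lB: "(\<lambda>n. (1 / real n) * (\<Sum>k=1..n. B (real k / real n))) \<longlonglongrightarrow> 1"
    using gauss_covariance[OF tS' tS'] unfolding S0 S1 by (simp add: B_def X_def)
  have "\<bar>(1 / real n) * (\<Sum>k=1..n. A (real k / real n)) - (1 / real n) * (\<Sum>k=1..n. B (real k / real n)) * Eg\<bar>
      \<le> 16 * sqrt \<delta> / var" if n: "1 \<le> n" for n
  proof -
    have eq: "(1 / real n) * (\<Sum>k=1..n. A (real k / real n)) - (1 / real n) * (\<Sum>k=1..n. B (real k / real n)) * Eg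
      = (1 / real n) * (\<Sum>k=1..n. A (real k / real n) - B (real k / real n) * Eg)"
      by (simp add: sum_subtractf sum_distrib_right right_diff_distrib diff_divide_distrib)
    have "\<bar>\<Sum>k=1..n. A (real k / real n) - B (real k / real n) * Eg\<bar> \<le> (\<Sum>k=1..n. 16 * sqrt \<delta> / var)"
      using n by (intro order_trans[OF sum_abs] sum_mono AB) auto
    then show ?thesis unfolding eq using n by (simp add: abs_mult field_simps)
  qed
  then have "\<bar>(\<integral>x. S x * g (S x) \<partial>gauss) - 1 * Eg\<bar> \<le> 16 * sqrt \<delta> / var"
    by (intro LIMSEQ_le_const2[OF tendsto_rabs[OF tendsto_diff[OF lA tendsto_mult[OF lB tendsto_const]]]] exI[of _ 1]) auto
  moreover have "(\<integral>x. h (S x) \<partial>gauss) - m = Eg - (\<integral>x. S x * g (S x) \<partial>gauss)"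
  proof -
    have "(\<integral>x. h (S x) \<partial>gauss) = (\<integral>x. g' (S x) - S x * g (S x) + m \<partial>gauss)"
      by (simp add: g')
    then show ?thesis using i by (simp add: Eg_def)
  qed
  ultimately show ?thesis unfolding m_def[symmetric] \<sigma>_def[symmetric] S[symmetric] by linarith
qed

end

lemma integral_normal_density_scale:
  fixes h :: "real \<Rightarrow> real"
  assumes "0 < \<sigma>" and [measurable]: "h \<in> borel_measurable borel"
  shows "(\<integral>y. normal_density 0 \<sigma> y * h y \<partial>lborel) = (\<integral>y. \<phi> y * h (\<sigma> * y) \<partial>lborel)"
proof -
  have eq: "\<sigma> * normal_density 0 \<sigma> (\<sigma> * y) = \<phi> y" for y
    using assms(1) by (simp add: normal_density_def real_sqrt_mult power_mult_distrib)
  have "(\<integral>y. normal_density 0 \<sigma> y * h y \<partial>lborel) = \<sigma> * (\<integral>y. normal_density 0 \<sigma> (\<sigma> * y) * h (\<sigma> * y) \<partial>lborel)"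
    using assms(1) by (subst lborel_integral_real_affine[where c=\<sigma> and t=0]) auto
  also have "\<dots> = (\<integral>y. \<sigma> * normal_density 0 \<sigma> (\<sigma> * y) * h (\<sigma> * y) \<partial>lborel)"
    by (simp add: mult.assoc)
  finally show ?thesis by (simp add: eq)
qed

context closed_cone begin

lemma stein_bound:
  fixes h :: "real \<Rightarrow> real"
  assumes pos: "0 < \<delta>"
    and lip: "\<And>v w. \<bar>h v - h w\<bar> \<le> L * \<bar>v - w\<bar>" and h01: "\<And>v. 0 \<le> h v" "\<And>v. h v \<le> 1"
  shows "\<bar>(\<integral>x. h (sqproj x - \<delta>) \<partial>gauss) - (\<integral>y. normal_density 0 (sqrt var) y * h y \<partial>lborel)\<bar> \<le> 16 * sqrt \<delta> / var"
proof -
  have "0 < var" using variance_lower pos by linarith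
  then have \<sigma>: "0 < sqrt var" by simp
  note hm = lipschitz_imp_borel(2)[OF lip]
  have lip': "\<bar>h (sqrt var * v) - h (sqrt var * w)\<bar> \<le> (L * sqrt var) * \<bar>v - w\<bar>" for v w
  proof -
    have "\<bar>sqrt var * v - sqrt var * w\<bar> = sqrt var * \<bar>v - w\<bar>"
      using \<sigma> by (simp only: right_diff_distrib[symmetric] abs_mult abs_of_pos)
    then show ?thesis using lip[of "sqrt var * v" "sqrt var * w"] by (simp add: mult.assoc)
  qed
  have cancel: "sqrt var * ((sqproj x - \<delta>) / sqrt var) = sqproj x - \<delta>" for x
    using \<sigma> by simp
  show ?thesis
    using stein_bound_standardized[OF pos lip' h01]
    unfolding cancel integral_normal_density_scale[OF \<sigma> hm] .
qed

lemma tv_bound: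
  assumes pos: "0 < \<delta>" and P: "prob_space P" and g: "distributed P lborel g std_gaussian_density"
    and R: "prob_space R" and N: "distributed R lborel N (normal_density 0 (sqrt var))"
  shows "tv_dist P (\<lambda>\<omega>. sqproj (g \<omega>) - \<delta>) R N \<le> 16 * sqrt \<delta> / var"
proof -
  interpret P: prob_space P by fact
  interpret R: prob_space R by fact
  have gm [measurable]: "g \<in> borel_measurable P" and Nm [measurable]: "N \<in> borel_measurable R"
    using distributed_measurable[OF g] distributed_measurable[OF N] by auto
  have dg: "distr P borel g = gauss"
    using distributed_distr_eq_density[OF g] by (simp add: gauss_def cong: distr_cong)
  let ?\<mu> = "distr P borel (\<lambda>\<omega>. sqproj (g \<omega>) - \<delta>)" and ?\<nu> = "distr R borel N"
  have B: "\<bar>measure ?\<mu> A - measure ?\<nu> A\<bar> \<le> 16 * sqrt \<delta> / var" if A: "A \<in> sets borel" for A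
  proof (rule lipschitz_test_imp_tv[OF _ _ _ _ _ A])
    show "prob_space ?\<mu>" "prob_space ?\<nu>"
      by (auto intro!: P.prob_space_distr R.prob_space_distr)
    fix h :: "real \<Rightarrow> real" and L
    assume h: "\<And>v w. \<bar>h v - h w\<bar> \<le> L * \<bar>v - w\<bar>" "\<And>v. 0 \<le> h v" "\<And>v. h v \<le> 1"
    note [measurable] = lipschitz_imp_borel(2)[OF h(1)]
    have "(\<integral>v. h v \<partial>?\<mu>) = (\<integral>x. h (sqproj x - \<delta>) \<partial>gauss)"
      unfolding dg[symmetric] by (simp add: integral_distr)
    moreover have "(\<integral>v. h v \<partial>?\<nu>) = (\<integral>y. normal_density 0 (sqrt var) y * h y \<partial>lborel)"
      using distributed_integral[OF N, of h] by (simp add: integral_distr)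
    ultimately show "\<bar>(\<integral>v. h v \<partial>?\<mu>) - (\<integral>v. h v \<partial>?\<nu>)\<bar> \<le> 16 * sqrt \<delta> / var"
      using stein_bound[OF pos h] by simp
  qed auto
  show ?thesis
    unfolding tv_dist_def
  proof (rule cSUP_least)
    fix A :: "real set" assume A: "A \<in> sets borel"
    have "measure ?\<mu> A = measure P {\<omega> \<in> space P. sqproj (g \<omega>) - \<delta> \<in> A}"
      using A by (subst measure_distr) (auto intro!: arg_cong[where f="measure P"])
    moreover have "measure ?\<nu> A = measure R {\<omega> \<in> space R. N \<omega> \<in> A}"
      using A by (subst measure_distr) (auto intro!: arg_cong[where f="measure R"])
    ultimately show "\<bar>measure P {\<omega> \<in> space P. sqproj (g \<omega>) - \<delta> \<in> A} - measure R {\<omega> \<in> space R. N \<omega> \<in> A}\<bar>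
        \<le> 16 * sqrt \<delta> / var"
      using B[OF A] by simp
  qed auto
qed

end

theorem proposition3p1:
  fixes C :: "(real ^ 'n) set"
    and P :: "'p measure" and g :: "'p \<Rightarrow> real ^ 'n"
    and Q :: "'q measure" and V :: "'q \<Rightarrow> nat"
    and R :: "'r measure" and N :: "'r \<Rightarrow> real"
  assumes "closed C" and "convex_cone C" and "C \<noteq> UNIV"
    and "prob_space P" and "distributed P lborel g std_gaussian_density"
  shows
    "let G = (\<lambda>\<omega>. (norm (closest_point C (g \<omega>)))\<^sup>2);
         \<delta> = prob_space.expectation P G;
         \<sigma>2 = prob_space.variance P G;
         \<tau>2 = prob_space.variance Q (\<lambda>\<omega>. real (V \<omega>));
         N_normal = (prob_space R \<and> distributed R lborel N (normal_density 0 (sqrt \<sigma>2)))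
     in (intrinsic_volume_variable C Q V \<longrightarrow> \<tau>2 \<le> 2 * \<delta>)
      \<and> 2 * \<delta> \<le> \<sigma>2 \<and> \<sigma>2 \<le> 4 * \<delta>
      \<and> (\<delta> > 0 \<longrightarrow>
           (N_normal \<longrightarrow> tv_dist P (\<lambda>\<omega>. G \<omega> - \<delta>) R N \<le> 16 * sqrt \<delta> / \<sigma>2)
           \<and> 16 * sqrt \<delta> / \<sigma>2 \<le> 8 / sqrt \<delta>)
      \<and> (polar_cone C = uminus ` C \<longrightarrow> N_normal \<longrightarrow>
           tv_dist P (\<lambda>\<omega>. G \<omega> - \<delta>) R N \<le> 8 * sqrt 2 / sqrt (real CARD('n)))"
proof -
  interpret closed_cone C by standard fact+
  interpret P: prob_space P by fact
  note g = assms(5)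
  have gm [measurable]: "g \<in> borel_measurable P"
    using distributed_measurable[OF g] by simp
  have dg: "distr P borel g = gauss"
    using distributed_distr_eq_density[OF g] by (simp add: gauss_def cong: distr_cong)
  have E: "(\<integral>\<omega>. f (g \<omega>) \<partial>P) = (\<integral>x. f x \<partial>gauss)" if [measurable]: "f \<in> borel_measurable borel" for f :: "real ^ 'n \<Rightarrow> real"
    unfolding dg[symmetric] by (simp add: integral_distr)
  have mean: "(\<integral>\<omega>. sqproj (g \<omega>) \<partial>P) = \<delta>"
    unfolding \<delta>_def by (rule E) measurable
  have variance: "(\<integral>\<omega>. (sqproj (g \<omega>) - \<delta>)\<^sup>2 \<partial>P) = var"
    using E[of "\<lambda>x. (sqproj x - \<delta>)\<^sup>2"] gauss.variance_eq[OF integrable_sqproj]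
    by (simp add: var_def \<delta>_def)
  have rate: "16 * sqrt \<delta> / var \<le> 8 / sqrt \<delta>" if pos: "0 < \<delta>"
  proof -
    have "16 * sqrt \<delta> / var \<le> 16 * sqrt \<delta> / (2 * \<delta>)"
      using variance_lower pos by (intro divide_left_mono) auto
    also have "\<dots> = 8 / sqrt \<delta>"
      using pos by (simp add: real_div_sqrt field_simps)
    finally show ?thesis .
  qed
  have tau: "prob_space.variance Q (\<lambda>\<omega>. real (V \<omega>)) \<le> 2 * \<delta>" if "intrinsic_volume_variable C Q V"
    using variance_intrinsic_volumes[OF that] variance_upper by simp
  have self_dual: "8 / sqrt \<delta> = 8 * sqrt 2 / sqrt (real CARD('n))" "0 < \<delta>" if "polar_cone C = uminus ` C"
    unfolding delta_self_dual[OF that] by (simp_all add: real_sqrt_divide)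
  show ?thesis
    unfolding Let_def sqproj_def[symmetric] mean variance
  proof (intro conjI impI)
    assume sd: "polar_cone C = uminus ` C"
      and R: "prob_space R \<and> distributed R lborel N (normal_density 0 (sqrt var))"
    have "tv_dist P (\<lambda>\<omega>. sqproj (g \<omega>) - \<delta>) R N \<le> 16 * sqrt \<delta> / var"
      using R by (intro tv_bound[OF self_dual(2)[OF sd] assms(4) g]) auto
    also have "\<dots> \<le> 8 / sqrt \<delta>"
      by (rule rate[OF self_dual(2)[OF sd]])
    finally show "tv_dist P (\<lambda>\<omega>. sqproj (g \<omega>) - \<delta>) R N \<le> 8 * sqrt 2 / sqrt (real CARD('n))"
      unfolding self_dual(1)[OF sd] .
  next
    assume "0 < \<delta>" and R: "prob_space R \<and> distributed R lborel N (normal_density 0 (sqrt var))"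
    then show "tv_dist P (\<lambda>\<omega>. sqproj (g \<omega>) - \<delta>) R N \<le> 16 * sqrt \<delta> / var"
      by (intro tv_bound[OF _ assms(4) g]) simp_all
  qed (fact tau variance_lower variance_upper rate)+
qed

end
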